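(* Assume the setting described in the context (domains $\Omega,\Omega_\ell,\Omega_{n\ell}\subset\mathbb{R}^N$, number $\delta>0$, kernels $J$ and $G$, with all the properties listed there). Let $f\in L^2(\Omega)$ with $\int_\Omega f(x)\,dx=0$, and define, for $u\in H_{Neu}$, $$E_{Neu}(u)=\int_{\Omega_\ell}\frac{|\nabla u(x)|^2}{2}\,dx+\frac12\int_{\Omega_{n\ell}}\int_{\Omega_{n\ell}}J(x-y)|u(y)-u(x)|^2\,dy\,dx+\frac12\int_{\Omega_{n\ell}}\int_{\Omega_\ell}G(x,y)|u(y)-u(x)|^2\,dx\,dy-\int_\Omega f(x)u(x)\,dx,$$ where in the third term $x\in\Omega_\ell$ and $y\in\Omega_{n\ell}$. Then there exists a unique minimizer of $E_{Neu}$ in $H_{Neu}$. Moreover, the minimizer $u$ is a weak solution (in the sense defined in the context) of the problem $$\begin{cases}-f(x)=\Delta u(x)+\displaystyle\int_{\Omega_{n\ell}}G(x,y)(u(y)-u(x))\,dy, & x\in\Omega_\ell,\\[4pt] \dfrac{\partial u}{\partial\eta}(x)=0,& x\in\partial\Omega_\ell,\end{cases}$$ together with $$-f(x)=2\int_{\Omega_{n\ell}}J(x-y)(u(y)-u(x))\,dy+\int_{\Omega_\ell}G(y,x)(u(y)-u(x))\,dy,\qquad x\in\Omega_{n\ell}.$$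
   Context: Setting. $\Omega\subset\mathbb{R}^N$ is a bounded open domain; $\Omega_\ell,\Omega_{n\ell}\subset\Omega$ are disjoint nonempty open sets with $\Omega=(\overline{\Omega_\ell}\cup\overline{\Omega_{n\ell}})^\circ$. A number $\delta>0$ is fixed, the same in all the conditions below. An open set $D\subset\mathbb{R}^N$ is called $\delta$-connected if it cannot be written as a disjoint union of two nonempty (relatively) open sets that are at distance greater than or equal to $\delta$. Assumptions: (1) $\Omega_\ell$ is connected and has Lipschitz boundary. (2) $\Omega_{n\ell}$ is $\delta$-connected. (J) $J:\mathbb{R}^N\to\mathbb{R}$ is a nonnegative measurable function, symmetric ($J(z)=J(-z)$). (J1) There is $C>0$ such that $J(z)>C$ for all $z$ with $\|z\|\le2\delta$. (J2) The operator $T_J(u)(x)=\int_{\Omega_{n\ell}}J(x-y)u(y)\,dy$ is a compact operator in $L^2(\Omega_{n\ell})$. (G1) $G:\Omega_\ell\times\Omega_{n\ell}\to\mathbb{R}$ is nonnegative and measurable, and there is $C>0$ such that for all $(x,y)\in\Omega_\ell\times\Omega_{n\ell}$, $G(x,y)>C$ whenever $\|x-y\|\le2\delta$. (P1) $\mathrm{dist}(\Omega_\ell,\Omega_{n\ell})<\delta$. Function space: $H_{Neu}=\{u\in L^2(\Omega):\ u|_{\Omega_\ell}\in H^1(\Omega_\ell),\ \int_\Omega u(x)\,dx=0\}$. The functional takes values in $(-\infty,+\infty]$. $\eta$ denotes the outward unit normal to $\partial\Omega_\ell$. Weak solution: $u\in H_{Neu}$ (with finite energy) is a weak solution of the coupled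 problem if for every smooth $\varphi$ (restriction to $\Omega$ of a $C^\infty(\mathbb{R}^N)$ function) with $\int_\Omega\varphi=0$, and for which the quadratic part of the energy is finite, $$\int_\Omega f\varphi=\int_{\Omega_\ell}\nabla u\cdot\nabla\varphi+\int_{\Omega_{n\ell}}\int_{\Omega_{n\ell}}J(x-y)(u(y)-u(x))(\varphi(y)-\varphi(x))\,dy\,dx+\int_{\Omega_{n\ell}}\int_{\Omega_\ell}G(x,y)(u(y)-u(x))(\varphi(y)-\varphi(x))\,dx\,dy,$$ with $x\in\Omega_\ell$, $y\in\Omega_{n\ell}$ in the last integral.
   Formalization: The formal theorem additionally assumes that Ω minus (Ω_ℓ ∪ Ω_{nℓ}) has Lebesgue measure zero; without this the energy does not control u on that set, and existence or uniqueness of the minimizer always fails. *)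

theory Defs
  imports "HOL-Analysis.Analysis"
begin

(* The ambient space R^N is an arbitrary euclidean space 'a; functions on a set D are total
   functions on 'a whose values outside D are irrelevant. "Measurable" means Lebesgue measurable.
   Elements of function spaces are honest functions, so uniqueness is up to null sets. *)

section \<open>Sets\<close>

definition lipschitz_boundary :: "'a::euclidean_space set \<Rightarrow> bool" where
  "lipschitz_boundary D \<longleftrightarrow>
     (\<forall>p\<in>frontier D. \<exists>r>0. \<exists>e \<gamma> L. norm e = 1 \<and> L-lipschitz_on {z. z \<bullet> e = 0} \<gamma> \<and>
        D \<inter> ball p r = {x \<in> ball p r. \<gamma> (x - (x \<bullet> e) *\<^sub>R e) < x \<bullet> e})"

definition delta_connected :: "real \<Rightarrow> 'a::metric_space set \<Rightarrow> bool" where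
  "delta_connected \<delta> D \<longleftrightarrow>
     \<not> (\<exists>A B. openin (top_of_set D) A \<and> openin (top_of_set D) B \<and> A \<noteq> {} \<and> B \<noteq> {} \<and>
          A \<inter> B = {} \<and> A \<union> B = D \<and> \<delta> \<le> setdist A B)"

section \<open>Square integrable functions\<close>

definition L2 :: "'a::euclidean_space set \<Rightarrow> ('a \<Rightarrow> 'b::euclidean_space) set" where
  "L2 D = {u. u \<in> borel_measurable (lebesgue_on D) \<and> integrable (lebesgue_on D) (\<lambda>x. (norm (u x))\<^sup>2)}"

definition L2_norm :: "'a::euclidean_space set \<Rightarrow> ('a \<Rightarrow> 'b::euclidean_space) \<Rightarrow> real" where
  "L2_norm D u = sqrt (\<integral>x. (norm (u x))\<^sup>2 \<partial>lebesgue_on D)"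

(* T is a compact operator on L2 D; used for integral operators, whose linearity is automatic. *)
definition compact_operator_L2 ::
    "'a::euclidean_space set \<Rightarrow> (('a \<Rightarrow> real) \<Rightarrow> ('a \<Rightarrow> real)) \<Rightarrow> bool" where
  "compact_operator_L2 D T \<longleftrightarrow>
     (\<forall>u\<in>L2 D. T u \<in> L2 D) \<and>
     (\<forall>u :: nat \<Rightarrow> 'a \<Rightarrow> real. (\<forall>k. u k \<in> L2 D) \<and> (\<exists>B. \<forall>k. L2_norm D (u k) \<le> B) \<longrightarrow>
        (\<exists>v\<in>L2 D. \<exists>r. strict_mono r \<and>
           (\<lambda>k. L2_norm D (\<lambda>x. T (u (r k)) x - v x)) \<longlonglongrightarrow> 0))"

definition T_op :: "('a \<Rightarrow> real) \<Rightarrow> 'a::euclidean_space set \<Rightarrow> ('a \<Rightarrow> real) \<Rightarrow> 'a \<Rightarrow> real" where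
  "T_op J D u x = (\<integral>y. J (x - y) * u y \<partial>lebesgue_on D)"

(* A Bochner integral that does not converge is 0 in HOL, so convergence of the integral
   defining T_op is required explicitly. *)
definition compact_kernel :: "('a \<Rightarrow> real) \<Rightarrow> 'a::euclidean_space set \<Rightarrow> bool" where
  "compact_kernel J D \<longleftrightarrow>
     (\<forall>u\<in>L2 D. AE x in lebesgue_on D. integrable (lebesgue_on D) (\<lambda>y. J (x - y) * u y)) \<and>
     compact_operator_L2 D (T_op J D)"

section \<open>Smooth functions, weak gradients, \<open>H\<^sup>1\<close>\<close>

fun Ck :: "nat \<Rightarrow> ('a::euclidean_space \<Rightarrow> real) \<Rightarrow> bool" where
  "Ck 0 f \<longleftrightarrow> continuous_on UNIV f"
| "Ck (Suc k) f \<longleftrightarrow>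
     f differentiable_on UNIV \<and> (\<forall>b\<in>Basis. Ck k (\<lambda>x. frechet_derivative f (at x) b))"

definition smooth :: "('a::euclidean_space \<Rightarrow> real) \<Rightarrow> bool" where
  "smooth f \<longleftrightarrow> (\<forall>k. Ck k f)"

definition grad :: "('a::euclidean_space \<Rightarrow> real) \<Rightarrow> 'a \<Rightarrow> 'a" where
  "grad f x = (\<Sum>b\<in>Basis. frechet_derivative f (at x) b *\<^sub>R b)"

definition test_function :: "'a::euclidean_space set \<Rightarrow> ('a \<Rightarrow> real) \<Rightarrow> bool" where
  "test_function D \<phi> \<longleftrightarrow>
     smooth \<phi> \<and> compact (closure {x. \<phi> x \<noteq> 0}) \<and> closure {x. \<phi> x \<noteq> 0} \<subseteq> D"

definition locally_integrable :: "'a::euclidean_space set \<Rightarrow> ('a \<Rightarrow> 'b::euclidean_space) \<Rightarrow> bool" where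
  "locally_integrable D u \<longleftrightarrow> (\<forall>K. compact K \<and> K \<subseteq> D \<longrightarrow> integrable (lebesgue_on K) u)"

definition has_weak_gradient ::
    "'a::euclidean_space set \<Rightarrow> ('a \<Rightarrow> real) \<Rightarrow> ('a \<Rightarrow> 'a) \<Rightarrow> bool" where
  "has_weak_gradient D u g \<longleftrightarrow>
     locally_integrable D u \<and> locally_integrable D g \<and>
     (\<forall>\<phi>. test_function D \<phi> \<longrightarrow> (\<forall>b\<in>Basis.
        (\<integral>x. u x * frechet_derivative \<phi> (at x) b \<partial>lebesgue_on D)
          = - (\<integral>x. (g x \<bullet> b) * \<phi> x \<partial>lebesgue_on D)))"

(* A choice of representative: the weak gradient is unique almost everywhere on an open D. *)
definition weak_grad :: "'a::euclidean_space set \<Rightarrow> ('a \<Rightarrow> real) \<Rightarrow> 'a \<Rightarrow> 'a" where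
  "weak_grad D u = (SOME g. has_weak_gradient D u g)"

definition H1 :: "'a::euclidean_space set \<Rightarrow> ('a \<Rightarrow> real) set" where
  "H1 D = {u \<in> L2 D. \<exists>g\<in>L2 D. has_weak_gradient D u g}"

section \<open>The energy and the coupled problem\<close>

definition H_Neu :: "'a::euclidean_space set \<Rightarrow> 'a set \<Rightarrow> ('a \<Rightarrow> real) set" where
  "H_Neu \<Omega> \<Omega>l = {u \<in> L2 \<Omega>. u \<in> H1 \<Omega>l \<and> (\<integral>x. u x \<partial>lebesgue_on \<Omega>) = 0}"

definition quadratic_energy ::
    "'a::euclidean_space set \<Rightarrow> 'a set \<Rightarrow> ('a \<Rightarrow> real) \<Rightarrow> ('a \<Rightarrow> 'a \<Rightarrow> real) \<Rightarrow> ('a \<Rightarrow> real) \<Rightarrow> ennreal" where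
  "quadratic_energy \<Omega>l \<Omega>n J G u =
     (\<integral>\<^sup>+x. ennreal ((norm (weak_grad \<Omega>l u x))\<^sup>2 / 2) \<partial>lebesgue_on \<Omega>l)
     + 1 / 2 * (\<integral>\<^sup>+x. \<integral>\<^sup>+y. ennreal (J (x - y) * \<bar>u y - u x\<bar>\<^sup>2) \<partial>lebesgue_on \<Omega>n \<partial>lebesgue_on \<Omega>n)
     + 1 / 2 * (\<integral>\<^sup>+y. \<integral>\<^sup>+x. ennreal (G x y * \<bar>u y - u x\<bar>\<^sup>2) \<partial>lebesgue_on \<Omega>l \<partial>lebesgue_on \<Omega>n)"

definition E_Neu ::
    "'a::euclidean_space set \<Rightarrow> 'a set \<Rightarrow> 'a set \<Rightarrow> ('a \<Rightarrow> real) \<Rightarrow> ('a \<Rightarrow> 'a \<Rightarrow> real) \<Rightarrow> ('a \<Rightarrow> real)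
      \<Rightarrow> ('a \<Rightarrow> real) \<Rightarrow> ereal" where
  "E_Neu \<Omega> \<Omega>l \<Omega>n J G f u =
     enn2ereal (quadratic_energy \<Omega>l \<Omega>n J G u) - ereal (\<integral>x. f x * u x \<partial>lebesgue_on \<Omega>)"

definition is_minimizer_Neu ::
    "'a::euclidean_space set \<Rightarrow> 'a set \<Rightarrow> 'a set \<Rightarrow> ('a \<Rightarrow> real) \<Rightarrow> ('a \<Rightarrow> 'a \<Rightarrow> real) \<Rightarrow> ('a \<Rightarrow> real)
      \<Rightarrow> ('a \<Rightarrow> real) \<Rightarrow> bool" where
  "is_minimizer_Neu \<Omega> \<Omega>l \<Omega>n J G f u \<longleftrightarrow>
     u \<in> H_Neu \<Omega> \<Omega>l \<and> (\<forall>v\<in>H_Neu \<Omega> \<Omega>l. E_Neu \<Omega> \<Omega>l \<Omega>n J G f u \<le> E_Neu \<Omega> \<Omega>l \<Omega>n J G f v)"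

(* The integrals below converge absolutely by Cauchy-Schwarz, since u and \<phi> have finite
   quadratic energy. *)
definition weak_solution_Neu ::
    "'a::euclidean_space set \<Rightarrow> 'a set \<Rightarrow> 'a set \<Rightarrow> ('a \<Rightarrow> real) \<Rightarrow> ('a \<Rightarrow> 'a \<Rightarrow> real) \<Rightarrow> ('a \<Rightarrow> real)
      \<Rightarrow> ('a \<Rightarrow> real) \<Rightarrow> bool" where
  "weak_solution_Neu \<Omega> \<Omega>l \<Omega>n J G f u \<longleftrightarrow>
     u \<in> H_Neu \<Omega> \<Omega>l \<and> E_Neu \<Omega> \<Omega>l \<Omega>n J G f u < \<infinity> \<and>
     (\<forall>\<phi>. smooth \<phi> \<and> (\<integral>x. \<phi> x \<partial>lebesgue_on \<Omega>) = 0 \<and> quadratic_energy \<Omega>l \<Omega>n J G \<phi> < \<infinity> \<longrightarrow>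
        (\<integral>x. f x * \<phi> x \<partial>lebesgue_on \<Omega>) =
          (\<integral>x. weak_grad \<Omega>l u x \<bullet> grad \<phi> x \<partial>lebesgue_on \<Omega>l)
          + (\<integral>x. \<integral>y. J (x - y) * (u y - u x) * (\<phi> y - \<phi> x) \<partial>lebesgue_on \<Omega>n \<partial>lebesgue_on \<Omega>n)
          + (\<integral>y. \<integral>x. G x y * (u y - u x) * (\<phi> y - \<phi> x) \<partial>lebesgue_on \<Omega>l \<partial>lebesgue_on \<Omega>n))"

end

theory Submission
  imports Defs
begin

text \<open>
  The quadratic part of the energy makes the functions of mean zero and finite energy into a Hilbert space, on which the
  linear part \<open>\<integral>f u\<close> is a bounded functional. The rest is the classical argument for quadratic functionals: minimizing sequences are
  Cauchy by the parallelogram identity, two minimizers differ by a function of zero energy, and the Euler-Lagrange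
  equation, tested with smooth functions, is the weak formulation. This is the locale \<open>energy_space\<close>. It rests on two facts:
  the Poincare inequality (\<open>poincare\<close>), which bounds the norm of \<open>L2\<close> by the energy, and the completeness of the energy
  space (\<open>V_complete\<close>), which follows from it by extracting almost everywhere convergent subsequences and using Fatou's lemma.

  The Poincare inequality is proved directly, by chaining. For sets \<open>A\<close> and \<open>B\<close>, consider the oscillation \<open>osc u A B\<close>, the integral of
  \<open>(u x - u y)\<^sup>2\<close> over \<open>A \<times> B\<close>, and call the sets linked if it is bounded by a constant times the energy, for all \<open>u\<close>.
  Inserting a third point shows that links compose through sets of positive measure (\<open>linked_trans\<close>), so that it is enough to link
  small sets. If all of \<open>\<Omega>l \<union> \<Omega>n\<close> is linked to itself, the inequality for functions of mean zero follows by expanding the square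
  (\<open>poincare_of_linked\<close>).

  In \<open>\<Omega>l\<close> links come from the estimate of \<open>u (x + v) - u x\<close> by \<open>norm v\<close> times the norm of the gradient
  (\<open>weak_gradient_translation_estimate\<close>). It links a ball to itself, connectedness links all balls, and pieces of the domain at the Lipschitz
  boundary are linked to the interior by shifting them inwards along the graph (\<open>linked_lipschitz_domain\<close>). In \<open>\<Omega>n\<close>, and between \<open>\<Omega>l\<close> and \<open>\<Omega>n\<close>, the lower
  bounds of the kernels link small sets directly when they are less than \<open>\<delta>\<close> apart, and \<open>\<delta>\<close>-connectedness does what connectedness did before
  (\<open>linked_delta_connected\<close>, \<open>linked_coupled_domains\<close>).

  The translation estimate for functions that only have a weak gradient is obtained by duality: the translations are moved to a test function,
  whose derivative is integrated by parts. The passage from test functions to the norm of \<open>L2\<close>, and the uniqueness of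
  weak gradients, use that bounded functions of compact support are bounded limits of test functions (\<open>test_function_approx\<close>).

  All this is carried out with Borel functions on products of Borel measures, so that the theorems of Tonelli and Fubini apply to the kernels. The last two
  parts transfer the result to Lebesgue measurable functions through Borel functions that agree with them almost everywhere.
\<close>

section \<open>Smooth functions and bumps\<close>

lemma Ck_Suc_imp_Ck: "Ck (Suc k) f \<Longrightarrow> Ck k f"
proof (induction k arbitrary: f)
  case 0
  then show ?case by (simp add: differentiable_imp_continuous_on)
next
  case (Suc k)
  then show ?case by (metis Ck.simps(2))
qed

lemma Ck_has_derivative:
  assumes "Ck (Suc k) f"
  shows "(f has_derivative frechet_derivative f (at x)) (at x)"
  using assms by (simp add: differentiable_on_def frechet_derivative_works)

text \<open>Uniqueness of the derivative: any exhibited derivative may stand for the term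
\<open>frechet_derivative\<close> in the recursion that defines \<open>Ck\<close>.\<close>

lemma CkI:
  assumes "\<And>x. (f has_derivative f' x) (at x)" "\<And>b. b \<in> Basis \<Longrightarrow> Ck k (\<lambda>x. f' x b)"
  shows "Ck (Suc k) f"
proof -
  have "frechet_derivative f (at x) = f' x" for x
    using frechet_derivative_at[OF assms(1)] by simp
  then show ?thesis
    using assms by (auto simp: differentiable_on_def intro: differentiableI)
qed

lemma Ck_const: "Ck k (\<lambda>x. c)"
proof (induction k arbitrary: c)
  case (Suc k)
  show ?case by (rule CkI[where f' = "\<lambda>x h. 0"]) (use Suc in auto)
qed simp

lemma Ck_add: "Ck k f \<Longrightarrow> Ck k g \<Longrightarrow> Ck k (\<lambda>x. f x + g x)"
proof (induction k arbitrary: f g)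
  case 0 then show ?case by (simp add: continuous_on_add)
next
  case (Suc k)
  show ?case
    by (rule CkI[OF has_derivative_add[OF Ck_has_derivative[OF Suc.prems(1)] Ck_has_derivative[OF Suc.prems(2)]]])
      (use Suc in auto)
qed

lemma Ck_mult: "Ck k f \<Longrightarrow> Ck k g \<Longrightarrow> Ck k (\<lambda>x. f x * g x)"
proof (induction k arbitrary: f g)
  case 0 then show ?case by (simp add: continuous_on_mult)
next
  case (Suc k)
  show ?case
    by (rule CkI[OF has_derivative_mult[OF Ck_has_derivative[OF Suc.prems(1)] Ck_has_derivative[OF Suc.prems(2)]]])
      (use Suc.IH Suc.prems Ck_Suc_imp_Ck[OF Suc.prems(1)] Ck_Suc_imp_Ck[OF Suc.prems(2)] in \<open>auto intro!: Ck_add\<close>)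
qed

lemma Ck_bounded_linear: "bounded_linear f \<Longrightarrow> Ck k f"
proof (cases k)
  case (Suc n)
  assume f: "bounded_linear f"
  show ?thesis unfolding Suc
    by (rule CkI[where f' = "\<lambda>x. f"]) (use f Ck_const in \<open>auto intro: bounded_linear_imp_has_derivative\<close>)
qed (simp add: linear_continuous_on)

lemma smooth_const: "smooth (\<lambda>x. c)"
  and smooth_add: "smooth f \<Longrightarrow> smooth g \<Longrightarrow> smooth (\<lambda>x. f x + g x)"
  and smooth_mult: "smooth f \<Longrightarrow> smooth g \<Longrightarrow> smooth (\<lambda>x. f x * g x)"
  by (auto simp: smooth_def intro: Ck_const Ck_add Ck_mult)

lemma smooth_sum: "finite I \<Longrightarrow> (\<And>i. i \<in> I \<Longrightarrow> smooth (f i)) \<Longrightarrow> smooth (\<lambda>x. \<Sum>i\<in>I. f i x)"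
  by (induction I rule: finite_induct) (auto intro: smooth_const smooth_add)

lemma smooth_polynomial: "real_polynomial_function p \<Longrightarrow> smooth p"
  by (induction rule: real_polynomial_function.induct)
    (auto simp: smooth_def Ck_bounded_linear Ck_const Ck_add Ck_mult)

lemma smooth_has_derivative:
  "smooth f \<Longrightarrow> (f has_derivative frechet_derivative f (at x)) (at x)"
  using Ck_has_derivative smooth_def by blast

lemma smooth_continuous: "smooth f \<Longrightarrow> continuous_on S f"
  using smooth_def Ck.simps(1) continuous_on_subset by blast

text \<open>\<open>Ck\<close> only speaks of derivatives along the standard basis; by linearity a derivative along
any vector is a combination of those.\<close>

lemma smooth_directional_derivative:
  assumes "smooth f" shows "smooth (\<lambda>x. frechet_derivative f (at x) v)"
proof -
  have "frechet_derivative f (at x) v = (\<Sum>b\<in>Basis. (v \<bullet> b) * frechet_derivative f (at x) b)" for x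
  proof -
    interpret linear "frechet_derivative f (at x)"
      using smooth_has_derivative[OF assms] has_derivative_linear by blast
    have "frechet_derivative f (at x) v = frechet_derivative f (at x) (\<Sum>b\<in>Basis. (v \<bullet> b) *\<^sub>R b)"
      by (simp add: euclidean_representation)
    then show ?thesis by (simp only: sum scaleR) simp
  qed
  moreover have "smooth (\<lambda>x. \<Sum>b\<in>Basis. (v \<bullet> b) * frechet_derivative f (at x) b)"
  proof (intro smooth_sum smooth_mult smooth_const)
    fix b :: 'a assume "b \<in> Basis"
    moreover have "Ck (Suc k) f" for k using assms by (simp only: smooth_def)
    ultimately show "smooth (\<lambda>x. frechet_derivative f (at x) b)"
      unfolding smooth_def by simp
  qed simp
  ultimately show ?thesis by simp
qed

lemma smooth_translate:
  assumes "smooth f" shows "smooth (\<lambda>x. f (x - a))"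
proof -
  have "Ck k f \<Longrightarrow> Ck k (\<lambda>x. f (x - a))" for k and f :: "'a \<Rightarrow> real"
  proof (induction k arbitrary: f)
    case 0
    then have "continuous_on UNIV f" by simp
    then show ?case 
      by (simp add: continuous_on_compose2[OF _ continuous_on_diff[OF continuous_on_id continuous_on_const]])
  next
    case (Suc k)
    have "((\<lambda>x. f (x - a)) has_derivative frechet_derivative f (at (x - a))) (at x)" for x
      using has_derivative_compose[OF has_derivative_diff[OF has_derivative_ident has_derivative_const] Ck_has_derivative[OF Suc.prems]]
      by simp
    then show ?case by (rule CkI) (use Suc in auto)
  qed
  then show ?thesis using assms smooth_def by blast
qed

text \<open>The functions \<open>exp (-1/s) / s ^ m\<close>, extended by zero to \<open>s \<le> 0\<close>. The case \<open>m = 0\<close> is the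
classical flat function; the other ones make the family closed under differentiation.\<close>

definition flat :: "nat \<Rightarrow> real \<Rightarrow> real" where
  "flat m s = (if s > 0 then exp (- 1 / s) / s ^ m else 0)"

lemma flat_tendsto_0: "(flat m \<longlongrightarrow> 0) (at_right 0)"
proof -
  have "((\<lambda>x::real. x ^ m / exp x) \<longlongrightarrow> 0) at_top" by (rule tendsto_power_div_exp_0)
  then have "((\<lambda>s::real. inverse s ^ m / exp (inverse s)) \<longlongrightarrow> 0) (at_right 0)"
    by (rule filterlim_compose) (rule filterlim_inverse_at_top_right)
  moreover have "eventually (\<lambda>s. inverse s ^ m / exp (inverse s) = flat m s) (at_right 0)"
    unfolding eventually_at_right_field flat_def
    by (rule exI[of _ 1]) (auto simp: exp_minus field_simps power_divide)
  ultimately show ?thesis by (rule Lim_transform_eventually)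
qed

lemma flat_has_derivative: "(flat m has_real_derivative flat (m + 2) s - m * flat (m + 1) s) (at s)"
proof -
  consider "s > 0" | "s < 0" | "s = 0" by linarith
  then show ?thesis
  proof cases
    case 1
    have "((\<lambda>s. exp (- 1 / s) / s ^ m) has_real_derivative flat (m + 2) s - m * flat (m + 1) s) (at s)"
    proof -
      have "((\<lambda>s. exp (- 1 / s)) has_real_derivative exp (- 1 / s) / s\<^sup>2) (at s)"
        using 1 by (auto intro!: derivative_eq_intros simp: power2_eq_square)
      note D = DERIV_divide[OF this DERIV_pow[of m s]]
      have "real m * s ^ (m - Suc 0) = m * s ^ m / s"
        using 1 by (cases m) auto
      moreover have "(a / s\<^sup>2 * p - a * (m * p / s)) / (p * p) = a / (p * s\<^sup>2) - m * (a / (p * s))"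
        if "p > 0" for a p :: real
        using 1 that by (simp add: divide_simps power2_eq_square) (simp add: algebra_simps)
      from this[of "s ^ m" "exp (- 1 / s)"]
      have "(exp (- 1 / s) / s\<^sup>2 * s ^ m - exp (- 1 / s) * (m * s ^ m / s)) / (s ^ m * s ^ m)
          = exp (- 1 / s) / (s ^ m * s\<^sup>2) - m * (exp (- 1 / s) / (s ^ m * s))" using 1 by simp
      ultimately have "(exp (- 1 / s) / s\<^sup>2 * s ^ m - exp (- 1 / s) * (m * s ^ (m - Suc 0))) / (s ^ m * s ^ m)
          = flat (m + 2) s - m * flat (m + 1) s"
        using 1 by (simp only: flat_def power_add if_True power_one_right)
      moreover have "s ^ m \<noteq> 0" using 1 by simp
      ultimately show ?thesis
        using DERIV_cong[OF D] by blast
    qed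
    moreover have "eventually (\<lambda>s. exp (- 1 / s) / s ^ m = flat m s) (nhds s)"
      using eventually_nhds_in_open[of "{0<..}" s] 1 by (auto simp: flat_def elim!: eventually_mono)
    ultimately show ?thesis by (rule DERIV_cong_ev[OF refl _ refl, THEN iffD1, rotated])
  next
    case 2
    have "eventually (\<lambda>s. 0 = flat m s) (nhds s)"
      using eventually_nhds_in_open[of "{..<0}" s] 2 by (auto simp: flat_def elim!: eventually_mono)
    then have "(flat m has_real_derivative 0) (at s)" by (rule DERIV_cong_ev[OF refl _ refl, THEN iffD1]) (rule DERIV_const)
    then show ?thesis using 2 by (simp add: flat_def)
  next
    case 3
    have "((\<lambda>h. flat m h / h) \<longlongrightarrow> 0) (at_right 0)"
      by (rule Lim_transform_eventually[OF flat_tendsto_0[of "Suc m"]])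
        (auto simp: flat_def eventually_at_right_field intro!: exI[of _ 1])
    moreover have "((\<lambda>h. flat m h / h) \<longlongrightarrow> 0) (at_left 0)"
      by (rule Lim_transform_eventually[OF tendsto_const])
        (auto simp: flat_def eventually_at_left_field intro!: exI[of _ "-1"])
    ultimately have "((\<lambda>h. flat m h / h) \<longlongrightarrow> 0) (at 0)"
      by (simp add: filterlim_split_at)
    then show ?thesis using 3 by (simp add: DERIV_def flat_def)
  qed
qed

text \<open>Differentiating \<open>flat m\<close> gives a combination of \<open>flat (m + 1)\<close> and \<open>flat (m + 2)\<close>, so an induction on
the order of differentiation must run over all \<open>m\<close> at once.\<close>

lemma Ck_flat_compose: "smooth q \<Longrightarrow> Ck k (\<lambda>x. flat m (q x))"
proof (induction k arbitrary: m)
  case 0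
  have "continuous_on UNIV (flat m)"
    by (meson DERIV_isCont flat_has_derivative continuous_at_imp_continuous_on)
  then show ?case using smooth_continuous[OF 0, of UNIV]
    by (simp add: continuous_on_compose2)
next
  case (Suc k)
  have "((\<lambda>x. flat m (q x)) has_derivative
      (\<lambda>h. (flat (m + 2) (q x) + (- m) * flat (m + 1) (q x)) * frechet_derivative q (at x) h)) (at x)" for x
    using has_derivative_compose[OF smooth_has_derivative[OF Suc.prems]
        flat_has_derivative[of m "q x", unfolded has_field_derivative_def]]
    by simp
  then show ?case
    by (rule CkI) (intro Ck_mult Ck_add Ck_const Suc, use Suc.prems smooth_directional_derivative smooth_def in auto)
qed

definition bump :: "'a::euclidean_space \<Rightarrow> real \<Rightarrow> 'a \<Rightarrow> real" where
  "bump c r x = flat 0 (r\<^sup>2 - (x - c) \<bullet> (x - c))"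

lemma smooth_bump: "smooth (bump c r)"
proof -
  have "smooth (\<lambda>x. (\<Sum>b\<in>Basis. ((x - c) \<bullet> b) * ((x - c) \<bullet> b)))"
    by (intro smooth_sum smooth_mult smooth_translate) (auto simp: smooth_def bounded_linear_inner_left Ck_bounded_linear)
  then have "smooth (\<lambda>x. (x - c) \<bullet> (x - c))"
    by (subst euclidean_inner) 
  from smooth_add[OF smooth_const smooth_mult[OF smooth_const this], of "r\<^sup>2" "-1"]
  show ?thesis using Ck_flat_compose unfolding smooth_def bump_def by auto
qed

lemma bump_nonneg: "bump c r x \<ge> 0" and bump_pos_iff: "r > 0 \<Longrightarrow> bump c r x > 0 \<longleftrightarrow> x \<in> ball c r"
  by (auto simp: bump_def flat_def dist_norm norm_minus_commute[of c x] norm_lt_square)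
   
lemma zero_outside_support: "x \<notin> closure {x. \<psi> x \<noteq> 0} \<Longrightarrow> \<psi> x = 0"
  using closure_subset[of "{x. \<psi> x \<noteq> 0}"] by blast

lemma compact_closure_of_subset:
  fixes L :: "'a::euclidean_space set"
  shows "compact L \<Longrightarrow> closure A \<subseteq> L \<Longrightarrow> compact (closure A)"
  by (meson bounded_subset closure_subset compact_closure compact_imp_bounded order_trans)

text \<open>A finite sum of bumps on balls that cover \<open>K\<close>. Positivity on \<open>K\<close>, rather than the value 1, is enough
for what follows, because one can divide by this function on \<open>K\<close>.\<close>

lemma test_function_positive_on_compact:
  assumes "compact K" "open D" "K \<subseteq> D"
  obtains \<zeta> where "test_function D \<zeta>" "\<And>x. \<zeta> x \<ge> 0" "\<And>x. x \<in> K \<Longrightarrow> \<zeta> x > 0"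
proof -
  have "\<exists>r>0. cball x r \<subseteq> D" if "x \<in> K" for x
    using assms that open_contains_cball by blast
  then obtain r where r: "\<And>x. x \<in> K \<Longrightarrow> r x > 0 \<and> cball x (r x) \<subseteq> D" by metis
  obtain C where C: "C \<subseteq> K" "finite C" "K \<subseteq> (\<Union>c\<in>C. ball c (r c))"
    using compactE_image[OF \<open>compact K\<close>, of K "\<lambda>c. ball c (r c)"] r by force
  define \<zeta> where "\<zeta> x = (\<Sum>c\<in>C. bump c (r c) x)" for x
  have sub: "closure {x. \<zeta> x \<noteq> 0} \<subseteq> (\<Union>c\<in>C. cball c (r c))"
  proof (rule closure_minimal)
    show "{x. \<zeta> x \<noteq> 0} \<subseteq> (\<Union>c\<in>C. cball c (r c))"
    proof clarify
      fix x assume "\<zeta> x \<noteq> 0"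
      then obtain c where "c \<in> C" "bump c (r c) x \<noteq> 0" by (auto simp: \<zeta>_def intro: sum.neutral)
      then show "x \<in> (\<Union>c\<in>C. cball c (r c))"
        using bump_pos_iff[of "r c" c x] bump_nonneg[of c "r c" x] r C
        by (intro UN_I[of c]) (auto simp: less_le subset_iff)
    qed
  qed (use C in auto)
  show ?thesis
  proof
    have "compact (\<Union>c\<in>C. cball c (r c))" using C by auto
    then have "compact (closure {x. \<zeta> x \<noteq> 0})"
      using sub by (rule compact_closure_of_subset)
    then show "test_function D \<zeta>"
      unfolding test_function_def using sub r C
      by (auto simp: \<zeta>_def[abs_def] intro!: smooth_sum smooth_bump)
    show "\<zeta> x \<ge> 0" for x by (simp add: \<zeta>_def sum_nonneg bump_nonneg)
    show "\<zeta> x > 0" if x: "x \<in> K" for x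
    proof -
      obtain c where c: "c \<in> C" "x \<in> ball c (r c)" using C(3) x by blast
      then have "bump c (r c) x > 0" using r C(1) bump_pos_iff by blast
      then show ?thesis unfolding \<zeta>_def
        using C(2) c(1) bump_nonneg by (intro sum_pos2[of C c]) auto
    qed
  qed
qed

section \<open>Approximation by test functions\<close>

lemma test_function_smooth: "test_function D \<psi> \<Longrightarrow> smooth \<psi>"
  by (simp add: test_function_def)

lemma smooth_borel: "smooth \<psi> \<Longrightarrow> \<psi> \<in> borel_measurable borel"
  using borel_measurable_continuous_onI smooth_continuous by blast

lemma test_function_borel: "test_function D \<psi> \<Longrightarrow> \<psi> \<in> borel_measurable borel"
  using smooth_borel test_function_smooth by blast

lemma test_function_outside: "test_function D \<psi> \<Longrightarrow> x \<notin> D \<Longrightarrow> \<psi> x = 0"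
  using closure_subset[of "{x. \<psi> x \<noteq> 0}"] by (auto simp: test_function_def)

lemma AE_lborel_negligible: "negligible N \<Longrightarrow> AE x in lborel. x \<notin> N"
  by (metis AE_completion_iff AE_not_in negligible_iff_null_sets)

lemma compact_support_continuous_bounded:
  fixes \<psi> :: "'a::euclidean_space \<Rightarrow> real"
  assumes "compact L" "continuous_on L \<psi>"
  obtains B where "B \<ge> 0" "\<And>x. x \<in> L \<Longrightarrow> \<bar>\<psi> x\<bar> \<le> B"
proof -
  have "bounded (\<psi> ` L)" using assms compact_continuous_image compact_imp_bounded by blast
  then show ?thesis using that by (metis bounded_pos imageI less_le real_norm_def)
qed

text \<open>Let \<open>\<zeta>\<close> be a test function that is positive on \<open>K\<close>. The bounded function \<open>h / \<zeta>\<close> is an almost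
everywhere limit of continuous functions, which can be truncated and then, by Stone and Weierstrass,
replaced on the support of \<open>\<zeta>\<close> by polynomials \<open>p n\<close>. The products \<open>\<zeta> * p n\<close> are smooth and converge
to \<open>h\<close>.\<close>

lemma test_function_approx:
  fixes h :: "'a::euclidean_space \<Rightarrow> real"
  assumes h: "h \<in> borel_measurable lebesgue" "\<And>x. \<bar>h x\<bar> \<le> C" "\<And>x. x \<notin> K \<Longrightarrow> h x = 0"
    and K: "compact K" "K \<subseteq> D" "open D"
  obtains \<psi> L B where "\<And>n::nat. test_function D (\<psi> n)" "compact L" "L \<subseteq> D"
    "\<And>n x. x \<notin> L \<Longrightarrow> \<psi> n x = 0" "\<And>n x. \<bar>\<psi> n x\<bar> \<le> B"
    "AE x in lborel. (\<lambda>n. \<psi> n x) \<longlonglongrightarrow> h x"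
proof -
  obtain \<zeta> where \<zeta>: "test_function D \<zeta>" "\<And>x. \<zeta> x \<ge> 0" "\<And>x. x \<in> K \<Longrightarrow> \<zeta> x > 0"
    using test_function_positive_on_compact[of K D] K by metis
  define L where "L = closure {x. \<zeta> x \<noteq> 0}"
  have L: "compact L" "L \<subseteq> D" "\<And>x. x \<notin> L \<Longrightarrow> \<zeta> x = 0"
    using \<zeta>(1) by (auto simp: L_def test_function_def intro: zero_outside_support)
  have cont: "continuous_on S \<zeta>" for S
    using \<zeta>(1) smooth_continuous test_function_smooth by blast
  obtain c where c: "c > 0" "\<And>x. x \<in> K \<Longrightarrow> c \<le> \<zeta> x"
  proof (cases "K = {}")
    case False
    then obtain y where "y \<in> K" "\<forall>x\<in>K. \<zeta> y \<le> \<zeta> x"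
      using continuous_attains_inf[OF K(1) _ cont] by blast
    then show ?thesis using that \<zeta>(3) by blast
  qed (use that[of 1] in auto)
  have C0: "C \<ge> 0" using h(2)[of undefined] by linarith
  define w where "w x = h x / \<zeta> x" for x
  have w_bound: "\<bar>w x\<bar> \<le> C / c" for x
  proof (cases "x \<in> K")
    case True
    have "\<bar>h x\<bar> / \<zeta> x \<le> C / c" by (rule frac_le[OF C0 h(2) c(1) c(2)[OF True]])
    then show ?thesis using \<zeta>(3)[OF True] by (simp add: w_def)
  next
    case False
    then show ?thesis using h(3)[OF False] c(1) C0 by (simp add: w_def)
  qed
  have "\<zeta> \<in> borel_measurable lebesgue"
    using test_function_borel[OF \<zeta>(1)] by (auto intro: measurable_completion)
  then have "w \<in> borel_measurable lebesgue" unfolding w_def[abs_def] using h(1) by measurable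
  then have "w measurable_on UNIV" by (simp add: lebesgue_measurable_imp_measurable_on)
  then obtain N g where g: "negligible N" "\<And>n. continuous_on UNIV (g n)"
    "\<And>x. x \<notin> N \<Longrightarrow> (\<lambda>n. g n x) \<longlonglongrightarrow> w x"
    unfolding measurable_on_def by auto
  define g' where "g' n x = max (- (C / c)) (min (C / c) (g n x))" for n x
  have "continuous_on L (g' n)" for n
    unfolding g'_def by (intro continuous_intros continuous_on_subset[OF g(2)]) auto
  then have "\<exists>p. real_polynomial_function p \<and> (\<forall>x\<in>L. \<bar>g' n x - p x\<bar> < inverse (real (Suc n)))" for n
    by (rule Stone_Weierstrass_real_polynomial_function[OF L(1), of "g' n" "inverse (real (Suc n))"]) auto
  then obtain p where p: "\<And>n. real_polynomial_function (p n)"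
    "\<And>n x. x \<in> L \<Longrightarrow> \<bar>g' n x - p n x\<bar> < inverse (real (Suc n))" by metis
  obtain Z where Z: "Z \<ge> 0" "\<And>x. x \<in> L \<Longrightarrow> \<bar>\<zeta> x\<bar> \<le> Z"
    using compact_support_continuous_bounded[OF L(1) cont] by metis
  define \<psi> where "\<psi> n x = \<zeta> x * p n x" for n x
  show ?thesis
  proof
    show "test_function D (\<psi> n)" for n
    proof -
      have "closure {x. \<psi> n x \<noteq> 0} \<subseteq> L" 
        unfolding L_def by (intro closure_mono) (auto simp: \<psi>_def)
      moreover have "compact (closure {x. \<psi> n x \<noteq> 0})"
        using L(1) calculation by (rule compact_closure_of_subset)
      ultimately show ?thesis
        using \<zeta>(1) p(1) L(2) unfolding test_function_def \<psi>_def[abs_def]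
        by (auto intro: smooth_mult smooth_polynomial)
    qed
    show "compact L" "L \<subseteq> D" by fact+
    show "\<psi> n x = 0" if "x \<notin> L" for n x using L(3) that by (simp add: \<psi>_def)
    show "\<bar>\<psi> n x\<bar> \<le> Z * (C / c + 1)" for n x
    proof (cases "x \<in> L")
      case True
      have "inverse (real (Suc n)) \<le> 1" by (simp add: field_simps)
      moreover have "C / c \<ge> 0" using C0 c(1) by simp
      then have "\<bar>g' n x\<bar> \<le> C / c" unfolding g'_def by linarith
      ultimately have "\<bar>p n x\<bar> \<le> C / c + 1" using p(2)[OF True, of n] by linarith
      then show ?thesis using Z(2)[OF True] Z(1) by (auto simp: \<psi>_def abs_mult intro!: mult_mono)
    next
      case False
      then show ?thesis using L(3) Z(1) C0 c(1) by (simp add: \<psi>_def)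
    qed
    show "AE x in lborel. (\<lambda>n. \<psi> n x) \<longlonglongrightarrow> h x"
      using AE_lborel_negligible[OF g(1)]
    proof eventually_elim
      case (elim x)
      show ?case
      proof (cases "x \<in> L")
        case True
        have "(\<lambda>n. g' n x) \<longlonglongrightarrow> max (- (C / c)) (min (C / c) (w x))"
          unfolding g'_def by (intro tendsto_intros g(3) elim)
        also have "max (- (C / c)) (min (C / c) (w x)) = w x" using w_bound[of x] by auto
        finally have 1: "(\<lambda>n. g' n x) \<longlonglongrightarrow> w x" .
        have "(\<lambda>n. g' n x - p n x) \<longlonglongrightarrow> 0"
          by (rule Lim_null_comparison[OF _ LIMSEQ_inverse_real_of_nat])
            (use p(2)[OF True] in \<open>auto intro!: always_eventually less_imp_le\<close>)
        from tendsto_diff[OF 1 this] have "(\<lambda>n. p n x) \<longlonglongrightarrow> w x" by simp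
        then have "(\<lambda>n. \<psi> n x) \<longlonglongrightarrow> \<zeta> x * w x" unfolding \<psi>_def by (intro tendsto_intros)
        moreover have "\<zeta> x * w x = h x"
          using \<zeta>(3)[of x] h(3)[of x] by (cases "x \<in> K") (auto simp: w_def)
        ultimately show ?thesis by simp
      next
        case False
        then have "h x = 0" using \<zeta>(3)[of x] L(3)[of x] h(3)[of x] by fastforce
        then show ?thesis using False L(3) by (simp add: \<psi>_def)
      qed
    qed
  qed
qed

lemma open_compact_exhaustion:
  fixes D :: "'a::euclidean_space set"
  assumes "open D"
  obtains K where "\<And>n::nat. compact (K n)" "\<And>n. K n \<subseteq> D" "incseq K" "(\<Union>n. K n) = D"
  using open_Union_compact_subsets[OF assms]
  by (metis incseq_SucI interior_subset order_trans)

text \<open>The convergence provided by \<open>test_function_approx\<close> is dominated, so it passes to integrals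
against any function that is integrable on the common support.\<close>

lemma integral_test_limit:
  fixes w :: "'a::euclidean_space \<Rightarrow> real"
  assumes w: "integrable lborel (\<lambda>x. indicator L x * w x)"
    and "\<And>n x. x \<notin> L \<Longrightarrow> \<psi> n x = 0" "\<And>n x. \<bar>\<psi> n x\<bar> \<le> B" "\<And>n. \<psi> n \<in> borel_measurable borel"
    "AE x in lborel. (\<lambda>n. \<psi> n x) \<longlonglongrightarrow> h x" "h \<in> borel_measurable borel"
    "\<And>x. x \<notin> L \<Longrightarrow> h x = 0"
  shows "(\<lambda>n. LBINT x. w x * \<psi> n x) \<longlonglongrightarrow> (LBINT x. w x * h x)"
proof -
  have *: "w x * \<psi> n x = (indicator L x * w x) * \<psi> n x" "w x * h x = (indicator L x * w x) * h x" for n x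
    using assms(2,7) by (auto simp: indicator_def)
  have [measurable]: "(\<lambda>x. indicator L x * w x) \<in> borel_measurable borel"
    using borel_measurable_integrable[OF w] by simp
  note [measurable] = assms(4,6)
  show ?thesis unfolding *
  proof (rule integral_dominated_convergence)
    show "integrable lborel (\<lambda>x. B * norm (indicator L x * w x))" using w by (intro integrable_mult_right integrable_norm)
    show "AE x in lborel. norm (indicator L x * w x * \<psi> n x) \<le> B * norm (indicator L x * w x)" for n
    proof (rule AE_I2)
      fix x
      have "norm (indicator L x * w x * \<psi> n x) = \<bar>\<psi> n x\<bar> * norm (indicator L x * w x)"
        by (simp add: abs_mult)
      also have "\<dots> \<le> B * norm (indicator L x * w x)"
        by (intro mult_right_mono assms(3)) simp
      finally show "norm (indicator L x * w x * \<psi> n x) \<le> B * norm (indicator L x * w x)" .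
    qed
    show "AE x in lborel. (\<lambda>n. indicator L x * w x * \<psi> n x) \<longlonglongrightarrow> indicator L x * w x * h x"
      using assms(5) by eventually_elim (intro tendsto_intros)
  qed measurable
qed

text \<open>On a compact \<open>K\<close> the function \<open>sgn w\<close>, cut off outside \<open>K\<close>, is a bounded limit of test functions.
Testing with it shows that the integral of \<open>\<bar>w\<bar>\<close> over \<open>K\<close> vanishes.\<close>

lemma fundamental_lemma:
  fixes w :: "'a::euclidean_space \<Rightarrow> real"
  assumes "open D" and w_borel: "w \<in> borel_measurable borel"
    and w: "\<And>K. compact K \<Longrightarrow> K \<subseteq> D \<Longrightarrow> integrable lborel (\<lambda>x. indicator K x * w x)"
    and 0: "\<And>\<psi>. test_function D \<psi> \<Longrightarrow> (LBINT x. w x * \<psi> x) = 0"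
  shows "AE x in lborel. x \<in> D \<longrightarrow> w x = 0"
proof -
  note [measurable] = w_borel
  have *: "AE x in lborel. x \<in> K \<longrightarrow> w x = 0" if K: "compact K" "K \<subseteq> D" for K
  proof -
    have [measurable]: "K \<in> sets borel" using K(1) by (simp add: borel_compact)
    define h where "h x = indicator K x * sgn (w x)" for x
    have [measurable]: "h \<in> borel_measurable borel" unfolding h_def[abs_def] by measurable
    have hb: "\<And>x. \<bar>h x\<bar> \<le> 1" "\<And>x. x \<notin> K \<Longrightarrow> h x = 0" by (auto simp: h_def indicator_def sgn_real_def)
    obtain \<psi> L B where \<psi>: "\<And>n::nat. test_function D (\<psi> n)" "compact L" "L \<subseteq> D"
        "\<And>n x. x \<notin> L \<Longrightarrow> \<psi> n x = 0" "\<And>n x. \<bar>\<psi> n x\<bar> \<le> B"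
        "AE x in lborel. (\<lambda>n. \<psi> n x) \<longlonglongrightarrow> h x"
      by (rule test_function_approx[of h 1 K D]) (use hb K \<open>open D\<close> in \<open>auto intro: measurable_completion\<close>)
    have KL: "compact (K \<union> L)" "K \<union> L \<subseteq> D" using \<psi> K by auto
    have "(\<lambda>n. LBINT x. w x * \<psi> n x) \<longlonglongrightarrow> (LBINT x. w x * h x)"
      by (rule integral_test_limit[OF w[OF KL], of _ B]) (use \<psi> hb test_function_borel[OF \<psi>(1)] in auto)
    then have "(LBINT x. w x * h x) = 0"
      using 0[OF \<psi>(1)] by (simp add: LIMSEQ_const_iff)
    moreover have "w x * h x = norm (indicator K x * w x)" for x
      by (auto simp: h_def indicator_def sgn_real_def)
    ultimately have "(LBINT x. norm (indicator K x * w x)) = 0" by simp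
    then have "AE x in lborel. norm (indicator K x * w x) = 0"
      by (subst (asm) integral_nonneg_eq_0_iff_AE) (use w[OF K] in auto)
    then show ?thesis by eventually_elim (auto simp: indicator_def split: if_splits)
  qed
  obtain K where K: "\<And>n::nat. compact (K n)" "\<And>n. K n \<subseteq> D" "(\<Union>n. K n) = D"
    using open_compact_exhaustion[OF \<open>open D\<close>] by metis
  have "AE x in lborel. \<forall>n. x \<in> K n \<longrightarrow> w x = 0"
    unfolding AE_all_countable using * K by blast
  then show ?thesis using K(3) by (auto elim!: eventually_mono)
qed

section \<open>Square integrable functions\<close>

text \<open>The counterpart of \<open>L2\<close> for an arbitrary measure. It is used for Borel functions with the measure
\<open>lborel\<close> and for functions of two points with the measure given by the interaction kernels.\<close>

definition sq_integrable :: "'x measure \<Rightarrow> ('x \<Rightarrow> 'b::euclidean_space) \<Rightarrow> bool" where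
  "sq_integrable M f \<longleftrightarrow> f \<in> borel_measurable M \<and> integrable M (\<lambda>x. (norm (f x))\<^sup>2)"

lemma sq_integrableD:
  "sq_integrable M f \<Longrightarrow> f \<in> borel_measurable M"
  "sq_integrable M f \<Longrightarrow> integrable M (\<lambda>x. (norm (f x))\<^sup>2)"
  by (auto simp: sq_integrable_def)

lemma sq_integrable_iff_nn:
  "sq_integrable M f \<longleftrightarrow> f \<in> borel_measurable M \<and> (\<integral>\<^sup>+x. ennreal ((norm (f x))\<^sup>2) \<partial>M) < \<infinity>"
proof -
  have "integrable M (\<lambda>x. (norm (f x))\<^sup>2) \<longleftrightarrow> (\<integral>\<^sup>+x. ennreal ((norm (f x))\<^sup>2) \<partial>M) < \<infinity>"
    if [measurable]: "f \<in> borel_measurable M"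
    by (subst integrable_iff_bounded) simp
  then show ?thesis unfolding sq_integrable_def by blast
qed

lemma norm_add_sq_le: "(norm (a + b))\<^sup>2 \<le> 2 * (norm a)\<^sup>2 + 2 * (norm (b :: 'b::real_inner))\<^sup>2"
proof -
  have "(norm (a + b))\<^sup>2 + (norm (a - b))\<^sup>2 = 2 * (norm a)\<^sup>2 + 2 * (norm b)\<^sup>2"
    by (simp add: power2_norm_eq_inner inner_simps)
  then show ?thesis by (smt (verit) zero_le_power2)
qed

lemma sq_integrable_add:
  assumes "sq_integrable M f" "sq_integrable M g"
  shows "sq_integrable M (\<lambda>x. f x + g x)"
proof -
  note [measurable] = sq_integrableD(1)[OF assms(1)] sq_integrableD(1)[OF assms(2)]
  have "integrable M (\<lambda>x. (norm (f x + g x))\<^sup>2)"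
  proof (rule Bochner_Integration.integrable_bound)
    show "integrable M (\<lambda>x. 2 * (norm (f x))\<^sup>2 + 2 * (norm (g x))\<^sup>2)"
      using assms by (auto simp: sq_integrable_def)
  qed (auto intro: norm_add_sq_le)
  then show ?thesis by (simp add: sq_integrable_def)
qed

lemma sq_integrable_scaleR:
  assumes "sq_integrable M f" shows "sq_integrable M (\<lambda>x. c *\<^sub>R f x)"
  using assms by (auto simp: sq_integrable_def power_mult_distrib)

lemma sq_integrable_diff:
  assumes "sq_integrable M f" "sq_integrable M g"
  shows "sq_integrable M (\<lambda>x. f x - g x)"
  using sq_integrable_add[OF assms(1) sq_integrable_scaleR[OF assms(2), of "-1"]] by simp

lemma sq_integrable_bound:
  assumes "sq_integrable M f" "g \<in> borel_measurable M" "\<And>x. norm (g x) \<le> norm (f x)"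
  shows "sq_integrable M g"
  using assms unfolding sq_integrable_def
  by (auto intro!: Bochner_Integration.integrable_bound[where f = "\<lambda>x. (norm (f x))\<^sup>2"] power_mono)

lemma sq_integrable_inner:
  assumes "sq_integrable M f" "sq_integrable M g"
  shows "integrable M (\<lambda>x. f x \<bullet> g x)"
    and "\<bar>\<integral>x. f x \<bullet> g x \<partial>M\<bar> \<le> sqrt (\<integral>x. (norm (f x))\<^sup>2 \<partial>M) * sqrt (\<integral>x. (norm (g x))\<^sup>2 \<partial>M)"
proof -
  note [measurable] = sq_integrableD(1)[OF assms(1)] sq_integrableD(1)[OF assms(2)]
  have le: "\<bar>f x \<bullet> g x\<bar> \<le> norm (f x) * norm (g x)" for x by (rule Cauchy_Schwarz_ineq2)
  have I: "integrable M (\<lambda>x. norm (f x) * norm (g x))"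
  proof (rule Bochner_Integration.integrable_bound)
    show "integrable M (\<lambda>x. (norm (f x))\<^sup>2 + (norm (g x))\<^sup>2)"
      using assms by (auto simp: sq_integrable_def)
    have "a * b \<le> a\<^sup>2 + b\<^sup>2" if "0 \<le> a" "0 \<le> b" for a b :: real
      using sum_squares_bound[of a b] mult_nonneg_nonneg[OF that] by linarith
    then show "AE x in M. norm (norm (f x) * norm (g x)) \<le> norm ((norm (f x))\<^sup>2 + (norm (g x))\<^sup>2)" by simp
  qed measurable
  show 1: "integrable M (\<lambda>x. f x \<bullet> g x)"
    by (rule Bochner_Integration.integrable_bound[OF I]) (use le in \<open>auto simp: abs_mult\<close>)
  let ?I = "\<integral>x. norm (f x) * norm (g x) \<partial>M"
  let ?F = "\<integral>x. (norm (f x))\<^sup>2 \<partial>M" let ?G = "\<integral>x. (norm (g x))\<^sup>2 \<partial>M"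
  have "(\<integral>\<^sup>+x. ennreal (norm (f x)) * ennreal (norm (g x)) \<partial>M)\<^sup>2
      \<le> (\<integral>\<^sup>+x. ennreal (norm (f x)) ^ 2 \<partial>M) * (\<integral>\<^sup>+x. ennreal (norm (g x)) ^ 2 \<partial>M)"
    by (rule Cauchy_Schwarz_nn_integral) measurable
  also have "(\<integral>\<^sup>+x. ennreal (norm (f x)) * ennreal (norm (g x)) \<partial>M) = ennreal ?I"
    using I by (subst nn_integral_eq_integral[symmetric]) (auto simp: ennreal_mult)
  also have "(\<integral>\<^sup>+x. ennreal (norm (f x)) ^ 2 \<partial>M) = ennreal ?F"
    using sq_integrableD(2)[OF assms(1)] by (subst nn_integral_eq_integral[symmetric]) (auto simp: ennreal_power)
  also have "(\<integral>\<^sup>+x. ennreal (norm (g x)) ^ 2 \<partial>M) = ennreal ?G"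
    using sq_integrableD(2)[OF assms(2)] by (subst nn_integral_eq_integral[symmetric]) (auto simp: ennreal_power)
  finally have "?I\<^sup>2 \<le> ?F * ?G"
    by (subst (asm) ennreal_power) (auto simp flip: ennreal_mult)
  then have "?I \<le> sqrt ?F * sqrt ?G"
    by (metis real_le_rsqrt real_sqrt_mult)
  moreover have "\<bar>\<integral>x. f x \<bullet> g x \<partial>M\<bar> \<le> ?I"
    using integral_abs_bound[of M "\<lambda>x. f x \<bullet> g x"]
      integral_mono[OF integrable_abs[OF 1] I] le by (meson order_trans)
  ultimately show "\<bar>\<integral>x. f x \<bullet> g x \<partial>M\<bar> \<le> sqrt ?F * sqrt ?G" by simp
qed

section \<open>Translations and integration by parts\<close>

lemma lborel_integrable_translate_iff:
  fixes f :: "'a::euclidean_space \<Rightarrow> 'b::euclidean_space"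
  assumes [measurable]: "f \<in> borel_measurable borel"
  shows "integrable lborel (\<lambda>x. f (x + a)) \<longleftrightarrow> integrable lborel f"
    and "(LBINT x. f (x + a)) = (LBINT x. f x)"
proof -
  have D: "lborel = distr lborel borel (\<lambda>x. x + a)"
    using lborel_distr_plus[of a] by (simp add: add.commute[of a] cong: distr_cong)
  show "integrable lborel (\<lambda>x. f (x + a)) \<longleftrightarrow> integrable lborel f"
    by (subst (2) D) (simp add: integrable_distr_eq)
  show "(LBINT x. f (x + a)) = (LBINT x. f x)"
    by (subst (2) D) (simp add: integral_distr)
qed

lemma nn_integral_lborel_translate:
  fixes f :: "'a::euclidean_space \<Rightarrow> ennreal"
  assumes [measurable]: "f \<in> borel_measurable borel"
  shows "(\<integral>\<^sup>+x. f (x + a) \<partial>lborel) = (\<integral>\<^sup>+x. f x \<partial>lborel)"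
proof -
  have D: "lborel = distr lborel borel (\<lambda>x. x + a)"
    using lborel_distr_plus[of a] by (simp add: add.commute[of a] cong: distr_cong)
  show ?thesis by (subst (2) D) (simp add: nn_integral_distr)
qed

lemma sq_integrable_translate:
  fixes f :: "'a::euclidean_space \<Rightarrow> 'b::euclidean_space"
  assumes "sq_integrable lborel f"
  shows "sq_integrable lborel (\<lambda>x. f (x + a))"
proof -
  have [measurable]: "f \<in> borel_measurable borel" using sq_integrableD(1)[OF assms] by simp
  show ?thesis using sq_integrableD(2)[OF assms]
    lborel_integrable_translate_iff(1)[of "\<lambda>x. (norm (f x))\<^sup>2" a]
    by (simp add: sq_integrable_def)
qed

definition locally_integrable_lborel :: "('a::euclidean_space \<Rightarrow> 'b::euclidean_space) \<Rightarrow> bool" where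
  "locally_integrable_lborel u \<longleftrightarrow> u \<in> borel_measurable borel \<and>
     (\<forall>K. compact K \<longrightarrow> integrable lborel (\<lambda>x. indicator K x *\<^sub>R u x))"

lemma continuous_locally_integrable:
  "continuous_on UNIV u \<Longrightarrow> locally_integrable_lborel u"
  unfolding locally_integrable_lborel_def
  using borel_measurable_continuous_onI borel_integrable_compact continuous_on_subset
  by (metis (no_types, lifting) subset_UNIV indicator_scaleR_eq_if Bochner_Integration.integrable_cong)

lemma sq_integrable_locally_integrable:
  assumes "sq_integrable lborel u" shows "locally_integrable_lborel u"
  unfolding locally_integrable_lborel_def
proof safe
  show [measurable]: "u \<in> borel_measurable borel" using sq_integrableD(1)[OF assms] by simp
  fix K :: "'a set" assume K: "compact K"
  then have [measurable]: "K \<in> sets borel" by (simp add: borel_compact)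
  show "integrable lborel (\<lambda>x. indicator K x *\<^sub>R u x)"
  proof (rule Bochner_Integration.integrable_bound)
    show "integrable lborel (\<lambda>x. indicator K x + (norm (u x))\<^sup>2 :: real)"
      using sq_integrableD(2)[OF assms] K emeasure_bounded_finite[OF compact_imp_bounded[OF K]]
      by (intro Bochner_Integration.integrable_add integrable_real_indicator)
        (auto simp: borel_compact)
    have "a \<le> 1 + a\<^sup>2" if "0 \<le> a" for a :: real
      using sum_squares_bound[of a 1] that by simp
    then show "AE x in lborel. norm (indicator K x *\<^sub>R u x) \<le> norm (indicator K x + (norm (u x))\<^sup>2 :: real)"
      by (auto simp: indicator_def)
  qed measurable
qed

lemma integrable_mult_compact_support:
  fixes u \<psi> :: "'a::euclidean_space \<Rightarrow> real"
  assumes u: "u \<in> borel_measurable borel" "integrable lborel (\<lambda>x. indicator L x *\<^sub>R u x)"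
    and "compact L" "\<And>x. x \<notin> L \<Longrightarrow> \<psi> x = 0" "continuous_on UNIV \<psi>"
  shows "integrable lborel (\<lambda>x. u x * \<psi> x)"
proof -
  have [measurable]: "u \<in> borel_measurable borel" "\<psi> \<in> borel_measurable borel"
    using assms borel_measurable_continuous_onI by auto
  obtain B where B: "B \<ge> 0" "\<And>x. x \<in> L \<Longrightarrow> \<bar>\<psi> x\<bar> \<le> B"
    using compact_support_continuous_bounded[OF assms(3)] assms(5) continuous_on_subset by (metis subset_UNIV)
  show ?thesis
  proof (rule Bochner_Integration.integrable_bound)
    show "integrable lborel (\<lambda>x. B * norm (indicator L x *\<^sub>R u x))"
      using u(2) by (intro integrable_mult_right integrable_norm)
    have "\<bar>u x\<bar> * \<bar>\<psi> x\<bar> \<le> B * (indicator L x * \<bar>u x\<bar>)" for x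
      using B(2)[of x] assms(4)[of x] mult_left_mono[of "\<bar>\<psi> x\<bar>" B "\<bar>u x\<bar>"]
      by (cases "x \<in> L") (auto simp: mult.commute)
    then show "AE x in lborel. norm (u x * \<psi> x) \<le> norm (B * norm (indicator L x *\<^sub>R u x))"
      using B(1) by (auto simp: abs_mult)
  qed measurable
qed

lemma locally_integrable_mult_bounded:
  fixes u \<psi> :: "'a::euclidean_space \<Rightarrow> real"
  assumes "locally_integrable_lborel u" "compact L" "\<And>x. x \<notin> L \<Longrightarrow> \<psi> x = 0"
    "continuous_on UNIV \<psi>"
  shows "integrable lborel (\<lambda>x. u x * \<psi> x)"
  using assms by (intro integrable_mult_compact_support[of u L]) (auto simp: locally_integrable_lborel_def)

lemma derivative_outside_support:
  fixes \<psi> :: "'a::euclidean_space \<Rightarrow> real"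
  assumes "smooth \<psi>" "x \<notin> closure {x. \<psi> x \<noteq> 0}"
  shows "frechet_derivative \<psi> (at x) v = 0"
proof -
  have "(\<psi> has_derivative (\<lambda>h. 0)) (at x)"
  proof (rule has_derivative_transform_within_open[of "\<lambda>x. 0"])
    show "open (- closure {x. \<psi> x \<noteq> 0})" by auto
    show "0 = \<psi> y" if "y \<in> - closure {x. \<psi> x \<noteq> 0}" for y
      using that by (metis ComplD zero_outside_support)
  qed (use assms in auto)
  from frechet_derivative_at[OF this] show ?thesis by metis
qed

lemma line_derivative:
  assumes "smooth \<psi>"
  shows "((\<lambda>s. \<psi> (x - s *\<^sub>R v)) has_real_derivative - frechet_derivative \<psi> (at (x - s *\<^sub>R v)) v) (at s)"
proof -
  have "((\<lambda>s. \<psi> (x - s *\<^sub>R v)) has_derivative (\<lambda>h. frechet_derivative \<psi> (at (x - s *\<^sub>R v)) (- (h *\<^sub>R v)))) (at s)"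
    by (rule has_derivative_compose[OF _ smooth_has_derivative[OF assms]]) (auto intro!: derivative_eq_intros)
  moreover have "linear (frechet_derivative \<psi> (at (x - s *\<^sub>R v)))"
    using smooth_has_derivative[OF assms] has_derivative_linear by blast
  ultimately show ?thesis
    by (simp add: has_field_derivative_def linear_neg linear_scale)
      (erule has_derivative_eq_rhs, simp add: fun_eq_iff)
qed

text \<open>Dominated convergence for difference quotients: the quotients are bounded by a Lipschitz
constant of \<open>\<psi>\<close> along \<open>v\<close>, and for \<open>s\<close> within distance 1 of \<open>t\<close> they live on one compact set.\<close>

lemma integral_translate_has_derivative:
  fixes u \<psi> :: "'a::euclidean_space \<Rightarrow> real"
  assumes u: "locally_integrable_lborel u" and \<psi>: "smooth \<psi>" "compact (closure {x. \<psi> x \<noteq> 0})"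
  shows "((\<lambda>t. LBINT x. u x * \<psi> (x - t *\<^sub>R v)) has_real_derivative
           - (LBINT x. u x * frechet_derivative \<psi> (at (x - t *\<^sub>R v)) v)) (at t)"
proof -
  define L where "L = closure {x. \<psi> x \<noteq> 0}"
  have outside: "\<psi> x = 0" if "x \<notin> L" for x
    using that unfolding L_def by (rule zero_outside_support)
  have "continuous_on (L \<times> {t - 1..t + 1}) (\<lambda>(x, s). x + s *\<^sub>R v)"
    by (auto intro!: continuous_intros simp: case_prod_unfold)
  moreover define K where "K = (\<lambda>(x, s). x + s *\<^sub>R v) ` (L \<times> {t - 1..t + 1})"
  ultimately have K: "compact K"
    using \<psi>(2) by (auto simp: L_def intro!: compact_continuous_image compact_Times)
  have K_out: "x - s *\<^sub>R v \<notin> L" if "x \<notin> K" "\<bar>s - t\<bar> \<le> 1" for x s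
  proof
    assume "x - s *\<^sub>R v \<in> L"
    then have "(\<lambda>(x, s). x + s *\<^sub>R v) (x - s *\<^sub>R v, s) \<in> K"
      unfolding K_def using that(2) by (intro imageI) auto
    then show False using that(1) by simp
  qed
  define d where "d x = frechet_derivative \<psi> (at x) v" for x
  have d_cont: "continuous_on S d" for S
    unfolding d_def using smooth_continuous smooth_directional_derivative[OF \<psi>(1)] by blast
  have [measurable]: "u \<in> borel_measurable borel" "\<psi> \<in> borel_measurable borel" "d \<in> borel_measurable borel"
    using u smooth_borel[OF \<psi>(1)] d_cont borel_measurable_continuous_onI
    by (auto simp: locally_integrable_lborel_def)
  obtain B where B: "B \<ge> 0" "\<And>x. x \<in> L \<Longrightarrow> \<bar>d x\<bar> \<le> B"
    using compact_support_continuous_bounded[OF _ d_cont, of L] \<psi>(2) by (auto simp: L_def)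
  have B': "\<bar>d x\<bar> \<le> B" for x
    using B derivative_outside_support[OF \<psi>(1), of x] by (cases "x \<in> L") (auto simp: L_def d_def)
  have int: "integrable lborel (\<lambda>x. u x * \<psi> (x - s *\<^sub>R v))" if "\<bar>s - t\<bar> \<le> 1" for s
    by (rule locally_integrable_mult_bounded[OF u K])
      (use that K_out outside smooth_continuous[OF smooth_translate[OF \<psi>(1)]] in auto)
  have lip: "\<bar>\<psi> (x - s *\<^sub>R v) - \<psi> (x - t *\<^sub>R v)\<bar> \<le> B * \<bar>s - t\<bar>" for x s
  proof -
    have "norm (\<psi> (x - s *\<^sub>R v) - \<psi> (x - t *\<^sub>R v)) \<le> B * norm (s - t)"
    proof (rule field_differentiable_bound[of UNIV "\<lambda>s. \<psi> (x - s *\<^sub>R v)" "\<lambda>s. - d (x - s *\<^sub>R v)"])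
      show "((\<lambda>s. \<psi> (x - s *\<^sub>R v)) has_field_derivative - d (x - z *\<^sub>R v)) (at z within UNIV)" for z
        using line_derivative[OF \<psi>(1)] unfolding d_def by simp
    qed (use B' in auto)
    then show ?thesis by simp
  qed
  let ?F = "\<lambda>t. LBINT x. u x * \<psi> (x - t *\<^sub>R v)"
  have "((\<lambda>s. (?F s - ?F t) / (s - t)) \<longlongrightarrow> (LBINT x. u x * - d (x - t *\<^sub>R v))) (at t)"
    unfolding tendsto_at_iff_sequentially
  proof safe
    fix X :: "nat \<Rightarrow> real" assume X: "\<forall>i. X i \<in> UNIV - {t}" "X \<longlonglongrightarrow> t"
    obtain N where N: "\<And>n. n \<ge> N \<Longrightarrow> \<bar>X n - t\<bar> \<le> 1"
      using LIMSEQ_D[OF X(2), of 1] by (auto intro: less_imp_le)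
    have "(\<lambda>n. LBINT x. u x * ((\<psi> (x - X (n + N) *\<^sub>R v) - \<psi> (x - t *\<^sub>R v)) / (X (n + N) - t)))
       \<longlonglongrightarrow> (LBINT x. u x * - d (x - t *\<^sub>R v))"
    proof (rule integral_dominated_convergence)
      show "integrable lborel (\<lambda>x. B * norm (indicator K x *\<^sub>R u x))"
        using u K by (intro integrable_mult_right integrable_norm) (auto simp: locally_integrable_lborel_def)
      have *: "\<bar>u x\<bar> * (\<bar>\<psi> (x - X (n + N) *\<^sub>R v) - \<psi> (x - t *\<^sub>R v)\<bar> / \<bar>X (n + N) - t\<bar>)
          \<le> B * (indicator K x * \<bar>u x\<bar>)" for n x
      proof (cases "x \<in> K")
        case True
        have "\<bar>X (n + N) - t\<bar> > 0" using X(1) by auto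
        then have "\<bar>\<psi> (x - X (n + N) *\<^sub>R v) - \<psi> (x - t *\<^sub>R v)\<bar> / \<bar>X (n + N) - t\<bar> \<le> B"
          using lip[of x "X (n + N)"] by (subst pos_divide_le_eq) auto
        from mult_left_mono[OF this, of "\<bar>u x\<bar>"] show ?thesis using True by (simp add: mult.commute)
      next
        case False
        then show ?thesis using outside K_out[OF False, of t] K_out[OF False N[of "n + N"]] by simp
      qed
      show "AE x in lborel. norm (u x * ((\<psi> (x - X (n + N) *\<^sub>R v) - \<psi> (x - t *\<^sub>R v)) / (X (n + N) - t)))
          \<le> B * norm (indicator K x *\<^sub>R u x)" for n
        using *[of _ n] by (intro AE_I2) (simp add: abs_mult)
      show "AE x in lborel. (\<lambda>n. u x * ((\<psi> (x - X (n + N) *\<^sub>R v) - \<psi> (x - t *\<^sub>R v)) / (X (n + N) - t)))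
          \<longlonglongrightarrow> u x * - d (x - t *\<^sub>R v)"
      proof (intro AE_I2 tendsto_intros)
        fix x
        have "((\<lambda>s. (\<psi> (x - s *\<^sub>R v) - \<psi> (x - t *\<^sub>R v)) / (s - t)) \<longlongrightarrow> - d (x - t *\<^sub>R v)) (at t)"
          using line_derivative[OF \<psi>(1)] unfolding d_def has_field_derivative_iff by blast
        then have "(\<lambda>n. (\<psi> (x - X n *\<^sub>R v) - \<psi> (x - t *\<^sub>R v)) / (X n - t)) \<longlonglongrightarrow> - d (x - t *\<^sub>R v)"
          using X unfolding tendsto_at_iff_sequentially by (auto simp: comp_def)
        then show "(\<lambda>n. (\<psi> (x - X (n + N) *\<^sub>R v) - \<psi> (x - t *\<^sub>R v)) / (X (n + N) - t)) \<longlonglongrightarrow> - d (x - t *\<^sub>R v)"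
          by (rule LIMSEQ_ignore_initial_segment)
      qed
    qed measurable
    moreover have "(LBINT x. u x * ((\<psi> (x - X (n + N) *\<^sub>R v) - \<psi> (x - t *\<^sub>R v)) / (X (n + N) - t)))
        = (?F (X (n + N)) - ?F t) / (X (n + N) - t)" for n
    proof -
      have eq: "u x * ((\<psi> (x - X (n + N) *\<^sub>R v) - \<psi> (x - t *\<^sub>R v)) / (X (n + N) - t))
          = (u x * \<psi> (x - X (n + N) *\<^sub>R v) - u x * \<psi> (x - t *\<^sub>R v)) / (X (n + N) - t)" for x
        by (simp add: right_diff_distrib)
      show ?thesis unfolding eq using int[of t] int[OF N[of "n + N"]] by simp
    qed
    ultimately have "(\<lambda>n. (?F (X (n + N)) - ?F t) / (X (n + N) - t)) \<longlonglongrightarrow> (LBINT x. u x * - d (x - t *\<^sub>R v))"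
      by (simp only:)
    then show "((\<lambda>s. (?F s - ?F t) / (s - t)) \<circ> X) \<longlonglongrightarrow> (LBINT x. u x * - d (x - t *\<^sub>R v))"
      unfolding comp_def by (rule LIMSEQ_offset)
  qed
  then show ?thesis unfolding has_field_derivative_iff d_def by simp
qed

text \<open>The integral of \<open>\<phi> * \<psi>\<close> does not change under translation, so the integral of its directional
derivative is zero; the product rule does the rest.\<close>

lemma integration_by_parts_smooth:
  fixes \<phi> \<psi> :: "'a::euclidean_space \<Rightarrow> real"
  assumes \<phi>: "smooth \<phi>" and \<psi>: "test_function D \<psi>"
  shows "(LBINT x. \<phi> x * frechet_derivative \<psi> (at x) v)
    = - (LBINT x. frechet_derivative \<phi> (at x) v * \<psi> x)"
proof -
  let ?p = "\<lambda>x. \<phi> x * \<psi> x"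
  have sp: "smooth ?p" using \<phi> test_function_smooth[OF \<psi>] by (rule smooth_mult)
  have sub: "closure {x. ?p x \<noteq> 0} \<subseteq> closure {x. \<psi> x \<noteq> 0}" by (intro closure_mono) auto
  have cp: "compact (closure {x. \<psi> x \<noteq> 0})" using \<psi> by (simp add: test_function_def)
  then have "compact (closure {x. ?p x \<noteq> 0})"
    using sub by (rule compact_closure_of_subset)
  from integral_translate_has_derivative[OF continuous_locally_integrable sp this, of "\<lambda>x. 1" v 0]
  have "((\<lambda>t. LBINT x. ?p (x - t *\<^sub>R v)) has_real_derivative
           - (LBINT x. frechet_derivative ?p (at x) v)) (at 0)" by simp
  moreover have "(LBINT x. ?p (x - t *\<^sub>R v)) = (LBINT x. ?p x)" for t
    using lborel_integrable_translate_iff(2)[of ?p "- (t *\<^sub>R v)"] smooth_borel[OF sp] by simp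
  ultimately have "(LBINT x. frechet_derivative ?p (at x) v) = 0"
    using DERIV_unique[OF _ DERIV_const] by fastforce
  moreover have "frechet_derivative ?p (at x) v = \<phi> x * frechet_derivative \<psi> (at x) v + frechet_derivative \<phi> (at x) v * \<psi> x" for x
    using frechet_derivative_at[OF has_derivative_mult[OF smooth_has_derivative[OF \<phi>] smooth_has_derivative[OF test_function_smooth[OF \<psi>]]], of x]
    by metis
  moreover have "integrable lborel (\<lambda>x. \<phi> x * frechet_derivative \<psi> (at x) v)"
    "integrable lborel (\<lambda>x. frechet_derivative \<phi> (at x) v * \<psi> x)"
    using \<phi> smooth_directional_derivative[OF \<phi>] test_function_smooth[OF \<psi>] smooth_directional_derivative[OF test_function_smooth[OF \<psi>]]
      derivative_outside_support[OF test_function_smooth[OF \<psi>]] closure_subset[of "{x. \<psi> x \<noteq> 0}"]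
    by (intro locally_integrable_mult_bounded[OF _ cp] continuous_locally_integrable smooth_continuous; auto)+
  ultimately show ?thesis by simp
qed

section \<open>The translation estimate for weak gradients\<close>

text \<open>One would like to test with \<open>w\<close> itself. The truncations \<open>h n\<close> of \<open>w\<close> are bounded limits of test functions and satisfy
\<open>w * h n = (h n)\<^sup>2\<close>, hence their norms are at most \<open>M\<close>, and Fatou's lemma gives the bound for \<open>w\<close>.\<close>

lemma duality_norm_bound:
  fixes w :: "'a::euclidean_space \<Rightarrow> real"
  assumes w: "sq_integrable lborel w" and "open D" and M: "M \<ge> 0"
    and bound: "\<And>\<psi>. test_function D \<psi> \<Longrightarrow> (LBINT x. w x * \<psi> x) \<le> M * sqrt (LBINT x. (\<psi> x)\<^sup>2)"
  shows "(\<integral>\<^sup>+x\<in>D. ennreal ((w x)\<^sup>2) \<partial>lborel) \<le> ennreal (M\<^sup>2)"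
proof -
  have [measurable]: "w \<in> borel_measurable borel" using sq_integrableD(1)[OF w] by simp
  obtain K where K: "\<And>n::nat. compact (K n)" "\<And>n. K n \<subseteq> D" "incseq K" "(\<Union>n. K n) = D"
    using open_compact_exhaustion[OF \<open>open D\<close>] by metis
  have [measurable]: "K n \<in> sets borel" for n using K(1) by (simp add: borel_compact)
  have [measurable]: "D \<in> sets borel" using \<open>open D\<close> by simp
  define h where "h n x = (if x \<in> K n \<and> \<bar>w x\<bar> \<le> real n then w x else 0)" for n x
  have h_meas [measurable]: "h n \<in> borel_measurable borel" for n unfolding h_def[abs_def] by measurable
  have hw: "w x * h n x = (h n x)\<^sup>2" for n x by (simp add: h_def power2_eq_square)
  have h_le: "(\<integral>\<^sup>+x. ennreal ((h n x)\<^sup>2) \<partial>lborel) \<le> ennreal (M\<^sup>2)" for n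
  proof -
    have hb: "\<And>x. \<bar>h n x\<bar> \<le> real n" "\<And>x. x \<notin> K n \<Longrightarrow> h n x = 0" by (auto simp: h_def)
    have int: "integrable lborel (\<lambda>x. (h n x)\<^sup>2)"
      using sq_integrable_bound[OF w, of "h n"] by (auto simp: h_def sq_integrable_def)
    obtain \<psi> L B where \<psi>: "\<And>n::nat. test_function D (\<psi> n)" "compact L" "L \<subseteq> D"
        "\<And>n x. x \<notin> L \<Longrightarrow> \<psi> n x = 0" "\<And>n x. \<bar>\<psi> n x\<bar> \<le> B"
        "AE x in lborel. (\<lambda>m. \<psi> m x) \<longlonglongrightarrow> h n x"
      by (rule test_function_approx[of "h n" "real n" "K n" D])
        (use hb K \<open>open D\<close> in \<open>auto intro: measurable_completion\<close>)
    have [measurable]: "\<psi> m \<in> borel_measurable borel" for m using \<psi>(1) test_function_borel by blast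
    have KL: "compact (K n \<union> L)" using \<psi> K by auto
    then have "emeasure lborel (K n \<union> L) < \<infinity>" by (rule emeasure_bounded_finite[OF compact_imp_bounded])
    have "B \<ge> 0" using \<psi>(5)[of 0 undefined] by linarith
    have "(\<lambda>m. LBINT x. w x * \<psi> m x) \<longlonglongrightarrow> (LBINT x. w x * h n x)"
    proof (rule integral_test_limit)
      show "integrable lborel (\<lambda>x. indicator (K n \<union> L) x * w x)"
        using sq_integrable_locally_integrable[OF w] KL by (auto simp: locally_integrable_lborel_def)
    qed (use \<psi>(4-6) hb(2) in auto)
    moreover have "(\<lambda>m. LBINT x. (\<psi> m x)\<^sup>2) \<longlonglongrightarrow> (LBINT x. (h n x)\<^sup>2)"
    proof (rule integral_dominated_convergence)
      show "integrable lborel (\<lambda>x. B\<^sup>2 * indicator (K n \<union> L) x)"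
        using \<open>emeasure lborel (K n \<union> L) < \<infinity>\<close> KL
        by (intro integrable_mult_right integrable_real_indicator) (auto simp: borel_compact)
      show "AE x in lborel. norm ((\<psi> m x)\<^sup>2) \<le> B\<^sup>2 * indicator (K n \<union> L) x" for m
        using \<psi>(4,5) \<open>B \<ge> 0\<close> by (intro AE_I2) (auto simp: indicator_def abs_le_square_iff[symmetric])
      show "AE x in lborel. (\<lambda>m. (\<psi> m x)\<^sup>2) \<longlonglongrightarrow> (h n x)\<^sup>2"
        using \<psi>(6) by eventually_elim (intro tendsto_intros)
    qed measurable
    ultimately have "(LBINT x. w x * h n x) \<le> M * sqrt (LBINT x. (h n x)\<^sup>2)"
      using bound[OF \<psi>(1)] by (intro LIMSEQ_le[OF _ tendsto_mult[OF tendsto_const tendsto_real_sqrt]]) auto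
    then have le: "(LBINT x. (h n x)\<^sup>2) \<le> M * sqrt (LBINT x. (h n x)\<^sup>2)" (is "?I \<le> _")
      by (simp add: hw)
    have "?I \<ge> 0" by simp
    have "sqrt ?I \<le> M"
    proof (rule ccontr)
      assume "\<not> sqrt ?I \<le> M"
      then have "M * sqrt ?I < sqrt ?I * sqrt ?I" using M by (intro mult_strict_right_mono) linarith+
      then show False using le by simp
    qed
    then have "?I \<le> M\<^sup>2" using \<open>?I \<ge> 0\<close> by (simp add: sqrt_le_D)
    then show ?thesis using int by (subst nn_integral_eq_integral) (auto intro: ennreal_leI)
  qed
  have "(\<integral>\<^sup>+x\<in>D. ennreal ((w x)\<^sup>2) \<partial>lborel) = (\<integral>\<^sup>+x. liminf (\<lambda>n. ennreal ((h n x)\<^sup>2)) \<partial>lborel)"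
  proof (rule nn_integral_cong)
    fix x
    have "(\<lambda>n. ennreal ((h n x)\<^sup>2)) \<longlonglongrightarrow> ennreal ((w x)\<^sup>2) * indicator D x"
    proof (cases "x \<in> D")
      case True
      then obtain m where m: "x \<in> K m" using K(4) by auto
      have "eventually (\<lambda>n. (w x)\<^sup>2 = (h n x)\<^sup>2) sequentially"
        using eventually_ge_at_top[of "max m (nat \<lceil>\<bar>w x\<bar>\<rceil>)"]
      proof eventually_elim
        case (elim n)
        then have "x \<in> K n" using m K(3) by (auto simp: incseq_def)
        moreover have "\<bar>w x\<bar> \<le> real n" using elim by linarith
        ultimately show ?case by (simp add: h_def)
      qed
      then have "(\<lambda>n. (h n x)\<^sup>2) \<longlonglongrightarrow> (w x)\<^sup>2" by (rule Lim_transform_eventually[OF tendsto_const])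
      then show ?thesis using True by (simp add: tendsto_ennrealI)
    next
      case False
      then have "h n x = 0" for n using K(2) by (auto simp: h_def)
      then show ?thesis using False by simp
    qed
    then show "ennreal ((w x)\<^sup>2) * indicator D x = liminf (\<lambda>n. ennreal ((h n x)\<^sup>2))"
      by (simp add: lim_imp_Liminf)
  qed
  also have "\<dots> \<le> liminf (\<lambda>n. \<integral>\<^sup>+x. ennreal ((h n x)\<^sup>2) \<partial>lborel)"
    by (rule nn_integral_liminf) measurable
  also have "\<dots> \<le> liminf (\<lambda>n. ennreal (M\<^sup>2))"
    by (intro Liminf_mono always_eventually allI h_le)
  also have "\<dots> = ennreal (M\<^sup>2)" by (simp add: Liminf_const)
  finally show ?thesis .
qed

text \<open>The integration by parts rule of \<open>has_weak_gradient\<close>, written with the Borel measure on the whole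
space; test functions vanish outside \<open>D\<close>.\<close>

definition weak_gradient_on :: "'a::euclidean_space set \<Rightarrow> ('a \<Rightarrow> real) \<Rightarrow> ('a \<Rightarrow> 'a) \<Rightarrow> bool" where
  "weak_gradient_on D u g \<longleftrightarrow> (\<forall>\<psi>. test_function D \<psi> \<longrightarrow> (\<forall>b\<in>Basis.
     (LBINT x. u x * frechet_derivative \<psi> (at x) b) = - (LBINT x. (g x \<bullet> b) * \<psi> x)))"

lemma test_function_compact: "test_function D \<psi> \<Longrightarrow> compact (closure {x. \<psi> x \<noteq> 0})"
  by (simp add: test_function_def)

lemma integrable_mult_test_function:
  fixes u :: "'a::euclidean_space \<Rightarrow> real"
  assumes "locally_integrable_lborel u" "test_function D \<psi>"
  shows "integrable lborel (\<lambda>x. u x * \<psi> x)"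
    "integrable lborel (\<lambda>x. u x * frechet_derivative \<psi> (at x) v)"
  using assms(2) closure_subset[of "{x. \<psi> x \<noteq> 0}"]
  by (intro locally_integrable_mult_bounded[OF assms(1) test_function_compact[OF assms(2)]] smooth_continuous
       smooth_directional_derivative derivative_outside_support test_function_smooth[OF assms(2)]; auto)+

lemma sq_integrable_inner_const:
  fixes g :: "'x \<Rightarrow> 'b::euclidean_space"
  assumes "sq_integrable M g"
  shows "sq_integrable M (\<lambda>x. g x \<bullet> v)"
proof -
  have "sq_integrable M (\<lambda>x. norm v *\<^sub>R g x)" by (rule sq_integrable_scaleR[OF assms])
  then show ?thesis
    by (rule sq_integrable_bound)
      (use assms in \<open>auto simp: sq_integrable_def mult.commute[of "norm v"] Cauchy_Schwarz_ineq2\<close>)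
qed

lemma sq_integrable_test_function:
  assumes "test_function D \<psi>"
  shows "sq_integrable lborel \<psi>" "sq_integrable lborel (\<lambda>x. frechet_derivative \<psi> (at x) v)"
proof -
  note sm = test_function_smooth[OF assms]
  note sm' = smooth_directional_derivative[OF sm, of v]
  have "integrable lborel (\<lambda>x. \<psi> x * \<psi> x)"
    by (rule integrable_mult_test_function(1)[OF continuous_locally_integrable assms]) (rule smooth_continuous[OF sm])
  moreover have "integrable lborel (\<lambda>x. frechet_derivative \<psi> (at x) v * frechet_derivative \<psi> (at x) v)"
    by (rule integrable_mult_test_function(2)[OF continuous_locally_integrable assms]) (rule smooth_continuous[OF sm'])
  ultimately show "sq_integrable lborel \<psi>" "sq_integrable lborel (\<lambda>x. frechet_derivative \<psi> (at x) v)"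
    using smooth_borel[OF sm] smooth_borel[OF sm'] by (auto simp: sq_integrable_def power2_eq_square)
qed

lemma weak_gradient_direction:
  fixes u :: "'a::euclidean_space \<Rightarrow> real"
  assumes w: "weak_gradient_on D u g" and u: "sq_integrable lborel u" and g: "sq_integrable lborel g"
    and \<psi>: "test_function D \<psi>"
  shows "(LBINT x. u x * frechet_derivative \<psi> (at x) v) = - (LBINT x. (g x \<bullet> v) * \<psi> x)"
proof -
  have lin: "linear (frechet_derivative \<psi> (at x))" for x
    using smooth_has_derivative[OF test_function_smooth[OF \<psi>]] has_derivative_linear by blast
  have 1: "u x * frechet_derivative \<psi> (at x) v = (\<Sum>b\<in>Basis. (v \<bullet> b) * (u x * frechet_derivative \<psi> (at x) b))" for x
  proof -
    have "frechet_derivative \<psi> (at x) v = frechet_derivative \<psi> (at x) (\<Sum>b\<in>Basis. (v \<bullet> b) *\<^sub>R b)"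
      by (simp add: euclidean_representation)
    then show ?thesis by (simp add: linear_sum[OF lin] linear_scale[OF lin] sum_distrib_left mult_ac)
  qed
  have 2: "(g x \<bullet> v) * \<psi> x = (\<Sum>b\<in>Basis. (v \<bullet> b) * ((g x \<bullet> b) * \<psi> x))" for x
    by (subst euclidean_inner) (simp add: sum_distrib_left sum_distrib_right mult_ac)
  have i1: "integrable lborel (\<lambda>x. u x * frechet_derivative \<psi> (at x) b)" for b
    by (rule integrable_mult_test_function(2)[OF sq_integrable_locally_integrable[OF u] \<psi>])
  have i2: "integrable lborel (\<lambda>x. (g x \<bullet> b) * \<psi> x)" for b
    by (rule integrable_mult_test_function(1)[OF sq_integrable_locally_integrable[OF sq_integrable_inner_const[OF g]] \<psi>])
  have "(LBINT x. u x * frechet_derivative \<psi> (at x) v)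
      = (\<Sum>b\<in>Basis. (v \<bullet> b) * (LBINT x. u x * frechet_derivative \<psi> (at x) b))"
    unfolding 1 using i1 by (simp add: Bochner_Integration.integral_sum)
  also have "\<dots> = - (\<Sum>b\<in>Basis. (v \<bullet> b) * (LBINT x. (g x \<bullet> b) * \<psi> x))"
    using w \<psi> by (simp add: weak_gradient_on_def sum_negf)
  also have "(\<Sum>b\<in>Basis. (v \<bullet> b) * (LBINT x. (g x \<bullet> b) * \<psi> x)) = (LBINT x. (g x \<bullet> v) * \<psi> x)"
    unfolding 2 using i2 by (simp add: Bochner_Integration.integral_sum)
  finally show ?thesis .
qed

lemma test_function_translate:
  assumes \<psi>: "test_function U \<psi>" and sub: "\<And>x. x \<in> U \<Longrightarrow> x + a \<in> D"
  shows "test_function D (\<lambda>x. \<psi> (x - a))"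
proof -
  have "{x. \<psi> (x - a) \<noteq> 0} = (+) a ` {x. \<psi> x \<noteq> 0}"
    by (auto simp: image_iff intro!: exI[of _ "_ - a"])
  then have "closure {x. \<psi> (x - a) \<noteq> 0} = (+) a ` closure {x. \<psi> x \<noteq> 0}"
    by (simp add: closure_translation)
  moreover have "(+) a ` closure {x. \<psi> x \<noteq> 0} \<subseteq> D"
    using \<psi> sub by (auto simp: test_function_def add.commute[of a])
  ultimately show ?thesis
    using \<psi> smooth_translate by (auto simp: test_function_def compact_translation)
qed

text \<open>By duality it suffices to bound the integral of \<open>(u (x + v) - u x) * \<psi> x\<close> for test functions \<open>\<psi>\<close> on \<open>U\<close>.
Moving the translations to \<open>\<psi>\<close>, this is \<open>F 1 - F 0\<close> for \<open>F t = \<integral>u x * \<psi> (x - t *\<^sub>R v)\<close>. By the mean value theorem it equals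
a derivative of \<open>F\<close>, and because all the translates of \<open>\<psi>\<close> in question are test functions on \<open>D\<close>, the weak
gradient turns that derivative into the integral of \<open>(g x \<bullet> v) * \<psi> (x - t *\<^sub>R v)\<close>. Cauchy-Schwarz finishes.\<close>

lemma weak_gradient_translation_estimate:
  fixes u :: "'a::euclidean_space \<Rightarrow> real"
  assumes w: "weak_gradient_on D u g" and u: "sq_integrable lborel u" and g: "sq_integrable lborel g"
    and "open U" and sub: "\<And>x t. x \<in> U \<Longrightarrow> 0 \<le> t \<Longrightarrow> t \<le> 1 \<Longrightarrow> x + t *\<^sub>R v \<in> D"
  shows "(\<integral>\<^sup>+x\<in>U. ennreal ((u (x + v) - u x)\<^sup>2) \<partial>lborel)
    \<le> ennreal ((norm v)\<^sup>2) * (\<integral>\<^sup>+x. ennreal ((norm (g x))\<^sup>2) \<partial>lborel)"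
proof -
  let ?G = "LBINT x. (norm (g x))\<^sup>2"
  have [measurable]: "u \<in> borel_measurable borel" "g \<in> borel_measurable borel"
    using sq_integrableD(1)[OF u] sq_integrableD(1)[OF g] by auto
  have "(\<integral>\<^sup>+x\<in>U. ennreal ((u (x + v) - u x)\<^sup>2) \<partial>lborel) \<le> ennreal ((norm v * sqrt ?G)\<^sup>2)"
  proof (rule duality_norm_bound[OF sq_integrable_diff[OF sq_integrable_translate[OF u] u] \<open>open U\<close>])
    fix \<psi> assume \<psi>: "test_function U \<psi>"
    note [measurable] = test_function_borel[OF \<psi>]
    define F where "F t = (LBINT x. u x * \<psi> (x - t *\<^sub>R v))" for t
    define F' where "F' t = - (LBINT x. u x * frechet_derivative \<psi> (at (x - t *\<^sub>R v)) v)" for t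
    have F': "(F has_real_derivative F' t) (at t)" for t
      unfolding F_def F'_def
      by (rule integral_translate_has_derivative[OF sq_integrable_locally_integrable[OF u]
          test_function_smooth[OF \<psi>] test_function_compact[OF \<psi>]])
    obtain t where t: "0 < t" "t < 1" "F 1 - F 0 = F' t"
      using MVT2[of 0 1 F F'] F' by auto
    have tr: "test_function D (\<lambda>x. \<psi> (x - t *\<^sub>R v))"
      using \<psi> by (rule test_function_translate) (use sub t in auto)
    have "frechet_derivative (\<lambda>x. \<psi> (x - t *\<^sub>R v)) (at x) = frechet_derivative \<psi> (at (x - t *\<^sub>R v))" for x
      by (rule frechet_derivative_at[symmetric],
          use has_derivative_compose[OF has_derivative_diff[OF has_derivative_ident has_derivative_const]
              smooth_has_derivative[OF test_function_smooth[OF \<psi>]]] in simp)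
    then have F'_eq: "F' t = (LBINT x. (g x \<bullet> v) * \<psi> (x - t *\<^sub>R v))"
      using weak_gradient_direction[OF w u g tr, of v] by (simp add: F'_def)
    note \<psi>2 = sq_integrable_test_function(1)[OF \<psi>]
    have "(LBINT x. (norm (g x \<bullet> v))\<^sup>2) \<le> (LBINT x. (norm v)\<^sup>2 * (norm (g x))\<^sup>2)"
    proof (rule integral_mono)
      show "integrable lborel (\<lambda>x. (norm (g x \<bullet> v))\<^sup>2)"
        by (rule sq_integrableD(2)[OF sq_integrable_inner_const[OF g]])
      show "integrable lborel (\<lambda>x. (norm v)\<^sup>2 * (norm (g x))\<^sup>2)"
        using sq_integrableD(2)[OF g] by (rule integrable_mult_right)
      show "(norm (g x \<bullet> v))\<^sup>2 \<le> (norm v)\<^sup>2 * (norm (g x))\<^sup>2" for x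
        unfolding power_mult_distrib[symmetric] mult.commute[of "norm v"] real_norm_def
        by (intro power_mono Cauchy_Schwarz_ineq2) simp
    qed
    then have n1: "sqrt (LBINT x. (norm (g x \<bullet> v))\<^sup>2) \<le> norm v * sqrt ?G"
      by (metis integral_mult_right_zero norm_ge_zero real_sqrt_le_mono real_sqrt_mult real_sqrt_unique)
    have n2: "(LBINT x. (norm (\<psi> (x - t *\<^sub>R v)))\<^sup>2) = (LBINT x. (\<psi> x)\<^sup>2)"
      using lborel_integrable_translate_iff(2)[of "\<lambda>x. (\<psi> x)\<^sup>2" "- (t *\<^sub>R v)"] by simp
    have "F' t \<le> norm v * sqrt ?G * sqrt (LBINT x. (\<psi> x)\<^sup>2)"
    proof -
      have "sq_integrable lborel (\<lambda>x. \<psi> (x - t *\<^sub>R v))"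
        using sq_integrable_translate[OF \<psi>2, of "- (t *\<^sub>R v)"] by simp
      from sq_integrable_inner(2)[OF sq_integrable_inner_const[OF g, of v] this]
      have "F' t \<le> sqrt (LBINT x. (norm (g x \<bullet> v))\<^sup>2) * sqrt (LBINT x. (\<psi> x)\<^sup>2)"
        using F'_eq n2 by simp
      also have "\<dots> \<le> norm v * sqrt ?G * sqrt (LBINT x. (\<psi> x)\<^sup>2)"
        by (rule mult_right_mono[OF n1]) simp
      finally show ?thesis .
    qed
    moreover have "(LBINT x. (u (x + v) - u x) * \<psi> x) = F 1 - F 0"
    proof -
      have m: "(\<lambda>x. u x * \<psi> (x - v)) \<in> borel_measurable borel" by measurable
      have "integrable lborel (\<lambda>x. u (x + v) * \<psi> x)"
        by (rule integrable_mult_test_function(1)[OF sq_integrable_locally_integrable[OF sq_integrable_translate[OF u]] \<psi>])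
      moreover have "integrable lborel (\<lambda>x. u x * \<psi> x)"
        by (rule integrable_mult_test_function(1)[OF sq_integrable_locally_integrable[OF u] \<psi>])
      ultimately show ?thesis
        using lborel_integrable_translate_iff(2)[OF m, of v] by (simp add: F_def left_diff_distrib)
    qed
    ultimately show "(LBINT x. (u (x + v) - u x) * \<psi> x) \<le> norm v * sqrt ?G * sqrt (LBINT x. (\<psi> x)\<^sup>2)"
      using t(3) by simp
  qed simp
  also have "\<dots> = ennreal ((norm v)\<^sup>2) * ennreal ?G"
    by (simp add: power_mult_distrib ennreal_mult)
  also have "ennreal ?G = (\<integral>\<^sup>+x. ennreal ((norm (g x))\<^sup>2) \<partial>lborel)"
    using sq_integrableD(2)[OF g] by (subst nn_integral_eq_integral) auto
  finally show ?thesis .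
qed

section \<open>Oscillations and linked sets\<close>

lemma set_nn_integral_add:
  assumes [measurable]: "f \<in> borel_measurable M" "g \<in> borel_measurable M" "A \<in> sets M"
  shows "(\<integral>\<^sup>+x\<in>A. (f x + g x) \<partial>M) = (\<integral>\<^sup>+x\<in>A. f x \<partial>M) + (\<integral>\<^sup>+x\<in>A. g x \<partial>M)"
  by (simp add: distrib_right nn_integral_add)

lemma set_nn_integral_cmult:
  assumes [measurable]: "f \<in> borel_measurable M" "A \<in> sets M"
  shows "(\<integral>\<^sup>+x\<in>A. (c * f x) \<partial>M) = c * (\<integral>\<^sup>+x\<in>A. f x \<partial>M)"
  by (simp add: mult.assoc nn_integral_cmult)

lemma set_nn_integral_le:
  "(\<And>x. x \<in> A \<Longrightarrow> f x \<le> g x) \<Longrightarrow> (\<integral>\<^sup>+x\<in>A. f x \<partial>M) \<le> (\<integral>\<^sup>+x\<in>A. g x \<partial>M)"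
  by (intro nn_integral_mono) (auto simp: indicator_def)

lemma emeasure_lborel_bounded: "bounded A \<Longrightarrow> emeasure lborel A = ennreal (measure lborel A)"
  by (metis emeasure_bounded_finite emeasure_eq_ennreal_measure infinity_ennreal_def less_irrefl)

text \<open>Oscillations between sets behave like squared distances: they are symmetric, and they obey a
triangle inequality (\<open>osc_trans\<close>) through any intermediate set of positive measure.\<close>

definition osc :: "('a::euclidean_space \<Rightarrow> real) \<Rightarrow> 'a set \<Rightarrow> 'a set \<Rightarrow> ennreal" where
  "osc u A B = (\<integral>\<^sup>+x\<in>A. (\<integral>\<^sup>+y\<in>B. ennreal ((u x - u y)\<^sup>2) \<partial>lborel) \<partial>lborel)"

lemma osc_sym:
  fixes u :: "'a::euclidean_space \<Rightarrow> real"
  assumes [measurable]: "u \<in> borel_measurable borel" "A \<in> sets borel" "B \<in> sets borel"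
  shows "osc u A B = osc u B A"
proof -
  have "osc u A B = (\<integral>\<^sup>+x. \<integral>\<^sup>+y. ennreal ((u x - u y)\<^sup>2) * indicator B y * indicator A x \<partial>lborel \<partial>lborel)"
    unfolding osc_def by (simp add: nn_integral_multc)
  also have "\<dots> = (\<integral>\<^sup>+y. \<integral>\<^sup>+x. ennreal ((u x - u y)\<^sup>2) * indicator B y * indicator A x \<partial>lborel \<partial>lborel)"
    by (rule lborel_pair.Fubini'[symmetric]) measurable
  also have "\<dots> = (\<integral>\<^sup>+y. \<integral>\<^sup>+x. ennreal ((u y - u x)\<^sup>2) * indicator A x * indicator B y \<partial>lborel \<partial>lborel)"
    by (intro nn_integral_cong) (simp add: power2_commute mult_ac)
  also have "\<dots> = osc u B A"
    unfolding osc_def by (simp add: nn_integral_multc)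
  finally show ?thesis .
qed

lemma osc_mono: "A \<subseteq> A' \<Longrightarrow> B \<subseteq> B' \<Longrightarrow> osc u A B \<le> osc u A' B'"
  unfolding osc_def
  by (intro nn_integral_mono mult_mono) (auto simp: indicator_def intro!: nn_integral_mono)

lemma osc_Un_right:
  assumes [measurable]: "u \<in> borel_measurable borel" "A \<in> sets borel" "B \<in> sets borel" "C \<in> sets borel"
  shows "osc u A (B \<union> C) \<le> osc u A B + osc u A C"
proof -
  have "osc u A (B \<union> C) \<le> (\<integral>\<^sup>+x\<in>A. ((\<integral>\<^sup>+y\<in>B. ennreal ((u x - u y)\<^sup>2) \<partial>lborel)
      + (\<integral>\<^sup>+y\<in>C. ennreal ((u x - u y)\<^sup>2) \<partial>lborel)) \<partial>lborel)"
    unfolding osc_def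
    by (intro nn_integral_mono mult_right_mono, subst nn_integral_add[symmetric])
      (auto simp: indicator_def intro!: nn_integral_mono)
  also have "\<dots> = osc u A B + osc u A C"
    unfolding osc_def by (subst nn_integral_add[symmetric]) (auto simp: distrib_right)
  finally show ?thesis .
qed

lemma sq_diff_le: "(a - c)\<^sup>2 \<le> 2 * (a - b)\<^sup>2 + 2 * (b - c :: real)\<^sup>2"
  using norm_add_sq_le[of "a - b" "b - c"] by simp

text \<open>Integrate the pointwise inequality \<open>(u x - u z)\<^sup>2 \<le> 2 * (u x - u y)\<^sup>2 + 2 * (u y - u z)\<^sup>2\<close> over \<open>x \<in> A\<close>, \<open>y \<in> B\<close>,
\<open>z \<in> C\<close>.\<close>

lemma osc_trans:
  fixes u :: "'a::euclidean_space \<Rightarrow> real"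
  assumes [measurable]: "u \<in> borel_measurable borel" "A \<in> sets borel" "B \<in> sets borel" "C \<in> sets borel"
  shows "emeasure lborel B * osc u A C \<le> 2 * (emeasure lborel C * osc u A B + emeasure lborel A * osc u B C)"
proof -
  let ?d = "\<lambda>x y. ennreal ((u x - u y)\<^sup>2)"
  have "emeasure lborel B * osc u A C = (\<integral>\<^sup>+x\<in>A. (\<integral>\<^sup>+y\<in>B. (\<integral>\<^sup>+z\<in>C. ?d x z \<partial>lborel) \<partial>lborel) \<partial>lborel)"
  proof -
    have "emeasure lborel B * osc u A C
        = (\<integral>\<^sup>+x. emeasure lborel B * ((\<integral>\<^sup>+z\<in>C. ?d x z \<partial>lborel) * indicator A x) \<partial>lborel)"
      unfolding osc_def by (rule nn_integral_cmult[symmetric]) measurable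
    also have "\<dots> = (\<integral>\<^sup>+x\<in>A. (\<integral>\<^sup>+z\<in>C. ?d x z \<partial>lborel) * emeasure lborel B \<partial>lborel)"
      by (intro nn_integral_cong) (simp only: mult_ac)
    finally show ?thesis by (simp only: nn_integral_cmult_indicator assms(3) sets_lborel)
  qed
  also have "\<dots> \<le> (\<integral>\<^sup>+x\<in>A. (\<integral>\<^sup>+y\<in>B. (\<integral>\<^sup>+z\<in>C. (2 * ?d x y + 2 * ?d y z) \<partial>lborel) \<partial>lborel) \<partial>lborel)"
    by (intro nn_integral_mono mult_right_mono)
      (auto intro!: sq_diff_le simp flip: ennreal_plus ennreal_mult'' ennreal_numeral simp: ennreal_leI)
  also have "\<dots> = (\<integral>\<^sup>+x\<in>A. (\<integral>\<^sup>+y\<in>B. (2 * emeasure lborel C * ?d x y + 2 * (\<integral>\<^sup>+z\<in>C. ?d y z \<partial>lborel)) \<partial>lborel) \<partial>lborel)"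
  proof -
    have "(\<integral>\<^sup>+z\<in>C. (2 * ?d x y + 2 * ?d y z) \<partial>lborel) = 2 * emeasure lborel C * ?d x y + 2 * (\<integral>\<^sup>+z\<in>C. ?d y z \<partial>lborel)"
      for x y
      by (simp add: set_nn_integral_add set_nn_integral_cmult nn_integral_cmult_indicator) (simp add: mult_ac)
    then show ?thesis by (simp only:)
  qed
  also have "\<dots> = (\<integral>\<^sup>+x\<in>A. (2 * emeasure lborel C * (\<integral>\<^sup>+y\<in>B. ?d x y \<partial>lborel) + 2 * osc u B C) \<partial>lborel)"
    by (simp add: set_nn_integral_add set_nn_integral_cmult osc_def)
  also have "\<dots> = 2 * emeasure lborel C * osc u A B + 2 * osc u B C * emeasure lborel A"
    by (simp add: set_nn_integral_add set_nn_integral_cmult nn_integral_cmult_indicator osc_def) (simp add: mult.assoc)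
  finally show ?thesis by (simp add: distrib_left mult_ac)
qed

text \<open>The family \<open>P\<close> consists of functions, each with a value \<open>q\<close> of its energy. Linked sets are those between which
the oscillation is controlled by the energy, with one constant for the whole family. A set that is linked to itself
satisfies a Poincare inequality.\<close>

definition linked :: "(('a::euclidean_space \<Rightarrow> real) \<times> ennreal) set \<Rightarrow> 'a set \<Rightarrow> 'a set \<Rightarrow> bool" where
  "linked P A B \<longleftrightarrow> (\<exists>C::real. \<forall>(u, q) \<in> P. osc u A B \<le> ennreal C * q)"

definition borel_family :: "(('a::euclidean_space \<Rightarrow> real) \<times> ennreal) set \<Rightarrow> bool" where
  "borel_family P \<longleftrightarrow> (\<forall>(u, q) \<in> P. u \<in> borel_measurable borel)"

text \<open>A negative constant can be replaced by zero, since \<open>ennreal\<close> sends it there anyway.\<close>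

lemma linkedE:
  assumes "linked P A B"
  obtains C where "C \<ge> 0" "\<And>u q. (u, q) \<in> P \<Longrightarrow> osc u A B \<le> ennreal C * q"
proof -
  obtain C where C: "\<And>u q. (u, q) \<in> P \<Longrightarrow> osc u A B \<le> ennreal C * q"
    using assms unfolding linked_def by blast
  show ?thesis
  proof
    fix u q assume "(u, q) \<in> P"
    moreover have "ennreal C * q \<le> ennreal (max 0 C) * q" by (intro mult_right_mono ennreal_leI) auto
    ultimately show "osc u A B \<le> ennreal (max 0 C) * q" using C by (meson order_trans)
  qed simp
qed

lemma linked_sym:
  assumes "borel_family P" "linked P A B" "A \<in> sets borel" "B \<in> sets borel"
  shows "linked P B A"
  using assms osc_sym unfolding linked_def borel_family_def by fastforce

lemma linked_mono:
  assumes "linked P A B" "A' \<subseteq> A" "B' \<subseteq> B"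
  shows "linked P A' B'"
proof -
  obtain c where "\<And>u q. (u, q) \<in> P \<Longrightarrow> osc u A B \<le> ennreal c * q"
    using assms(1) linkedE by blast
  then have "osc u A' B' \<le> ennreal c * q" if "(u, q) \<in> P" for u q
    using order_trans[OF osc_mono[OF assms(2,3)]] that by blast
  then show ?thesis unfolding linked_def by blast
qed

lemma linked_Un_right:
  assumes P: "borel_family P" and AB: "linked P A B" "linked P A C"
    and S: "A \<in> sets borel" "B \<in> sets borel" "C \<in> sets borel"
  shows "linked P A (B \<union> C)"
proof -
  obtain c where c: "c \<ge> 0" "\<And>u q. (u, q) \<in> P \<Longrightarrow> osc u A B \<le> ennreal c * q"
    using AB(1) linkedE by blast
  obtain d where d: "d \<ge> 0" "\<And>u q. (u, q) \<in> P \<Longrightarrow> osc u A C \<le> ennreal d * q"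
    using AB(2) linkedE by blast
  have "osc u A (B \<union> C) \<le> ennreal (c + d) * q" if "(u, q) \<in> P" for u q
  proof -
    have "osc u A (B \<union> C) \<le> osc u A B + osc u A C"
      using P that S by (intro osc_Un_right) (auto simp: borel_family_def)
    also have "\<dots> \<le> ennreal c * q + ennreal d * q" using c(2) d(2) that by (intro add_mono)
    finally show ?thesis using c(1) d(1) by (simp add: distrib_right)
  qed
  then show ?thesis unfolding linked_def by blast
qed

lemma linked_empty_right: "linked P A {}"
  unfolding linked_def osc_def by (auto intro!: exI[of _ 0])

lemma linked_UN_right:
  assumes P: "borel_family P" and "finite I" "A \<in> sets borel"
    "\<And>i. i \<in> I \<Longrightarrow> B i \<in> sets borel" "\<And>i. i \<in> I \<Longrightarrow> linked P A (B i)"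
  shows "linked P A (\<Union>i\<in>I. B i)"
  using assms(2-) by (induction I rule: finite_induct) (auto intro!: linked_Un_right P linked_empty_right)

lemma linked_trans:
  assumes P: "borel_family P" and AB: "linked P A B" "linked P B C"
    and S: "A \<in> sets borel" "B \<in> sets borel" "C \<in> sets borel"
    and bdd: "bounded A" "bounded B" "bounded C" and B: "emeasure lborel B > 0"
  shows "linked P A C"
proof -
  obtain c where c: "c \<ge> 0" "\<And>u q. (u, q) \<in> P \<Longrightarrow> osc u A B \<le> ennreal c * q"
    using AB(1) linkedE by blast
  obtain d where d: "d \<ge> 0" "\<And>u q. (u, q) \<in> P \<Longrightarrow> osc u B C \<le> ennreal d * q"
    using AB(2) linkedE by blast
  define a b m where "a = measure lborel A" "b = measure lborel C" "m = measure lborel B"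
  have em: "emeasure lborel A = ennreal a" "emeasure lborel C = ennreal b" "emeasure lborel B = ennreal m"
    using bdd emeasure_lborel_bounded unfolding a_b_m_def by blast+
  have ab: "a \<ge> 0" "b \<ge> 0" "m > 0"
    using B em(3) by (auto simp: a_b_m_def ennreal_less_zero_iff zero_less_measure_iff)
  define K where "K = 2 * (b * c + a * d)"
  have "osc u A C \<le> ennreal (K / m) * q" if "(u, q) \<in> P" for u q
  proof -
    have "ennreal m * osc u A C \<le> 2 * (ennreal b * osc u A B + ennreal a * osc u B C)"
      using osc_trans[of u A B C] P that S em by (auto simp: borel_family_def)
    also have "\<dots> \<le> 2 * (ennreal b * (ennreal c * q) + ennreal a * (ennreal d * q))"
      using c(2) d(2) that by (intro mult_left_mono add_mono) auto
    also have "\<dots> = ennreal K * q"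
      using ab c(1) d(1) by (simp add: K_def ennreal_mult distrib_left distrib_right mult_ac)
    finally have "ennreal (1 / m) * (ennreal m * osc u A C) \<le> ennreal (1 / m) * (ennreal K * q)"
      by (rule mult_left_mono) simp
    moreover have "ennreal (1 / m) * ennreal m = 1" using ab(3) by (simp flip: ennreal_mult)
    moreover have "ennreal (1 / m) * ennreal K = ennreal (K / m)"
    proof -
      have "K \<ge> 0" using ab c(1) d(1) by (simp add: K_def)
      then show ?thesis using ab by (simp flip: ennreal_mult)
    qed
    ultimately show ?thesis by (simp flip: mult.assoc)
  qed
  then show ?thesis unfolding linked_def by blast
qed

text \<open>If translating \<open>U\<close> by \<open>v\<close> changes the functions only by an amount controlled by the energy, then a link to
the translate of \<open>U\<close> is as good as a link to \<open>U\<close>. This is how links reach the boundary of a domain.\<close>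

lemma linked_shift:
  fixes P :: "(('a::euclidean_space \<Rightarrow> real) \<times> ennreal) set"
  assumes P: "borel_family P" and S: "A \<in> sets borel" "U \<in> sets borel" "bounded A"
    and AV: "linked P A ((+) v ` U)"
    and shift: "\<And>u q. (u, q) \<in> P \<Longrightarrow> (\<integral>\<^sup>+x\<in>U. ennreal ((u (x + v) - u x)\<^sup>2) \<partial>lborel) \<le> ennreal c * q"
    and c: "c \<ge> 0" and V: "(+) v ` U \<in> sets borel"
  shows "linked P A U"
proof -
  obtain d where d: "d \<ge> 0" "\<And>u q. (u, q) \<in> P \<Longrightarrow> osc u A ((+) v ` U) \<le> ennreal d * q"
    using AV linkedE by blast
  define a where "a = measure lborel A"
  have em: "emeasure lborel A = ennreal a"
    unfolding a_def using S(3) by (rule emeasure_lborel_bounded)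
  have a: "a \<ge> 0" by (simp add: a_def)
  have "osc u A U \<le> ennreal (2 * d + 2 * a * c) * q" if uq: "(u, q) \<in> P" for u q
  proof -
    have [measurable]: "u \<in> borel_measurable borel" using P uq by (auto simp: borel_family_def)
    note [measurable] = S(1,2) V
    have shift_eq: "(\<integral>\<^sup>+y\<in>U. ennreal ((u x - u (y + v))\<^sup>2) \<partial>lborel)
        = (\<integral>\<^sup>+y\<in>(+) v ` U. ennreal ((u x - u y)\<^sup>2) \<partial>lborel)" for x
    proof -
      have "(\<lambda>y. ennreal ((u x - u y)\<^sup>2) * indicator ((+) v ` U) y) \<in> borel_measurable borel" by measurable
      from nn_integral_lborel_translate[OF this, of v]
      show ?thesis by (simp add: indicator_def image_iff add.commute[of _ v])
    qed
    have "osc u A U \<le> (\<integral>\<^sup>+x\<in>A. (\<integral>\<^sup>+y\<in>U. (2 * ennreal ((u x - u (y + v))\<^sup>2) + 2 * ennreal ((u (y + v) - u y)\<^sup>2)) \<partial>lborel) \<partial>lborel)"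
      unfolding osc_def
      by (intro nn_integral_mono mult_right_mono)
        (auto intro!: sq_diff_le simp flip: ennreal_plus ennreal_mult'' ennreal_numeral simp: ennreal_leI)
    also have "\<dots> = (\<integral>\<^sup>+x\<in>A. (2 * (\<integral>\<^sup>+y\<in>U. ennreal ((u x - u (y + v))\<^sup>2) \<partial>lborel)
        + 2 * (\<integral>\<^sup>+y\<in>U. ennreal ((u (y + v) - u y)\<^sup>2) \<partial>lborel)) \<partial>lborel)"
      by (simp add: set_nn_integral_add set_nn_integral_cmult)
    also have "\<dots> = 2 * osc u A ((+) v ` U) + 2 * (\<integral>\<^sup>+y\<in>U. ennreal ((u (y + v) - u y)\<^sup>2) \<partial>lborel) * ennreal a"
      unfolding shift_eq
      by (simp add: set_nn_integral_add set_nn_integral_cmult nn_integral_cmult_indicator osc_def em) (simp add: mult.assoc)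
    also have "\<dots> \<le> 2 * (ennreal d * q) + 2 * (ennreal c * q) * ennreal a"
      using d(2)[OF uq] shift[OF uq] by (intro add_mono mult_mono) auto
    also have "\<dots> = ennreal (2 * d + 2 * a * c) * q"
      using d(1) a c by (simp add: ennreal_mult distrib_left distrib_right mult_ac)
    finally show ?thesis .
  qed
  then show ?thesis unfolding linked_def by blast
qed

text \<open>The property of the family \<open>P\<close> that \<open>weak_gradient_translation_estimate\<close> yields when \<open>q\<close> dominates
the integral of the squared gradient.\<close>

definition translation_controlled ::
    "'a::euclidean_space set \<Rightarrow> (('a \<Rightarrow> real) \<times> ennreal) set \<Rightarrow> bool" where
  "translation_controlled D P \<longleftrightarrow> (\<forall>(u, q) \<in> P. \<forall>U v. open U \<longrightarrow>
     (\<forall>x\<in>U. \<forall>t\<in>{0..1}. x + t *\<^sub>R v \<in> D) \<longrightarrow>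
     (\<integral>\<^sup>+x\<in>U. ennreal ((u (x + v) - u x)\<^sup>2) \<partial>lborel) \<le> ennreal ((norm v)\<^sup>2) * q)"

text \<open>Write \<open>y = x + z\<close>. For fixed \<open>z\<close>, of norm at most the diameter, convexity keeps the segment from \<open>x\<close> to
\<open>x + z\<close> in the ball, so the translation estimate applies; then integrate over \<open>z\<close>.\<close>

lemma linked_ball:
  fixes D :: "'a::euclidean_space set"
  assumes P: "borel_family P" and T: "translation_controlled D P" and D: "ball p r \<subseteq> D"
  shows "linked P (ball p r) (ball p r)"
proof -
  let ?B = "ball p r"
  have "osc u ?B ?B \<le> ennreal ((2 * r)\<^sup>2 * measure lborel (ball (0::'a) (2 * r))) * q" if uq: "(u, q) \<in> P" for u q
  proof -
    have [measurable]: "u \<in> borel_measurable borel" using P uq by (auto simp: borel_family_def)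
    have [measurable]: "?B \<in> sets borel" by simp
    let ?f = "\<lambda>x z. ennreal ((u (x + z) - u x)\<^sup>2) * indicator ?B (x + z) * indicator ?B x"
    have "osc u ?B ?B = (\<integral>\<^sup>+x. \<integral>\<^sup>+y. ennreal ((u x - u y)\<^sup>2) * indicator ?B y * indicator ?B x \<partial>lborel \<partial>lborel)"
      unfolding osc_def by (simp add: nn_integral_multc)
    also have "\<dots> = (\<integral>\<^sup>+x. \<integral>\<^sup>+z. ?f x z \<partial>lborel \<partial>lborel)"
    proof (rule nn_integral_cong)
      fix x
      have "(\<lambda>y. ennreal ((u x - u y)\<^sup>2) * indicator ?B y * indicator ?B x) \<in> borel_measurable borel" by measurable
      from nn_integral_lborel_translate[OF this, of x]
      show "(\<integral>\<^sup>+y. ennreal ((u x - u y)\<^sup>2) * indicator ?B y * indicator ?B x \<partial>lborel) = (\<integral>\<^sup>+z. ?f x z \<partial>lborel)"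
        by (simp add: add.commute[of _ x] power2_commute[of "u x"])
    qed
    also have "\<dots> = (\<integral>\<^sup>+z. \<integral>\<^sup>+x. ?f x z \<partial>lborel \<partial>lborel)"
      by (rule lborel_pair.Fubini'[symmetric]) measurable
    also have "\<dots> \<le> (\<integral>\<^sup>+z. ennreal ((2 * r)\<^sup>2) * q * indicator (ball (0::'a) (2 * r)) z \<partial>lborel)"
    proof (rule nn_integral_mono)
      fix z :: 'a
      define U where "U = ?B \<inter> {x. x + z \<in> ?B}"
      have "open {x. x + z \<in> ?B}"
        by (rule open_Collect_less[of "\<lambda>x. dist p (x + z)" "\<lambda>x. r", folded mem_ball]) (auto intro!: continuous_intros)
      then have "open U" by (auto simp: U_def)
      have "x + t *\<^sub>R z \<in> D" if "x \<in> U" "t \<in> {0..1}" for x t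
      proof -
        have "(1 - t) *\<^sub>R x + t *\<^sub>R (x + z) \<in> ?B"
          using that by (intro convexD[OF convex_ball]) (auto simp: U_def)
        moreover have "(1 - t) *\<^sub>R x + t *\<^sub>R (x + z) = x + t *\<^sub>R z" by (simp add: algebra_simps)
        ultimately show ?thesis using D by auto
      qed
      then have le: "(\<integral>\<^sup>+x\<in>U. ennreal ((u (x + z) - u x)\<^sup>2) \<partial>lborel) \<le> ennreal ((norm z)\<^sup>2) * q"
        using T uq \<open>open U\<close> unfolding translation_controlled_def by blast
      have eq: "(\<integral>\<^sup>+x. ?f x z \<partial>lborel) = (\<integral>\<^sup>+x\<in>U. ennreal ((u (x + z) - u x)\<^sup>2) \<partial>lborel)"
        by (intro nn_integral_cong) (auto simp: U_def indicator_def)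
      show "(\<integral>\<^sup>+x. ?f x z \<partial>lborel) \<le> ennreal ((2 * r)\<^sup>2) * q * indicator (ball (0::'a) (2 * r)) z"
      proof (cases "U = {}")
        case True then show ?thesis unfolding eq by simp
      next
        case False
        then obtain x where "dist p x < r" "dist p (x + z) < r" by (auto simp: U_def)
        then have z: "norm z < 2 * r"
          using dist_triangle_less_add[of x p r "x + z" r] by (simp add: dist_commute)  (simp add: dist_norm)
        then have "ennreal ((norm z)\<^sup>2) * q \<le> ennreal ((2 * r)\<^sup>2) * q"
          by (intro mult_right_mono ennreal_leI power_mono) auto
        then show ?thesis using le z unfolding eq by simp
      qed
    qed
    also have "\<dots> = ennreal ((2 * r)\<^sup>2) * q * emeasure lborel (ball (0::'a) (2 * r))"
      by (rule nn_integral_cmult_indicator) simp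
    also have "emeasure lborel (ball (0::'a) (2 * r)) = ennreal (measure lborel (ball (0::'a) (2 * r)))"
      by (rule emeasure_lborel_bounded) simp
    finally show ?thesis by (simp add: ennreal_mult mult_ac)
  qed
  then show ?thesis unfolding linked_def by blast
qed

section \<open>Chains of links through a domain\<close>

lemma emeasure_lborel_open_pos:
  fixes U :: "'a::euclidean_space set"
  assumes "open U" "U \<noteq> {}"
  shows "emeasure lborel U > 0"
proof (rule ccontr)
  assume "\<not> emeasure lborel U > 0"
  then have "U \<in> null_sets lborel" using assms by (intro null_setsI) auto
  then have "negligible U" by (simp add: negligible_iff_null_sets null_sets_completionI)
  then show False using assms open_not_negligible by blast
qed

lemma linked_trans_open:
  fixes A B C :: "'a::euclidean_space set"
  assumes "borel_family P" "linked P A B" "linked P B C"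
    "open A" "open B" "open C" "bounded A" "bounded B" "bounded C" "B \<noteq> {}"
  shows "linked P A C"
  by (rule linked_trans[of P A B C]) (use assms emeasure_lborel_open_pos in auto)

lemma linked_sym_open:
  "borel_family P \<Longrightarrow> linked P A B \<Longrightarrow> open A \<Longrightarrow> open B \<Longrightarrow> linked P B A"
  by (rule linked_sym) auto

text \<open>Links from a fixed set add up over finite unions, so they only have to be found locally.\<close>

lemma linked_compact_cover:
  fixes D :: "'a::euclidean_space set"
  assumes P: "borel_family P" and K: "compact K" and "open A" "open D"
    and loc: "\<And>p. p \<in> K \<Longrightarrow> \<exists>W. open W \<and> p \<in> W \<and> linked P A (W \<inter> D)"
  shows "linked P A (K \<inter> D)"
proof -
  obtain W where W: "\<And>p. p \<in> K \<Longrightarrow> open (W p) \<and> p \<in> W p \<and> linked P A (W p \<inter> D)"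
    using loc by metis
  obtain I where I: "I \<subseteq> K" "finite I" "K \<subseteq> (\<Union>p\<in>I. W p)"
    using compactE_image[OF K, of K W] W by blast
  have "linked P A (\<Union>p\<in>I. W p \<inter> D)"
    by (rule linked_UN_right[OF P I(2)]) (use W I(1) \<open>open D\<close> \<open>open A\<close> in \<open>auto simp: subset_iff\<close>)
  then show ?thesis by (rule linked_mono) (use I(3) in auto)
qed

text \<open>Having linked balls around them is an equivalence relation between points of \<open>D\<close> with open classes;
transitivity passes through the smaller of two concentric balls.\<close>

lemma connected_balls_linked:
  fixes D :: "'a::euclidean_space set"
  assumes P: "borel_family P" and T: "translation_controlled D P"
    and D: "open D" "connected D" and a: "a \<in> D" and r: "r > 0" "ball a r \<subseteq> D" and b: "b \<in> D"
  shows "\<exists>s>0. ball b s \<subseteq> D \<and> linked P (ball a r) (ball b s)"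
proof -
  \<comment> \<open>The radii may differ from the given \<open>r\<close>; they are matched at the end.\<close>
  define R where "R x y \<longleftrightarrow> (\<exists>r>0. \<exists>s>0. ball x r \<subseteq> D \<and> ball y s \<subseteq> D \<and> linked P (ball x r) (ball y s))" for x y
  have "R a b"
  proof (rule connected_equivalence_relation[OF D(2) a b])
    show "R y x" if "R x y" for x y
      using that unfolding R_def by (meson P linked_sym_open open_ball)
    show "R x z" if "R x y" "R y z" for x y z
    proof -
      obtain r s where 1: "r > 0" "s > 0" "ball x r \<subseteq> D" "linked P (ball x r) (ball y s)"
        using \<open>R x y\<close> unfolding R_def by blast
      obtain s' t where 2: "s' > 0" "t > 0" "ball z t \<subseteq> D" "linked P (ball y s') (ball z t)"
        using \<open>R y z\<close> unfolding R_def by blast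
      have "linked P (ball x r) (ball y (min s s'))" "linked P (ball y (min s s')) (ball z t)"
        by (rule linked_mono[OF 1(4)] linked_mono[OF 2(4)]; auto)+
      then have "linked P (ball x r) (ball z t)"
        by (rule linked_trans_open[OF P]) (use 1 2 in auto)
      then show ?thesis unfolding R_def using 1 2 by blast
    qed
    show "\<exists>T. openin (top_of_set D) T \<and> x \<in> T \<and> (\<forall>y\<in>T. R x y)" if x: "x \<in> D" for x
    proof -
      obtain r where r: "r > 0" "ball x r \<subseteq> D" using D(1) x openE by blast
      have "R x y" if y: "y \<in> ball x r" for y
      proof -
        obtain s where s: "s > 0" "ball y s \<subseteq> ball x r" using y openE[OF open_ball] by blast
        have "linked P (ball x r) (ball y s)"
          by (rule linked_mono[OF linked_ball[OF P T r(2)]]) (use s in auto)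
        then show ?thesis unfolding R_def using r s by blast
      qed
      moreover have "openin (top_of_set D) (ball x r)" using r D(1) by (simp add: openin_open_eq)
      ultimately show ?thesis using r(1) by (metis centre_in_ball)
    qed
  qed
  then obtain r' s where rs: "r' > 0" "s > 0" "ball a r' \<subseteq> D" "ball b s \<subseteq> D" "linked P (ball a r') (ball b s)"
    unfolding R_def by blast
  have "linked P (ball a r) (ball a (min r r'))"
    by (rule linked_mono[OF linked_ball[OF P T r(2)]]) auto
  moreover have "linked P (ball a (min r r')) (ball b s)"
    by (rule linked_mono[OF rs(5)]) auto
  ultimately have "linked P (ball a r) (ball b s)"
    by (rule linked_trans_open[OF P]) (use r rs in auto)
  then show ?thesis using rs by blast
qed

text \<open>Near \<open>p\<close> the domain is the part above a graph. Moving upwards by a small amount keeps points of the domain inside,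
and it moves even the limit points, where \<open>\<gamma> (\<pi> x) \<le> x \<bullet> e\<close>, strictly above the graph. Hence the shifted piece
has a compact closure inside the domain.\<close>

lemma lipschitz_boundary_inward_shift:
  fixes D :: "'a::euclidean_space set"
  assumes D: "lipschitz_boundary D" and p: "p \<in> frontier D"
  obtains W v where "open W" "p \<in> W" "\<And>x t. x \<in> W \<inter> D \<Longrightarrow> 0 \<le> t \<Longrightarrow> t \<le> 1 \<Longrightarrow> x + t *\<^sub>R v \<in> D"
    "compact ((+) v ` closure (W \<inter> D))" "(+) v ` closure (W \<inter> D) \<subseteq> D"
proof -
  obtain r e \<gamma> L where r: "r > 0" and e: "norm e = 1" and lip: "L-lipschitz_on {z. z \<bullet> e = 0} \<gamma>"
    and graph: "D \<inter> ball p r = {x \<in> ball p r. \<gamma> (x - (x \<bullet> e) *\<^sub>R e) < x \<bullet> e}"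
    using D p unfolding lipschitz_boundary_def by blast
  define \<pi> where "\<pi> x = x - (x \<bullet> e) *\<^sub>R e" for x
  have ee: "e \<bullet> e = 1" using e by (simp add: norm_eq_1)
  have \<pi>_shift: "\<pi> (x + s *\<^sub>R e) = \<pi> x" for x s
    by (simp add: \<pi>_def inner_add_left ee algebra_simps)
  have "continuous_on UNIV (\<lambda>x. \<gamma> (\<pi> x))"
  proof (rule continuous_on_compose2[OF lipschitz_on_continuous_on[OF lip]])
    show "continuous_on UNIV \<pi>" unfolding \<pi>_def by (intro continuous_intros)
    show "\<pi> ` UNIV \<subseteq> {z. z \<bullet> e = 0}" by (auto simp: \<pi>_def inner_diff_left ee)
  qed
  then have closed: "closed {x. \<gamma> (\<pi> x) \<le> x \<bullet> e}"
    by (intro closed_Collect_le continuous_intros)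
  have in_D: "x + s *\<^sub>R e \<in> D" if "\<gamma> (\<pi> x) \<le> x \<bullet> e" "dist p x \<le> r / 2" "0 < s" "s < r / 2" for x s
  proof -
    have "dist p (x + s *\<^sub>R e) \<le> dist p x + norm (s *\<^sub>R e)"
      using norm_triangle_ineq4[of "p - x" "s *\<^sub>R e"] by (simp add: dist_norm algebra_simps)
    then have "x + s *\<^sub>R e \<in> ball p r" using that e by simp
    moreover have "\<gamma> (\<pi> (x + s *\<^sub>R e)) < (x + s *\<^sub>R e) \<bullet> e"
      using that by (simp add: \<pi>_shift inner_add_left ee)
    ultimately show ?thesis using graph unfolding \<pi>_def by blast
  qed
  show ?thesis
  proof
    define W where "W = ball p (r / 2)"
    \<comment> \<open>Points of \<open>W\<close> have distance at most \<open>r / 2\<close> from \<open>p\<close>, so a shift of length \<open>r / 4\<close> stays in the chart.\<close>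
    define v where "v = (r / 4) *\<^sub>R e"
    show "open W" "p \<in> W" using r by (auto simp: W_def)
    have W: "\<gamma> (\<pi> x) \<le> x \<bullet> e" "dist p x \<le> r / 2" if "x \<in> W \<inter> D" for x
      using that graph r unfolding W_def \<pi>_def by (auto simp: set_eq_iff) (smt (verit) that field_sum_of_halves)
    show "x + t *\<^sub>R v \<in> D" if "x \<in> W \<inter> D" "0 \<le> t" "t \<le> 1" for x t
    proof (cases "t = 0")
      case False
      have "t * r / 4 < r / 2" using r that(3) mult_right_mono[of t 1 r] by simp
      then show ?thesis using in_D[OF W[OF that(1)], of "t * r / 4"] that(2) False r by (simp add: v_def)
    qed (use that in auto)
    have "bounded (W \<inter> D)" by (auto simp: W_def bounded_Int)
    then show "compact ((+) v ` closure (W \<inter> D))" by (intro compact_translation compact_closure[THEN iffD2])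
    have "closure (W \<inter> D) \<subseteq> {x. \<gamma> (\<pi> x) \<le> x \<bullet> e} \<inter> cball p (r / 2)"
      by (rule closure_minimal) (use W closed in auto)
    then show "(+) v ` closure (W \<inter> D) \<subseteq> D"
      using in_D[of _ "r / 4"] r by (auto simp: v_def add.commute[of "_ *\<^sub>R e"] subset_iff)
  qed
qed

text \<open>The Poincare inequality of a connected Lipschitz domain. Fix a ball \<open>B\<close> in \<open>D\<close>. Around each interior point there is a ball linked
to \<open>B\<close>. A piece of \<open>D\<close> near a boundary point is shifted into a compact subset of \<open>D\<close>, which is covered by finitely many
such balls, and \<open>linked_shift\<close> carries the link back. Compactness of the closure then links \<open>B\<close> to \<open>D\<close>.\<close>

lemma linked_lipschitz_domain:
  fixes D :: "'a::euclidean_space set"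
  assumes P: "borel_family P" and T: "translation_controlled D P"
    and D: "open D" "bounded D" "connected D" "D \<noteq> {}" "lipschitz_boundary D"
  shows "linked P D D"
proof -
  obtain a where a: "a \<in> D" using D by blast
  obtain r where r: "r > 0" "ball a r \<subseteq> D" using D(1) a openE by blast
  let ?B = "ball a r"
  have interior: "\<exists>W. open W \<and> p \<in> W \<and> linked P ?B (W \<inter> D)" if p: "p \<in> D" for p
  proof -
    obtain s where s: "s > 0" "ball p s \<subseteq> D" "linked P ?B (ball p s)"
      using connected_balls_linked[OF P T D(1,3) a r p] by blast
    have "linked P ?B (ball p s \<inter> D)" by (rule linked_mono[OF s(3)]) auto
    then show ?thesis using s(1) by (intro exI[of _ "ball p s"]) auto
  qed
  have "\<exists>W. open W \<and> p \<in> W \<and> linked P ?B (W \<inter> D)" if p: "p \<in> closure D" for p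
  proof (cases "p \<in> D")
    case True then show ?thesis by (rule interior)
  next
    case False
    then have "p \<in> frontier D" using p D(1) by (simp add: frontier_def interior_open)
    then obtain W v where W: "open W" "p \<in> W" "\<And>x t. x \<in> W \<inter> D \<Longrightarrow> 0 \<le> t \<Longrightarrow> t \<le> 1 \<Longrightarrow> x + t *\<^sub>R v \<in> D"
      "compact ((+) v ` closure (W \<inter> D))" "(+) v ` closure (W \<inter> D) \<subseteq> D"
      using lipschitz_boundary_inward_shift[OF D(5)] by metis
    have WD: "open (W \<inter> D)" using W(1) D(1) by blast
    have "linked P ?B ((+) v ` closure (W \<inter> D) \<inter> D)"
      by (rule linked_compact_cover[OF P W(4) _ D(1)]) (use W(5) interior in auto)
    then have "linked P ?B ((+) v ` (W \<inter> D))"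
      by (rule linked_mono) (use W(5) closure_subset[of "W \<inter> D"] in auto)
    moreover have "(\<integral>\<^sup>+x\<in>W \<inter> D. ennreal ((u (x + v) - u x)\<^sup>2) \<partial>lborel) \<le> ennreal ((norm v)\<^sup>2) * q"
      if "(u, q) \<in> P" for u q
      using T that WD W(3) unfolding translation_controlled_def by auto
    ultimately have "linked P ?B (W \<inter> D)"
      by (intro linked_shift[OF P, of ?B "W \<inter> D" v "(norm v)\<^sup>2"])
        (use WD open_translation[OF WD, of v] in auto)
    then show ?thesis using W by blast
  qed
  then have "linked P ?B (closure D \<inter> D)"
    using D(1,2) by (intro linked_compact_cover[OF P]) auto
  then have BD: "linked P ?B D" using closure_subset[of D] by (simp add: Int_absorb1)
  show ?thesis
    by (rule linked_trans_open[OF P linked_sym_open[OF P BD] BD]) (use D r in auto)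
qed

text \<open>What a kernel that is bounded below on pairs of points at distance at most \<open>\<rho>\<close> provides.\<close>

definition near_linked :: "real \<Rightarrow> 'a::euclidean_space set \<Rightarrow> 'a set \<Rightarrow> (('a \<Rightarrow> real) \<times> ennreal) set \<Rightarrow> bool" where
  "near_linked \<rho> S T P \<longleftrightarrow> (\<forall>A B. open A \<longrightarrow> open B \<longrightarrow> A \<subseteq> S \<longrightarrow> B \<subseteq> T \<longrightarrow>
     (\<forall>x\<in>A. \<forall>y\<in>B. dist x y \<le> \<rho>) \<longrightarrow> linked P A B)"

lemma near_linked_balls:
  assumes N: "near_linked (2 * \<delta>) S T P" and \<delta>: "\<delta> > 0" and ST: "open S" "open T" and xy: "dist x y < \<delta>"
  shows "linked P (ball x (\<delta> / 4) \<inter> S) (ball y (\<delta> / 4) \<inter> T)"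
proof -
  have "dist x' y' \<le> 2 * \<delta>" if "dist x x' < \<delta> / 4" "dist y y' < \<delta> / 4" for x' y'
    using that xy \<delta> dist_triangle[of x' y' x] dist_triangle[of x y' y] by (simp add: dist_commute)
  then show ?thesis using ST by (intro N[unfolded near_linked_def, rule_format]) auto
qed

lemma ball_Int_nonempty: "x \<in> S \<Longrightarrow> r > 0 \<Longrightarrow> ball x r \<inter> S \<noteq> {}"
  by (metis IntI centre_in_ball empty_iff)

text \<open>Intersections of \<open>D\<close> with balls of radius \<open>\<delta> / 4\<close> are linked as soon as the centres are less than \<open>\<delta>\<close> apart. The
centres that can be reached from one of them by such links form a set \<open>A\<close> at distance at least \<open>\<delta>\<close> from the rest of \<open>D\<close>, so
by \<open>\<delta>\<close>-connectedness there is no rest.\<close>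

lemma linked_delta_connected:
  fixes D :: "'a::euclidean_space set"
  assumes P: "borel_family P" and N: "near_linked (2 * \<delta>) D D P" and \<delta>: "\<delta> > 0"
    and D: "open D" "bounded D" "delta_connected \<delta> D" "D \<noteq> {}"
  shows "linked P D D"
proof -
  define V where "V x = ball x (\<delta> / 4) \<inter> D" for x
  have V: "open (V x)" "bounded (V x)" for x using D(1,2) by (auto simp: V_def bounded_Int)
  have V_ne: "V x \<noteq> {}" if "x \<in> D" for x using that \<delta> by (simp add: V_def ball_Int_nonempty)
  have step: "linked P (V x) (V y)" if "dist x y < \<delta>" for x y
    unfolding V_def by (rule near_linked_balls[OF N \<delta> D(1,1) that])
  have trans: "linked P (V x) (V z)" if "linked P (V x) (V y)" "linked P (V y) (V z)" "y \<in> D" for x y z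
    by (rule linked_trans_open[OF P that(1,2)]) (use V V_ne that in auto)
  obtain a where a: "a \<in> D" using D by blast
  define A where "A = {y\<in>D. linked P (V a) (V y)}"
  define B where "B = D - A"
  have far: "\<delta> \<le> dist x y" if "x \<in> A" "y \<in> B" for x y
    using that step[of x y] trans[of a x y] unfolding A_def B_def by force
  have opA: "openin (top_of_set D) A" unfolding openin_contains_ball
  proof (intro conjI ballI)
    fix x assume x: "x \<in> A"
    have "ball x \<delta> \<inter> D \<subseteq> A" using far[OF x] by (force simp: B_def)
    then show "\<exists>e>0. ball x e \<inter> D \<subseteq> A" using \<delta> by blast
  qed (auto simp: A_def)
  have opB: "openin (top_of_set D) B" unfolding openin_contains_ball
  proof (intro conjI ballI)
    fix x assume x: "x \<in> B"
    have "ball x \<delta> \<inter> D \<subseteq> B" using far[OF _ x] by (force simp: B_def dist_commute)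
    then show "\<exists>e>0. ball x e \<inter> D \<subseteq> B" using \<delta> by blast
  qed (auto simp: B_def)
  have aA: "a \<in> A" using a step[of a a] \<delta> by (simp add: A_def)
  have "B = {}"
  proof (rule ccontr)
    assume "B \<noteq> {}"
    then have "\<delta> \<le> setdist A B" using aA far by (intro le_setdistI) auto
    then show False using D(3) opA opB aA \<open>B \<noteq> {}\<close> unfolding delta_connected_def
      by (metis A_def B_def Diff_disjoint Un_Diff_cancel empty_iff mem_Collect_eq subsetI sup.absorb2)
  qed
  then have all: "linked P (V a) (V y)" if "y \<in> D" for y using that by (auto simp: A_def B_def)
  have "linked P (V a) (closure D \<inter> D)"
  proof (rule linked_compact_cover[OF P _ V(1) D(1)])
    fix p assume "p \<in> closure D"
    then obtain y where "y \<in> D" "dist y p < \<delta> / 4" using \<delta> by (meson closure_approachable divide_pos_pos zero_less_numeral)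
    then show "\<exists>W. open W \<and> p \<in> W \<and> linked P (V a) (W \<inter> D)"
      using all[of y] unfolding V_def by (intro exI[of _ "ball y (\<delta> / 4)"]) auto
  qed (use D(2) in auto)
  then have VD: "linked P (V a) D" using closure_subset[of D] by (simp add: Int_absorb1)
  show ?thesis
    by (rule linked_trans_open[OF P linked_sym_open[OF P VD] VD]) (use D V V_ne a in auto)
qed

lemma linked_coupled_domains:
  fixes S T :: "'a::euclidean_space set"
  assumes P: "borel_family P" and S: "open S" "bounded S" "S \<noteq> {}" and T: "open T" "bounded T" "T \<noteq> {}"
    and SS: "linked P S S" and TT: "linked P T T"
    and N: "near_linked (2 * \<delta>) S T P" and \<delta>: "\<delta> > 0" and dist: "setdist S T < \<delta>"
  shows "linked P (S \<union> T) (S \<union> T)"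
proof -
  obtain x y where xy: "x \<in> S" "y \<in> T" "dist x y < \<delta>"
    using dist S(3) T(3) le_setdistI[of S T \<delta>] by (meson not_le)
  let ?A = "ball x (\<delta> / 4) \<inter> S" and ?B = "ball y (\<delta> / 4) \<inter> T"
  have A: "open ?A" "bounded ?A" "?A \<noteq> {}" using S xy(1) \<delta> by (auto simp: bounded_Int ball_Int_nonempty)
  have B: "open ?B" "bounded ?B" "?B \<noteq> {}" using T xy(2) \<delta> by (auto simp: bounded_Int ball_Int_nonempty)
  have AB: "linked P ?A ?B" by (rule near_linked_balls[OF N \<delta> S(1) T(1) xy(3)])
  have SA: "linked P S ?A" by (rule linked_mono[OF SS]) auto
  have BT: "linked P ?B T" by (rule linked_mono[OF TT]) auto
  have "linked P S ?B" by (rule linked_trans_open[OF P SA AB]) (use A B S in auto)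
  then have ST: "linked P S T" by (rule linked_trans_open[OF P _ BT]) (use B S T in auto)
  have TS: "linked P T S" by (rule linked_sym_open[OF P ST S(1) T(1)])
  have "linked P S (S \<union> T)" "linked P T (S \<union> T)"
    using linked_Un_right[OF P SS ST] linked_Un_right[OF P TS TT] S(1) T(1) by auto
  then have "linked P (S \<union> T) S" "linked P (S \<union> T) T"
    using linked_sym_open[OF P] S(1) T(1) by auto
  then show ?thesis using S(1) T(1) by (intro linked_Un_right[OF P]) auto
qed

text \<open>For \<open>u\<close> of mean zero and vanishing outside \<open>D\<close>, expanding the square shows that the integral over \<open>y \<in> D\<close>
of \<open>(u x - u y)\<^sup>2\<close> is at least the measure of \<open>D\<close> times \<open>(u x)\<^sup>2\<close>.\<close>

lemma poincare_of_linked: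
  fixes D :: "'a::euclidean_space set"
  assumes D: "open D" "bounded D" "D \<noteq> {}" and L: "linked P D D"
  obtains C where "C \<ge> 0" "\<And>u q. (u, q) \<in> P \<Longrightarrow> sq_integrable lborel u \<Longrightarrow>
     (AE x in lborel. x \<notin> D \<longrightarrow> u x = 0) \<Longrightarrow> (LBINT x. u x) = 0 \<Longrightarrow>
     (\<integral>\<^sup>+x. ennreal ((u x)\<^sup>2) \<partial>lborel) \<le> ennreal C * q"
proof -
  obtain c where c: "c \<ge> 0" "\<And>u q. (u, q) \<in> P \<Longrightarrow> osc u D D \<le> ennreal c * q"
    using L linkedE by blast
  define m where "m = measure lborel D"
  have em: "emeasure lborel D = ennreal m" using D(2) unfolding m_def by (rule emeasure_lborel_bounded)
  have m: "m > 0" using emeasure_lborel_open_pos[OF D(1,3)] em by (simp add: ennreal_less_zero_iff)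
  have [measurable]: "D \<in> sets borel" using D by simp
  show ?thesis
  proof
    show "c / m \<ge> 0" using c m by simp
    fix u :: "'a \<Rightarrow> real" and q
    assume uq: "(u, q) \<in> P" and u: "sq_integrable lborel u" and 0: "AE x in lborel. x \<notin> D \<longrightarrow> u x = 0"
      and mean: "(LBINT x. u x) = 0"
    have [measurable]: "u \<in> borel_measurable borel" using sq_integrableD(1)[OF u] by simp
    have int1: "integrable lborel (indicator D :: 'a \<Rightarrow> real)"
      using em by (intro integrable_real_indicator) auto
    then have "sq_integrable lborel (indicator D :: 'a \<Rightarrow> real)"
      by (simp add: sq_integrable_def power2_eq_square indicator_inter_arith[symmetric])
    from sq_integrable_inner(1)[OF u this]
    have intD: "integrable lborel (\<lambda>x. u x * indicator D x)" by simp
    have "(LBINT x. u x * indicator D x) = (LBINT x. u x)"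
      using 0 by (intro integral_cong_AE) (auto elim!: eventually_mono simp: indicator_def)
    then have mean': "(LBINT x. u x * indicator D x) = 0" using mean by simp
    have intD2: "integrable lborel (\<lambda>x. (u x)\<^sup>2 * indicator D x)"
      using sq_integrableD(2)[OF u]
      by (rule Bochner_Integration.integrable_bound) (auto simp: indicator_def)
    have inner: "ennreal (m * (u x)\<^sup>2) \<le> (\<integral>\<^sup>+y\<in>D. ennreal ((u x - u y)\<^sup>2) \<partial>lborel)" for x
    proof -
      have eq: "(u x - u y)\<^sup>2 * indicator D y = (u x)\<^sup>2 * indicator D y - 2 * u x * (u y * indicator D y) + (u y)\<^sup>2 * indicator D y" for y
        by (simp add: power2_diff algebra_simps)
      have I: "integrable lborel (\<lambda>y. (u x - u y)\<^sup>2 * indicator D y)"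
        unfolding eq using int1 intD intD2 by (intro Bochner_Integration.integrable_add Bochner_Integration.integrable_diff integrable_mult_right)
      have "(LBINT y. (u x - u y)\<^sup>2 * indicator D y) = (u x)\<^sup>2 * m + (LBINT y. (u y)\<^sup>2 * indicator D y)"
        unfolding eq using int1 intD intD2 mean'
        by (subst Bochner_Integration.integral_add Bochner_Integration.integral_diff integral_mult_right_zero
            | intro Bochner_Integration.integrable_diff integrable_mult_right | simp add: m_def)+
      moreover have "(LBINT y. (u y)\<^sup>2 * indicator D y) \<ge> 0" by simp
      ultimately have "m * (u x)\<^sup>2 \<le> (LBINT y. (u x - u y)\<^sup>2 * indicator D y)" by (simp add: mult.commute)
      then have "ennreal (m * (u x)\<^sup>2) \<le> (\<integral>\<^sup>+y. ennreal ((u x - u y)\<^sup>2 * indicator D y) \<partial>lborel)"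
        using I by (subst nn_integral_eq_integral) (auto intro: ennreal_leI)
      also have "\<dots> = (\<integral>\<^sup>+y\<in>D. ennreal ((u x - u y)\<^sup>2) \<partial>lborel)"
        by (intro nn_integral_cong) (auto simp: indicator_def)
      finally show ?thesis .
    qed
    have "ennreal m * (\<integral>\<^sup>+x. ennreal ((u x)\<^sup>2) \<partial>lborel) = (\<integral>\<^sup>+x\<in>D. ennreal (m * (u x)\<^sup>2) \<partial>lborel)"
    proof -
      have "(\<integral>\<^sup>+x. ennreal ((u x)\<^sup>2) \<partial>lborel) = (\<integral>\<^sup>+x\<in>D. ennreal ((u x)\<^sup>2) \<partial>lborel)"
        using 0 by (intro nn_integral_cong_AE) (auto elim!: eventually_mono simp: indicator_def)
      then show ?thesis using m by (simp add: ennreal_mult set_nn_integral_cmult)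
    qed
    also have "\<dots> \<le> osc u D D" unfolding osc_def by (intro set_nn_integral_le inner)
    also have "\<dots> \<le> ennreal c * q" using c(2) uq by blast
    finally have "ennreal (1 / m) * (ennreal m * (\<integral>\<^sup>+x. ennreal ((u x)\<^sup>2) \<partial>lborel)) \<le> ennreal (1 / m) * (ennreal c * q)"
      by (rule mult_left_mono) simp
    moreover have "ennreal (1 / m) * ennreal m = 1" using m by (simp flip: ennreal_mult)
    moreover have "ennreal (1 / m) * ennreal c = ennreal (c / m)" using m c by (simp flip: ennreal_mult)
    ultimately show "(\<integral>\<^sup>+x. ennreal ((u x)\<^sup>2) \<partial>lborel) \<le> ennreal (c / m) * q"
      by (simp flip: mult.assoc)
  qed
qed

section \<open>Minimization of a quadratic energy\<close>

text \<open>The setting of the theorem of Riesz for a form \<open>B\<close> that is positive semidefinite on a space \<open>V\<close> of functions and complete, and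
for a linear functional \<open>F\<close> that is bounded with respect to it.\<close>

locale energy_space =
  fixes V :: "('p \<Rightarrow> 'q::real_vector) set"
    and B :: "('p \<Rightarrow> 'q) \<Rightarrow> ('p \<Rightarrow> 'q) \<Rightarrow> real"
    and F :: "('p \<Rightarrow> 'q) \<Rightarrow> real" and C :: real
  assumes zero: "(\<lambda>x. 0) \<in> V"
    and add: "u \<in> V \<Longrightarrow> v \<in> V \<Longrightarrow> (\<lambda>x. u x + v x) \<in> V"
    and scale: "u \<in> V \<Longrightarrow> (\<lambda>x. c *\<^sub>R u x) \<in> V"
    and B_sym: "u \<in> V \<Longrightarrow> v \<in> V \<Longrightarrow> B u v = B v u"
    and B_add: "u \<in> V \<Longrightarrow> v \<in> V \<Longrightarrow> w \<in> V \<Longrightarrow> B (\<lambda>x. u x + v x) w = B u w + B v w"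
    and B_scale: "u \<in> V \<Longrightarrow> v \<in> V \<Longrightarrow> B (\<lambda>x. c *\<^sub>R u x) v = c * B u v"
    and B_nonneg: "u \<in> V \<Longrightarrow> B u u \<ge> 0"
    and F_add: "u \<in> V \<Longrightarrow> v \<in> V \<Longrightarrow> F (\<lambda>x. u x + v x) = F u + F v"
    and F_scale: "u \<in> V \<Longrightarrow> F (\<lambda>x. c *\<^sub>R u x) = c * F u"
    and C_nonneg: "C \<ge> 0"
    and F_bound: "u \<in> V \<Longrightarrow> (F u)\<^sup>2 \<le> C * B u u"
    and complete: "(\<And>n::nat. U n \<in> V) \<Longrightarrow>
      (\<And>e. e > 0 \<Longrightarrow> \<exists>N. \<forall>m\<ge>N. \<forall>n\<ge>N. B (\<lambda>x. U m x - U n x) (\<lambda>x. U m x - U n x) < e) \<Longrightarrow>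
      \<exists>u\<in>V. (\<lambda>n. B (\<lambda>x. U n x - u x) (\<lambda>x. U n x - u x)) \<longlonglongrightarrow> 0"
begin

definition energy :: "('p \<Rightarrow> 'q) \<Rightarrow> real" where
  "energy u = B u u / 2 - F u"

lemma diff: "u \<in> V \<Longrightarrow> v \<in> V \<Longrightarrow> (\<lambda>x. u x - v x) \<in> V"
  using add[OF _ scale[of v "-1"], of u] by simp

text \<open>A quadratic polynomial in \<open>t\<close>. Existence, uniqueness and the Euler-Lagrange equation are all read off from it.\<close>

lemma energy_line:
  assumes "u \<in> V" "w \<in> V"
  shows "energy (\<lambda>x. u x + t *\<^sub>R w x) = energy u + t * (B u w - F w) + t\<^sup>2 / 2 * B w w"
proof -
  let ?w = "\<lambda>x. t *\<^sub>R w x"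
  have w: "?w \<in> V" using assms(2) by (rule scale)
  have s: "(\<lambda>x. u x + ?w x) \<in> V" using assms(1) w by (rule add)
  have B_w: "B v ?w = t * B v w" if "v \<in> V" for v
    using B_sym[OF that w] B_scale[OF assms(2) that] B_sym[OF that assms(2)] by simp
  have "B (\<lambda>x. u x + ?w x) (\<lambda>x. u x + ?w x) = B u (\<lambda>x. u x + ?w x) + B ?w (\<lambda>x. u x + ?w x)"
    by (rule B_add[OF assms(1) w s])
  also have "B u (\<lambda>x. u x + ?w x) = B u u + t * B u w"
    using B_sym[OF assms(1) s] B_add[OF assms(1) w assms(1)] B_sym[OF w assms(1)] B_w[OF assms(1)] by simp
  also have "B ?w (\<lambda>x. u x + ?w x) = t * B u w + t * (t * B w w)"
    using B_sym[OF w s] B_add[OF assms(1) w w] B_w[OF assms(1)] B_w[OF w] B_scale[OF assms(2) assms(2)] by simp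
  finally show ?thesis
    unfolding energy_def using F_add[OF assms(1) w] F_scale[OF assms(2)]
    by (simp add: field_simps power2_eq_square)
qed

lemma B_Cauchy_Schwarz:
  assumes "u \<in> V" "w \<in> V"
  shows "(B u w)\<^sup>2 \<le> B u u * B w w"
proof -
  have quad: "0 \<le> B u u + 2 * t * B u w + t\<^sup>2 * B w w" for t
  proof -
    let ?w = "\<lambda>x. t *\<^sub>R w x"
    have "(\<lambda>x. u x + ?w x) \<in> V" using assms scale add by blast
    moreover have "F (\<lambda>x. u x + ?w x) = F u + t * F w"
      using F_add[OF assms(1) scale[OF assms(2)]] F_scale[OF assms(2)] by simp
    then have "B (\<lambda>x. u x + ?w x) (\<lambda>x. u x + ?w x) = B u u + 2 * t * B u w + t\<^sup>2 * B w w"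
      using energy_line[OF assms, of t] unfolding energy_def by (simp add: field_simps)
    ultimately show ?thesis using B_nonneg by metis
  qed
  show ?thesis
  proof (cases "B w w = 0")
    case True
    have "B u w = 0"
    proof (rule ccontr)
      assume "B u w \<noteq> 0"
      then show False using quad[of "- (B u u + 1) / (2 * B u w)"] True by (simp add: field_simps)
    qed
    then show ?thesis using True by simp
  next
    case False
    then have "B w w > 0" using B_nonneg[OF assms(2)] by simp
    then show ?thesis using quad[of "- B u w / B w w"] by (simp add: field_simps power2_eq_square)
  qed
qed

lemma energy_ge: "u \<in> V \<Longrightarrow> - C / 2 \<le> energy u"
proof -
  assume u: "u \<in> V"
  have "(2 * F u)\<^sup>2 \<le> (C + B u u)\<^sup>2"
    using F_bound[OF u] zero_le_power2[of "C - B u u"] by (simp add: power2_sum power2_diff power_mult_distrib)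
  then have "2 * F u \<le> C + B u u"
    using C_nonneg B_nonneg[OF u] power2_le_imp_le[of "2 * F u" "C + B u u"] by linarith
  then show ?thesis by (simp add: energy_def field_simps)
qed

lemma energy_midpoint:
  assumes "u \<in> V" "v \<in> V"
  shows "B (\<lambda>x. u x - v x) (\<lambda>x. u x - v x)
    = 4 * (energy u + energy v - 2 * energy (\<lambda>x. v x + (1 / 2) *\<^sub>R (u x - v x)))"
  using energy_line[OF assms(2) diff[OF assms], of 1] energy_line[OF assms(2) diff[OF assms], of "1 / 2"]
  by (simp add: field_simps power2_eq_square)

lemma midpoint: "u \<in> V \<Longrightarrow> v \<in> V \<Longrightarrow> (\<lambda>x. v x + (1 / 2) *\<^sub>R (u x - v x)) \<in> V"
  using add scale diff by blast

text \<open>Minimizing sequences are Cauchy by the parallelogram identity \<open>energy_midpoint\<close>, and the energy is continuous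
along the limit that completeness provides.\<close>

theorem minimizer_exists: "\<exists>u\<in>V. \<forall>v\<in>V. energy u \<le> energy v"
proof -
  define d where "d = Inf (energy ` V)"
  have bdd: "bdd_below (energy ` V)" using energy_ge by (intro bdd_belowI[of _ "- C / 2"]) auto
  have d_le: "d \<le> energy v" if "v \<in> V" for v unfolding d_def by (rule cINF_lower[OF bdd that])
  have "\<exists>u\<in>V. energy u < d + inverse (Suc n)" for n
  proof -
    have "\<exists>y\<in>energy ` V. y < d + inverse (Suc n)"
      unfolding d_def by (rule cInf_lessD) (use zero in auto)
    then show ?thesis by blast
  qed
  then obtain U where U: "\<And>n. U n \<in> V" "\<And>n. energy (U n) < d + inverse (Suc n)" by metis
  have Cauchy: "\<exists>N. \<forall>m\<ge>N. \<forall>n\<ge>N. B (\<lambda>x. U m x - U n x) (\<lambda>x. U m x - U n x) < e" if e: "e > 0" for e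
  proof -
    obtain N where N: "inverse (Suc N) < e / 8" using reals_Archimedean[of "e / 8"] e by auto
    have "B (\<lambda>x. U m x - U n x) (\<lambda>x. U m x - U n x) < e" if "m \<ge> N" "n \<ge> N" for m n
    proof -
      have "inverse (real (Suc m)) \<le> inverse (Suc N)" "inverse (real (Suc n)) \<le> inverse (Suc N)"
        using that by (auto simp: field_simps)
      moreover have "d \<le> energy (\<lambda>x. U n x + (1 / 2) *\<^sub>R (U m x - U n x))"
        by (intro d_le midpoint U)
      ultimately show ?thesis using energy_midpoint[OF U(1)[of m] U(1)[of n]] U(2)[of m] U(2)[of n] N by argo
    qed
    then show ?thesis by blast
  qed
  obtain u where u: "u \<in> V" and lim: "(\<lambda>n. B (\<lambda>x. U n x - u x) (\<lambda>x. U n x - u x)) \<longlonglongrightarrow> 0"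
    using complete[OF U(1) Cauchy] by blast
  define w where "w n = (\<lambda>x. U n x - u x)" for n
  have w: "w n \<in> V" for n unfolding w_def using U(1) u by (rule diff)
  have sq0: "(\<lambda>n. sqrt (K * B (w n) (w n))) \<longlonglongrightarrow> 0" for K
    using tendsto_real_sqrt[OF tendsto_mult[OF tendsto_const lim], of K] unfolding w_def by simp
  have Bu: "(\<lambda>n. B u (w n)) \<longlonglongrightarrow> 0"
    by (rule Lim_null_comparison[OF _ sq0[of "B u u"]])
      (use B_Cauchy_Schwarz[OF u w] in \<open>auto intro!: always_eventually real_le_rsqrt\<close>)
  have Fw: "(\<lambda>n. F (w n)) \<longlonglongrightarrow> 0"
    by (rule Lim_null_comparison[OF _ sq0[of C]])
      (use F_bound[OF w] in \<open>auto intro!: always_eventually real_le_rsqrt\<close>)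
  have "energy (U n) = energy u + (B u (w n) - F (w n)) + 1 / 2 * B (w n) (w n)" for n
    using energy_line[OF u w, of 1 n] by (simp add: w_def)
  then have "(\<lambda>n. energy (U n)) \<longlonglongrightarrow> energy u + (0 - 0) + 1 / 2 * 0"
    using tendsto_add[OF tendsto_add[OF tendsto_const tendsto_diff[OF Bu Fw]] tendsto_mult[OF tendsto_const lim]]
    unfolding w_def by (simp only:)
  moreover have "(\<lambda>n. d + inverse (Suc n)) \<longlonglongrightarrow> d + 0"
    by (intro tendsto_intros LIMSEQ_inverse_real_of_nat)
  ultimately have "energy u \<le> d"
    using U(2) by (intro LIMSEQ_le[of "\<lambda>n. energy (U n)" _ "\<lambda>n. d + inverse (Suc n)"]) (auto intro: less_imp_le)
  then show ?thesis using u d_le by (meson order_trans)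
qed

lemma minimizer_unique:
  assumes "u \<in> V" "v \<in> V" "\<And>w. w \<in> V \<Longrightarrow> energy u \<le> energy w" "\<And>w. w \<in> V \<Longrightarrow> energy v \<le> energy w"
  shows "B (\<lambda>x. u x - v x) (\<lambda>x. u x - v x) = 0"
proof -
  define m where "m = (\<lambda>x. v x + (1 / 2) *\<^sub>R (u x - v x))"
  have m: "m \<in> V" unfolding m_def using assms(1,2) by (rule midpoint)
  define b where "b = B (\<lambda>x. u x - v x) (\<lambda>x. u x - v x)"
  have "b = 4 * (energy u + energy v - 2 * energy m)" "b \<ge> 0"
    unfolding b_def m_def using assms(1,2) by (rule energy_midpoint, intro B_nonneg diff)
  moreover have "b \<le> 0" using calculation(1) assms(3)[OF m] assms(4)[OF m] by (simp add: algebra_simps)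
  ultimately have "b = 0" by simp
  then show ?thesis by (simp add: b_def)
qed

lemma euler_lagrange:
  assumes u: "u \<in> V" and min: "\<And>w. w \<in> V \<Longrightarrow> energy u \<le> energy w" and w: "w \<in> V"
  shows "B u w = F w"
proof -
  define a where "a = B u w - F w"
  define b where "b = B w w"
  have b: "b \<ge> 0" unfolding b_def by (rule B_nonneg[OF w])
  have "0 \<le> t * a + t\<^sup>2 / 2 * b" for t
    using min[OF add[OF u scale[OF w, of t]]] energy_line[OF u w, of t] by (simp add: a_def b_def)
  \<comment> \<open>The choice \<open>t = - a / b\<close> would be optimal; adding 1 avoids a division by zero.\<close>
  from this[of "- a / (b + 1)"] have "0 \<le> - a / (b + 1) * a + (- a / (b + 1))\<^sup>2 / 2 * b" .
  also have "\<dots> = - (a\<^sup>2 * (b + 2)) / (2 * (b + 1)\<^sup>2)"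
    using b by (simp add: divide_simps power2_eq_square) (simp add: algebra_simps)
  finally have "a\<^sup>2 * (b + 2) \<le> 0" using b by (auto simp: zero_le_divide_iff divide_le_0_iff)
  then have "a = 0" using b by (simp add: mult_le_0_iff)
  then show ?thesis by (simp add: a_def)
qed

end

section \<open>Completeness of spaces of square integrable functions\<close>

text \<open>Fatou's lemma upgrades almost everywhere convergence of a subsequence of a Cauchy sequence to
convergence of the whole sequence in the mean.\<close>

lemma L2_Cauchy_limit:
  fixes U :: "nat \<Rightarrow> 'x \<Rightarrow> 'b::euclidean_space"
  assumes U: "\<And>n. sq_integrable M (U n)" and f: "f \<in> borel_measurable M" and r: "strict_mono r"
    and AE: "AE x in M. (\<lambda>k. U (r k) x) \<longlonglongrightarrow> f x"
    and Cauchy: "\<And>e. e > 0 \<Longrightarrow> \<exists>N. \<forall>m\<ge>N. \<forall>n\<ge>N. (\<integral>x. (norm (U m x - U n x))\<^sup>2 \<partial>M) < e"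
  shows "sq_integrable M f" and "(\<lambda>n. \<integral>x. (norm (U n x - f x))\<^sup>2 \<partial>M) \<longlonglongrightarrow> 0"
proof -
  note [measurable] = f sq_integrableD(1)[OF U]
  have bound: "\<exists>N. \<forall>n\<ge>N. (\<integral>\<^sup>+x. ennreal ((norm (U n x - f x))\<^sup>2) \<partial>M) \<le> ennreal e" if e: "e > 0" for e
  proof -
    obtain N where N: "\<And>m n. m \<ge> N \<Longrightarrow> n \<ge> N \<Longrightarrow> (\<integral>x. (norm (U m x - U n x))\<^sup>2 \<partial>M) < e"
      using Cauchy[OF e] by blast
    have "(\<integral>\<^sup>+x. ennreal ((norm (U n x - f x))\<^sup>2) \<partial>M) \<le> ennreal e" if "n \<ge> N" for n
    proof -
      have "(\<integral>\<^sup>+x. ennreal ((norm (U n x - f x))\<^sup>2) \<partial>M)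
          = (\<integral>\<^sup>+x. liminf (\<lambda>k. ennreal ((norm (U n x - U (r (k + N)) x))\<^sup>2)) \<partial>M)"
      proof (rule nn_integral_cong_AE)
        show "AE x in M. ennreal ((norm (U n x - f x))\<^sup>2) = liminf (\<lambda>k. ennreal ((norm (U n x - U (r (k + N)) x))\<^sup>2))"
          using AE
        proof eventually_elim
          case (elim x)
          have "(\<lambda>k. ennreal ((norm (U n x - U (r (k + N)) x))\<^sup>2)) \<longlonglongrightarrow> ennreal ((norm (U n x - f x))\<^sup>2)"
            by (intro tendsto_ennrealI tendsto_intros LIMSEQ_ignore_initial_segment elim)
          then show ?case by (rule lim_imp_Liminf[OF sequentially_bot, symmetric])
        qed
      qed
      also have "\<dots> \<le> liminf (\<lambda>k. \<integral>\<^sup>+x. ennreal ((norm (U n x - U (r (k + N)) x))\<^sup>2) \<partial>M)"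
        by (rule nn_integral_liminf) measurable
      also have "\<dots> \<le> liminf (\<lambda>k. ennreal e)"
      proof (intro Liminf_mono always_eventually allI)
        fix k
        have "k + N \<le> r (k + N)" using r by (rule strict_mono_imp_increasing)
        then have "(\<integral>x. (norm (U n x - U (r (k + N)) x))\<^sup>2 \<partial>M) \<le> e"
          using N[OF \<open>n \<ge> N\<close>, of "r (k + N)"] by simp
        then show "(\<integral>\<^sup>+x. ennreal ((norm (U n x - U (r (k + N)) x))\<^sup>2) \<partial>M) \<le> ennreal e"
          using sq_integrableD(2)[OF sq_integrable_diff[OF U U]] 
          by (subst nn_integral_eq_integral) (auto intro: ennreal_leI)
      qed
      also have "\<dots> = ennreal e" by (simp add: Liminf_const)
      finally show ?thesis .
    qed
    then show ?thesis by blast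
  qed
  have sq: "sq_integrable M (\<lambda>x. U n x - f x)" if "(\<integral>\<^sup>+x. ennreal ((norm (U n x - f x))\<^sup>2) \<partial>M) \<le> ennreal e" for n e
    unfolding sq_integrable_iff_nn using that by (auto intro: le_less_trans)
  obtain N where N: "(\<integral>\<^sup>+x. ennreal ((norm (U N x - f x))\<^sup>2) \<partial>M) \<le> ennreal 1"
    using bound[of 1] by auto
  have "sq_integrable M (\<lambda>x. U N x - (U N x - f x))" by (rule sq_integrable_diff[OF U sq[OF N]])
  then show fsq: "sq_integrable M f" by simp
  show "(\<lambda>n. \<integral>x. (norm (U n x - f x))\<^sup>2 \<partial>M) \<longlonglongrightarrow> 0"
  proof (rule LIMSEQ_I)
    fix e :: real assume "e > 0"
    then obtain N where N: "\<And>n. n \<ge> N \<Longrightarrow> (\<integral>\<^sup>+x. ennreal ((norm (U n x - f x))\<^sup>2) \<partial>M) \<le> ennreal (e / 2)"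
      using bound[of "e / 2"] by auto
    have "norm ((\<integral>x. (norm (U n x - f x))\<^sup>2 \<partial>M) - 0) < e" if "n \<ge> N" for n
    proof -
      have "ennreal (\<integral>x. (norm (U n x - f x))\<^sup>2 \<partial>M) \<le> ennreal (e / 2)"
        using N[OF that] sq_integrableD(2)[OF sq_integrable_diff[OF U fsq]]
        by (subst (asm) nn_integral_eq_integral) auto
      then show ?thesis using \<open>e > 0\<close> by simp
    qed
    then show "\<exists>N. \<forall>n\<ge>N. norm ((\<integral>x. (norm (U n x - f x))\<^sup>2 \<partial>M) - 0) < e" by blast
  qed
qed

text \<open>Choose a subsequence whose consecutive differences \<open>\<Delta> k\<close> have squared norm at most \<open>(1/4) ^ k\<close>. Then the sum of
\<open>2 ^ k * (norm (\<Delta> k x))\<^sup>2\<close> has finite integral, hence is finite for almost every \<open>x\<close>, and since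
\<open>t \<le> 2 ^ k * t\<^sup>2 + (1/2) ^ k\<close>, the differences are absolutely summable there.\<close>

lemma L2_Cauchy_AE_subsequence:
  fixes U :: "nat \<Rightarrow> 'x \<Rightarrow> 'b::euclidean_space"
  assumes U: "\<And>n. sq_integrable M (U n)"
    and Cauchy: "\<And>e. e > 0 \<Longrightarrow> \<exists>N. \<forall>m\<ge>N. \<forall>n\<ge>N. (\<integral>x. (norm (U m x - U n x))\<^sup>2 \<partial>M) < e"
  obtains f r where "f \<in> borel_measurable M" "strict_mono (r :: nat \<Rightarrow> nat)" "AE x in M. (\<lambda>k. U (r k) x) \<longlonglongrightarrow> f x"
proof -
  note [measurable] = sq_integrableD(1)[OF U]
  have "\<exists>N. \<forall>m\<ge>N. \<forall>n\<ge>N. (\<integral>x. (norm (U m x - U n x))\<^sup>2 \<partial>M) < (1 / 4) ^ k" for k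
    by (rule Cauchy) simp
  then obtain N where N: "\<And>k m n. m \<ge> N k \<Longrightarrow> n \<ge> N k \<Longrightarrow> (\<integral>x. (norm (U m x - U n x))\<^sup>2 \<partial>M) < (1 / 4) ^ k"
    by metis
  define r where "r = rec_nat (N 0) (\<lambda>k s. max (Suc s) (N (Suc k)))"
  have r_Suc: "r (Suc k) = max (Suc (r k)) (N (Suc k))" for k by (simp add: r_def)
  have r: "strict_mono r" unfolding strict_mono_Suc_iff by (simp add: r_Suc less_max_iff_disj)
  have rN: "N k \<le> r k" for k by (cases k) (auto simp: r_def)
  define \<Delta> where "\<Delta> k x = U (r (Suc k)) x - U (r k) x" for k x
  have [measurable]: "\<Delta> k \<in> borel_measurable M" for k unfolding \<Delta>_def[abs_def] by measurable
  have \<Delta>: "(\<integral>\<^sup>+x. ennreal ((norm (\<Delta> k x))\<^sup>2) \<partial>M) \<le> ennreal ((1 / 4) ^ k)" for k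
  proof -
    have "r k \<le> r (Suc k)" using r by (simp add: strict_mono_less_eq)
    then have "(\<integral>x. (norm (\<Delta> k x))\<^sup>2 \<partial>M) \<le> (1 / 4) ^ k"
      unfolding \<Delta>_def using N[of k "r (Suc k)" "r k"] rN[of k] by simp
    then show ?thesis
      using sq_integrableD(2)[OF sq_integrable_diff[OF U U]] unfolding \<Delta>_def
      by (subst nn_integral_eq_integral) (auto intro: ennreal_leI)
  qed
  have "(\<integral>\<^sup>+x. (\<Sum>k. ennreal (2 ^ k * (norm (\<Delta> k x))\<^sup>2)) \<partial>M) = (\<Sum>k. \<integral>\<^sup>+x. ennreal (2 ^ k * (norm (\<Delta> k x))\<^sup>2) \<partial>M)"
    by (rule nn_integral_suminf) measurable
  also have "\<dots> \<le> (\<Sum>k. ennreal ((1 / 2) ^ k))"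
  proof (intro suminf_le summableI)
    fix k
    have "(\<integral>\<^sup>+x. ennreal (2 ^ k * (norm (\<Delta> k x))\<^sup>2) \<partial>M) = ennreal (2 ^ k) * (\<integral>\<^sup>+x. ennreal ((norm (\<Delta> k x))\<^sup>2) \<partial>M)"
      by (subst nn_integral_cmult[symmetric]) (auto simp: ennreal_mult)
    also have "\<dots> \<le> ennreal (2 ^ k) * ennreal ((1 / 4) ^ k)" by (intro mult_left_mono \<Delta>) simp
    also have "\<dots> = ennreal ((1 / 2) ^ k)" by (simp flip: ennreal_mult power_mult_distrib)
    finally show "(\<integral>\<^sup>+x. ennreal (2 ^ k * (norm (\<Delta> k x))\<^sup>2) \<partial>M) \<le> ennreal ((1 / 2) ^ k)" .
  qed
  also have "\<dots> < \<infinity>"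
    by (subst suminf_ennreal2) (auto intro: summable_geometric)
  finally have "AE x in M. (\<Sum>k. ennreal (2 ^ k * (norm (\<Delta> k x))\<^sup>2)) \<noteq> \<infinity>"
    by (intro nn_integral_PInf_AE) auto
  then have conv: "AE x in M. convergent (\<lambda>k. U (r k) x)"
  proof eventually_elim
    case (elim x)
    then have s1: "summable (\<lambda>k. 2 ^ k * (norm (\<Delta> k x))\<^sup>2)"
      by (intro summable_suminf_not_top) auto
    have "summable (\<lambda>k. \<Delta> k x)"
    proof (rule summable_comparison_test')
      show "summable (\<lambda>k. 2 ^ k * (norm (\<Delta> k x))\<^sup>2 + (1 / 2) ^ k)"
        by (intro summable_add s1 summable_geometric) simp
      fix k
      define s t :: real where "s = 2 ^ k" and "t = norm (\<Delta> k x)"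
      have "s > 0" by (simp add: s_def)
      have "2 * (s * t) \<le> (s * t)\<^sup>2 + 1" using sum_squares_bound[of "s * t" 1] by simp
      moreover have "0 \<le> s * t" using \<open>s > 0\<close> by (simp add: t_def)
      ultimately have "s * t \<le> s * (s * t\<^sup>2 + 1 / s)" 
        using \<open>s > 0\<close> by (simp add: algebra_simps power2_eq_square)
      then have "t \<le> s * t\<^sup>2 + 1 / s" using \<open>s > 0\<close> by (rule mult_left_le_imp_le)
      then show "norm (\<Delta> k x) \<le> 2 ^ k * (norm (\<Delta> k x))\<^sup>2 + (1 / 2) ^ k"
        by (simp add: s_def t_def power_one_over)
    qed
    then have "convergent (\<lambda>n. \<Sum>k<n. \<Delta> k x)" by (simp add: summable_iff_convergent)
    moreover have "(\<Sum>k<n. \<Delta> k x) = U (r n) x - U (r 0) x" for n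
      unfolding \<Delta>_def by (induction n) auto
    ultimately have "convergent (\<lambda>n. U (r n) x - U (r 0) x)" by simp
    from convergent_add[OF this convergent_const[of "U (r 0) x"]] show ?case by simp
  qed
  show ?thesis
  proof
    show "(\<lambda>x. lim (\<lambda>k. U (r k) x)) \<in> borel_measurable M"
      by (rule borel_measurable_lim_metric) measurable
    show "strict_mono r" by (rule r)
    show "AE x in M. (\<lambda>k. U (r k) x) \<longlonglongrightarrow> lim (\<lambda>k. U (r k) x)"
      using conv by eventually_elim (simp add: convergent_LIMSEQ_iff)
  qed
qed

section \<open>The energy space of the coupled problem\<close>

lemma AE_lborel_pair:
  assumes "AE x in lborel. P (x :: 'a::euclidean_space)"
  shows "AE z in (lborel \<Otimes>\<^sub>M lborel :: ('a \<times> 'a) measure). P (fst z) \<and> P (snd z)"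
proof -
  \<comment> \<open>The exceptional set need not be measurable, so it is enclosed in a Borel null set first.\<close>
  obtain N where N: "{x. \<not> P x} \<subseteq> N" "emeasure lborel N = 0" "N \<in> sets lborel"
    using AE_E[OF assms] by auto
  have "N \<times> UNIV \<in> null_sets (lborel \<Otimes>\<^sub>M (lborel :: 'a measure))"
    "UNIV \<times> N \<in> null_sets ((lborel :: 'a measure) \<Otimes>\<^sub>M lborel)"
    using N by (auto simp: null_sets_def lborel.emeasure_pair_measure_Times)
  then have "AE z in (lborel \<Otimes>\<^sub>M lborel :: ('a \<times> 'a) measure). z \<notin> N \<times> UNIV \<and> z \<notin> UNIV \<times> N"
    by (auto intro: AE_not_in)
  then show ?thesis by eventually_elim (use N(1) in auto)
qed

lemma L2_limit_inner:
  assumes U: "\<And>n::nat. sq_integrable M (U n)" and W: "sq_integrable M W" and h: "sq_integrable M h"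
    and lim: "(\<lambda>n. \<integral>x. (norm (U n x - W x))\<^sup>2 \<partial>M) \<longlonglongrightarrow> 0"
  shows "(\<lambda>n. \<integral>x. U n x \<bullet> h x \<partial>M) \<longlonglongrightarrow> (\<integral>x. W x \<bullet> h x \<partial>M)"
proof -
  let ?b = "\<lambda>n. sqrt (\<integral>x. (norm (U n x - W x))\<^sup>2 \<partial>M) * sqrt (\<integral>x. (norm (h x))\<^sup>2 \<partial>M)"
  have le: "norm ((\<integral>x. U n x \<bullet> h x \<partial>M) - (\<integral>x. W x \<bullet> h x \<partial>M)) \<le> ?b n" for n
  proof -
    have "(\<integral>x. (U n x - W x) \<bullet> h x \<partial>M) = (\<integral>x. U n x \<bullet> h x \<partial>M) - (\<integral>x. W x \<bullet> h x \<partial>M)"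
      unfolding inner_diff_left
      by (rule Bochner_Integration.integral_diff[OF sq_integrable_inner(1)[OF U h] sq_integrable_inner(1)[OF W h]])
    then show ?thesis using sq_integrable_inner(2)[OF sq_integrable_diff[OF U[of n] W] h] by (simp only: real_norm_def)
  qed
  have "?b \<longlonglongrightarrow> 0"
    using tendsto_mult[OF tendsto_real_sqrt[OF lim] tendsto_const[of "sqrt (\<integral>x. (norm (h x))\<^sup>2 \<partial>M)"]] by simp
  then have "(\<lambda>n. (\<integral>x. U n x \<bullet> h x \<partial>M) - (\<integral>x. W x \<bullet> h x \<partial>M)) \<longlonglongrightarrow> 0"
    by (rule Lim_null_comparison[OF always_eventually[OF allI[OF le]]])
  then show ?thesis by (simp add: LIM_zero_iff)
qed

lemma sq_integrable_fst_snd: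
  fixes U :: "'x \<Rightarrow> 'b::euclidean_space \<times> 'c::euclidean_space"
  assumes "sq_integrable M U"
  shows "sq_integrable M (\<lambda>x. fst (U x))" "sq_integrable M (\<lambda>x. snd (U x))"
proof -
  note [measurable] = sq_integrableD(1)[OF assms]
  have "(\<lambda>x. fst (U x)) \<in> borel_measurable M" "(\<lambda>x. snd (U x)) \<in> borel_measurable M"
    by (auto intro!: borel_measurable_continuous_on[OF continuous_on_fst[OF continuous_on_id]]
       borel_measurable_continuous_on[OF continuous_on_snd[OF continuous_on_id]])
  then show "sq_integrable M (\<lambda>x. fst (U x))" "sq_integrable M (\<lambda>x. snd (U x))"
    using sq_integrable_bound[OF assms] norm_fst_le norm_snd_le by (metis prod.collapse)+
qed

lemma sq_integrable_Pair:
  fixes f :: "'x \<Rightarrow> 'b::euclidean_space" and g :: "'x \<Rightarrow> 'c::euclidean_space"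
  assumes "sq_integrable M f" "sq_integrable M g"
  shows "sq_integrable M (\<lambda>x. (f x, g x))"
  using assms by (auto simp: sq_integrable_def norm_Pair intro!: borel_measurable_Pair)

lemma integral_norm_sq_prod:
  fixes U :: "'x \<Rightarrow> 'b::euclidean_space \<times> 'c::euclidean_space"
  assumes "sq_integrable M U"
  shows "(\<integral>x. (norm (U x))\<^sup>2 \<partial>M) = (\<integral>x. (norm (fst (U x)))\<^sup>2 \<partial>M) + (\<integral>x. (norm (snd (U x)))\<^sup>2 \<partial>M)"
proof -
  have "(norm (U x))\<^sup>2 = (norm (fst (U x)))\<^sup>2 + (norm (snd (U x)))\<^sup>2" for x
    by (cases "U x") (simp add: norm_Pair)
  then show ?thesis
    using sq_integrable_fst_snd[OF assms] by (simp add: sq_integrable_def)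
qed

lemma sq_integrable_test_pair:
  fixes b :: "'a::euclidean_space"
  assumes "test_function D \<psi>"
  shows "sq_integrable lborel (\<lambda>x. (frechet_derivative \<psi> (at x) b, \<psi> x *\<^sub>R b))"
  using sq_integrable_test_function[OF assms]
  by (intro sq_integrable_Pair) (auto simp: sq_integrable_def power_mult_distrib)

text \<open>A function and its weak gradient are carried along together as one function \<open>U\<close> with values in
\<open>real \<times> 'a\<close>. The nonlocal energies see only the differences of the first component.\<close>

definition jump :: "('a \<Rightarrow> real \<times> 'a) \<Rightarrow> 'a \<times> 'a \<Rightarrow> real" where
  "jump U = (\<lambda>(x, y). fst (U y) - fst (U x))"

lemma jump_linear:
  "jump (\<lambda>x. U x + W x) z = jump U z + jump W z" "jump (\<lambda>x. U x - W x) z = jump U z - jump W z"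
  "jump (\<lambda>x. c *\<^sub>R (U x :: real \<times> 'a::euclidean_space)) z = c *\<^sub>R jump U z" "jump (\<lambda>x. (0 :: real \<times> 'a)) z = 0"
  by (auto simp: jump_def algebra_simps split: prod.split)

lemma jump_measurable:
  fixes U :: "'a::euclidean_space \<Rightarrow> real \<times> 'a"
  assumes "U \<in> borel_measurable borel"
  shows "jump U \<in> borel_measurable (lborel \<Otimes>\<^sub>M lborel)"
proof -
  have [measurable]: "(\<lambda>x. fst (U x)) \<in> borel_measurable borel"
    by (rule borel_measurable_continuous_on[OF continuous_on_fst[OF continuous_on_id] assms])
  show ?thesis unfolding jump_def by (simp add: case_prod_unfold)
qed

text \<open>The two interactions are merged into one Borel kernel \<open>k\<close> on pairs of points, so that the nonlocal energy is a squared norm of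
\<open>jump U\<close> with respect to a single measure \<open>\<mu>\<close>. Pairs in \<open>\<Omega>n \<times> \<Omega>n\<close> stand for the interaction through \<open>J\<close>, those in \<open>\<Omega>l \<times> \<Omega>n\<close> for the one
through \<open>G\<close>.\<close>

locale coupled_domains =
  fixes \<Omega> \<Omega>l \<Omega>n :: "'a::euclidean_space set" and \<delta> c :: real
    and k :: "'a \<times> 'a \<Rightarrow> real" and f :: "'a \<Rightarrow> real"
  assumes Om: "open \<Omega>" "bounded \<Omega>"
    and l: "open \<Omega>l" "\<Omega>l \<noteq> {}" "\<Omega>l \<subseteq> \<Omega>" "connected \<Omega>l" "lipschitz_boundary \<Omega>l"
    and n: "open \<Omega>n" "\<Omega>n \<noteq> {}" "\<Omega>n \<subseteq> \<Omega>" "delta_connected \<delta> \<Omega>n"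
    and null: "AE x in lborel. x \<in> \<Omega> \<longrightarrow> x \<in> \<Omega>l \<union> \<Omega>n"
    and \<delta>: "\<delta> > 0" and dist: "setdist \<Omega>l \<Omega>n < \<delta>"
    and k_meas [measurable]: "k \<in> borel_measurable borel" and k_nonneg: "\<And>z. k z \<ge> 0"
    and c: "c > 0"
    and k_lower: "\<And>x y. x \<in> \<Omega>l \<union> \<Omega>n \<Longrightarrow> y \<in> \<Omega>n \<Longrightarrow> dist x y \<le> 2 * \<delta> \<Longrightarrow> c \<le> k (x, y)"
    and f: "sq_integrable lborel f"
begin

definition \<mu> :: "('a \<times> 'a) measure" where
  "\<mu> = density (lborel \<Otimes>\<^sub>M lborel) (\<lambda>z. ennreal (k z))"

lemma sets_\<mu> [measurable_cong]: "sets \<mu> = sets (lborel \<Otimes>\<^sub>M lborel)" by (simp add: \<mu>_def)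

lemma k_meas' [measurable]: "k \<in> borel_measurable (borel \<Otimes>\<^sub>M borel)"
  using k_meas by (simp add: borel_prod)

lemma AE_\<mu>: "AE z in lborel \<Otimes>\<^sub>M lborel. P z \<Longrightarrow> AE z in \<mu>. P z"
  unfolding \<mu>_def by (subst AE_density) (auto elim!: eventually_mono)

text \<open>The pairs of a function in \<open>H_Neu\<close> and its weak gradient, both extended by zero. Working with pairs makes the
energy a closed form: limits in the mean of admissible pairs are admissible. Finite energy is
the additional requirement in \<open>V\<close>.\<close>

definition admissible :: "('a \<Rightarrow> real \<times> 'a) \<Rightarrow> bool" where
  "admissible U \<longleftrightarrow> sq_integrable lborel U \<and> (\<forall>x. x \<notin> \<Omega> \<longrightarrow> fst (U x) = 0) \<and> (\<forall>x. x \<notin> \<Omega>l \<longrightarrow> snd (U x) = 0) \<and>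
     (LBINT x. fst (U x)) = 0 \<and> weak_gradient_on \<Omega>l (\<lambda>x. fst (U x)) (\<lambda>x. snd (U x))"

definition V :: "('a \<Rightarrow> real \<times> 'a) set" where
  "V = {U. admissible U \<and> sq_integrable \<mu> (jump U)}"

definition B :: "('a \<Rightarrow> real \<times> 'a) \<Rightarrow> ('a \<Rightarrow> real \<times> 'a) \<Rightarrow> real" where
  "B U W = (LBINT x. snd (U x) \<bullet> snd (W x)) + (\<integral>z. jump U z \<bullet> jump W z \<partial>\<mu>)"

definition F :: "('a \<Rightarrow> real \<times> 'a) \<Rightarrow> real" where
  "F U = (LBINT x. f x \<bullet> fst (U x))"

lemma mean_as_inner:
  assumes "\<forall>x. x \<notin> \<Omega> \<longrightarrow> fst (U x) = 0"
  shows "(LBINT x. fst (U x)) = (LBINT x. U x \<bullet> (indicator \<Omega> x, 0))"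
  using assms by (intro Bochner_Integration.integral_cong) (auto simp: inner_prod_def indicator_def)

text \<open>Both the mean and the weak gradient condition say that \<open>U\<close> is orthogonal to certain square integrable functions; therefore they are
stable under sums and limits.\<close>

lemma weak_gradient_as_inner:
  fixes U :: "'a \<Rightarrow> real \<times> 'a"
  assumes "sq_integrable lborel U"
  shows "weak_gradient_on D (\<lambda>x. fst (U x)) (\<lambda>x. snd (U x)) \<longleftrightarrow>
    (\<forall>\<psi>. test_function D \<psi> \<longrightarrow> (\<forall>b\<in>Basis.
       (LBINT x. U x \<bullet> (frechet_derivative \<psi> (at x) b, \<psi> x *\<^sub>R b)) = 0))"
proof -
  have "(LBINT x. U x \<bullet> (frechet_derivative \<psi> (at x) b, \<psi> x *\<^sub>R b)) =
      (LBINT x. fst (U x) * frechet_derivative \<psi> (at x) b) + (LBINT x. (snd (U x) \<bullet> b) * \<psi> x)"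
    if \<psi>: "test_function D \<psi>" for \<psi> b
  proof -
    have "integrable lborel (\<lambda>x. fst (U x) * frechet_derivative \<psi> (at x) b)"
      using sq_integrable_inner(1)[OF sq_integrable_fst_snd(1)[OF assms] sq_integrable_test_function(2)[OF \<psi>]] by simp
    moreover have "integrable lborel (\<lambda>x. (snd (U x) \<bullet> b) * \<psi> x)"
      using sq_integrable_inner(1)[OF sq_integrable_inner_const[OF sq_integrable_fst_snd(2)[OF assms]] sq_integrable_test_function(1)[OF \<psi>]] by simp
    ultimately show ?thesis by (simp add: inner_prod_def mult.commute)
  qed
  then show ?thesis unfolding weak_gradient_on_def by (auto simp: add_eq_0_iff)
qed

lemma sq_integrable_indicator: "sq_integrable lborel (indicator \<Omega> :: 'a \<Rightarrow> real)"
proof -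
  have "emeasure lborel \<Omega> < \<infinity>" using Om(2) by (rule emeasure_bounded_finite)
  then show ?thesis using Om(1)
    by (auto simp: sq_integrable_def power2_eq_square indicator_inter_arith[symmetric] intro!: integrable_real_indicator)
qed

lemma admissibleD:
  assumes "admissible U"
  shows "sq_integrable lborel U" "sq_integrable lborel (\<lambda>x. fst (U x))" "sq_integrable lborel (\<lambda>x. snd (U x))"
    "\<And>x. x \<notin> \<Omega> \<Longrightarrow> fst (U x) = 0" "\<And>x. x \<notin> \<Omega>l \<Longrightarrow> snd (U x) = 0" "(LBINT x. fst (U x)) = 0"
    "weak_gradient_on \<Omega>l (\<lambda>x. fst (U x)) (\<lambda>x. snd (U x))" "U \<in> borel_measurable borel"
    "(\<lambda>x. fst (U x)) \<in> borel_measurable borel" "(\<lambda>x. snd (U x)) \<in> borel_measurable borel"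
proof -
  show sq: "sq_integrable lborel U" using assms by (simp add: admissible_def)
  show "sq_integrable lborel (\<lambda>x. fst (U x))" "sq_integrable lborel (\<lambda>x. snd (U x))"
    by (rule sq_integrable_fst_snd[OF sq])+
  then show "U \<in> borel_measurable borel" "(\<lambda>x. fst (U x)) \<in> borel_measurable borel" "(\<lambda>x. snd (U x)) \<in> borel_measurable borel"
    using sq by (simp_all add: sq_integrable_def)
qed (use assms in \<open>simp_all add: admissible_def\<close>)

lemma V_admissible: "U \<in> V \<Longrightarrow> admissible U" and V_jump: "U \<in> V \<Longrightarrow> sq_integrable \<mu> (jump U)"
  by (simp_all add: V_def)

lemmas V_D = admissibleD[OF V_admissible]

lemma V_add: assumes "U \<in> V" "W \<in> V" shows "(\<lambda>x. U x + W x) \<in> V"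
proof -
  note U = V_D[OF assms(1)] and W = V_D[OF assms(2)]
  have s: "sq_integrable lborel (\<lambda>x. U x + W x)" using U(1) W(1) by (rule sq_integrable_add)
  have j: "jump (\<lambda>x. U x + W x) = (\<lambda>z. jump U z + jump W z)" by (simp add: jump_linear fun_eq_iff)
  have m: "(LBINT x. fst (U x + W x)) = 0"
    using mean_as_inner[of "\<lambda>x. U x + W x"] mean_as_inner[of U] mean_as_inner[of W] U(4,6) W(4,6)
      sq_integrable_inner(1)[OF U(1) sq_integrable_Pair[OF sq_integrable_indicator, of "\<lambda>x. 0::'a"]]
      sq_integrable_inner(1)[OF W(1) sq_integrable_Pair[OF sq_integrable_indicator, of "\<lambda>x. 0::'a"]]
    by (simp add: inner_add_left sq_integrable_def)
  have "weak_gradient_on \<Omega>l (\<lambda>x. fst (U x + W x)) (\<lambda>x. snd (U x + W x))"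
    unfolding weak_gradient_as_inner[OF s]
  proof (intro allI impI ballI)
    fix \<psi> and b :: 'a assume \<psi>: "test_function \<Omega>l \<psi>" and b: "b \<in> Basis"
    note h = sq_integrable_test_pair[OF \<psi>, of b]
    show "(LBINT x. (U x + W x) \<bullet> (frechet_derivative \<psi> (at x) b, \<psi> x *\<^sub>R b)) = 0"
      using U(7)[unfolded weak_gradient_as_inner[OF U(1)]] W(7)[unfolded weak_gradient_as_inner[OF W(1)]] \<psi> b
        sq_integrable_inner(1)[OF U(1) h] sq_integrable_inner(1)[OF W(1) h]
      by (simp add: inner_add_left)
  qed
  moreover have "sq_integrable \<mu> (jump (\<lambda>x. U x + W x))"
    unfolding j by (rule sq_integrable_add[OF V_jump[OF assms(1)] V_jump[OF assms(2)]])
  ultimately show ?thesis unfolding V_def admissible_def using s m U(4,5) W(4,5) by simp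
qed

lemma V_scale: assumes "U \<in> V" shows "(\<lambda>x. a *\<^sub>R U x) \<in> V"
proof -
  note U = V_D[OF assms]
  have j: "jump (\<lambda>x. a *\<^sub>R U x) = (\<lambda>z. a *\<^sub>R jump U z)" by (simp only: jump_linear fun_eq_iff) simp
  have "sq_integrable \<mu> (jump (\<lambda>x. a *\<^sub>R U x))"
    unfolding j by (rule sq_integrable_scaleR[OF V_jump[OF assms]])
  then show ?thesis unfolding V_def admissible_def
    using sq_integrable_scaleR[OF U(1)] U(4-7)
    by (simp add: weak_gradient_on_def mult.assoc)
qed

lemma V_diff: assumes "U \<in> V" "W \<in> V" shows "(\<lambda>x. U x - W x) \<in> V"
  using V_add[OF assms(1) V_scale[OF assms(2), of "-1"]] by simp

lemma V_zero: "(\<lambda>x. 0) \<in> V"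
  by (auto simp: V_def admissible_def sq_integrable_def jump_def weak_gradient_on_def case_prod_unfold)

lemma B_nonneg: "B U U \<ge> 0" and snd_le_B: "(LBINT x. (norm (snd (U x)))\<^sup>2) \<le> B U U"
  and jump_le_B: "(\<integral>z. (norm (jump U z))\<^sup>2 \<partial>\<mu>) \<le> B U U"
  by (simp_all add: B_def power2_norm_eq_inner flip: power2_eq_square)

lemma V_family_borel: "borel_family ((\<lambda>U. (\<lambda>x. fst (U x), ennreal (B U U))) ` V)"
  using V_D(9) by (auto simp: borel_family_def)

lemma V_family_translation: "translation_controlled \<Omega>l ((\<lambda>U. (\<lambda>x. fst (U x), ennreal (B U U))) ` V)"
  unfolding translation_controlled_def
proof clarify
  fix U v and S :: "'a set" assume U: "U \<in> V" and S: "open S" "\<forall>x\<in>S. \<forall>t\<in>{0..1}. x + t *\<^sub>R v \<in> \<Omega>l"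
  note D = V_D[OF U]
  have "(\<integral>\<^sup>+x\<in>S. ennreal ((fst (U (x + v)) - fst (U x))\<^sup>2) \<partial>lborel)
      \<le> ennreal ((norm v)\<^sup>2) * (\<integral>\<^sup>+x. ennreal ((norm (snd (U x)))\<^sup>2) \<partial>lborel)"
    by (rule weak_gradient_translation_estimate[OF D(7,2,3) S(1)]) (use S(2) in auto)
  also have "(\<integral>\<^sup>+x. ennreal ((norm (snd (U x)))\<^sup>2) \<partial>lborel) = ennreal (LBINT x. (norm (snd (U x)))\<^sup>2)"
    using sq_integrableD(2)[OF D(3)] by (subst nn_integral_eq_integral) auto
  also have "\<dots> \<le> ennreal (B U U)" by (rule ennreal_leI[OF snd_le_B])
  finally show "(\<integral>\<^sup>+x\<in>S. ennreal ((fst (U (x + v)) - fst (U x))\<^sup>2) \<partial>lborel) \<le> ennreal ((norm v)\<^sup>2) * ennreal (B U U)"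
    by (simp add: mult_left_mono)
qed

text \<open>Where the kernel is at least \<open>c\<close>, the indicator of the set of pairs is at most \<open>k / c\<close>.\<close>

lemma V_family_near_linked:
  assumes "S \<subseteq> \<Omega>l \<union> \<Omega>n"
  shows "near_linked (2 * \<delta>) S \<Omega>n ((\<lambda>U. (\<lambda>x. fst (U x), ennreal (B U U))) ` V)"
  unfolding near_linked_def
proof (intro allI impI)
  fix A T :: "'a set"
  assume A: "open A" "A \<subseteq> S" and T: "open T" "T \<subseteq> \<Omega>n" and near: "\<forall>x\<in>A. \<forall>y\<in>T. dist x y \<le> 2 * \<delta>"
  have [measurable]: "A \<in> sets borel" "T \<in> sets borel" using A T by auto
  have "osc (\<lambda>x. fst (U x)) A T \<le> ennreal (1 / c) * ennreal (B U U)" if U: "U \<in> V" for U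
  proof -
    note D = V_D[OF U]
    note [measurable] = D(9)
    let ?d = "\<lambda>x y. ennreal ((fst (U x) - fst (U y))\<^sup>2)"
    have "osc (\<lambda>x. fst (U x)) A T = (\<integral>\<^sup>+x. \<integral>\<^sup>+y. ?d x y * indicator T y * indicator A x \<partial>lborel \<partial>lborel)"
      unfolding osc_def by (simp add: nn_integral_multc)
    also have "\<dots> \<le> (\<integral>\<^sup>+x. \<integral>\<^sup>+y. ennreal (1 / c) * (ennreal (k (x, y)) * ?d x y) \<partial>lborel \<partial>lborel)"
    proof (intro nn_integral_mono)
      fix x y
      show "?d x y * indicator T y * indicator A x \<le> ennreal (1 / c) * (ennreal (k (x, y)) * ?d x y)"
      proof (cases "x \<in> A \<and> y \<in> T")
        case True
        then have "c \<le> k (x, y)" using k_lower[of x y] A T assms near by blast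
        then have "1 \<le> 1 / c * k (x, y)" using c by (simp add: field_simps)
        then have "1 * ?d x y \<le> ennreal (1 / c * k (x, y)) * ?d x y"
          by (intro mult_right_mono) (simp_all add: ennreal_le_iff flip: ennreal_1)
        also have "\<dots> = ennreal (1 / c) * (ennreal (k (x, y)) * ?d x y)"
          using c k_nonneg by (simp only: mult.assoc ennreal_mult less_imp_le divide_nonneg_nonneg zero_le_one)
        finally show ?thesis using True by simp
      qed (auto simp: indicator_def)
    qed
    also have "\<dots> = (\<integral>\<^sup>+z. ennreal (1 / c) * (ennreal (k z) * ?d (fst z) (snd z)) \<partial>(lborel \<Otimes>\<^sub>M lborel))"
      by (subst lborel.nn_integral_fst[symmetric]) auto
    also have "\<dots> = ennreal (1 / c) * (\<integral>\<^sup>+z. ennreal ((norm (jump U z))\<^sup>2) \<partial>\<mu>)"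
      unfolding \<mu>_def using jump_measurable[OF D(8)]
      by (subst nn_integral_density) (auto simp: nn_integral_cmult jump_def case_prod_unfold power2_commute)
    also have "(\<integral>\<^sup>+z. ennreal ((norm (jump U z))\<^sup>2) \<partial>\<mu>) = ennreal (\<integral>z. (norm (jump U z))\<^sup>2 \<partial>\<mu>)"
      using sq_integrableD(2)[OF V_jump[OF U]] by (subst nn_integral_eq_integral) auto
    also have "ennreal (1 / c) * \<dots> \<le> ennreal (1 / c) * ennreal (B U U)"
      by (intro mult_left_mono ennreal_leI jump_le_B) simp
    finally show ?thesis .
  qed
  then show "linked ((\<lambda>U. (\<lambda>x. fst (U x), ennreal (B U U))) ` V) A T"
    unfolding linked_def by (intro exI[of _ "1 / c"]) auto
qed

text \<open>The sets \<open>\<Omega>l\<close> and \<open>\<Omega>n\<close> are linked to themselves, the first through gradients and the second through the kernel, and the kernel also links them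
to each other because they are less than \<open>\<delta>\<close> apart.\<close>

lemma poincare:
  obtains C where "C \<ge> 0" "\<And>U. U \<in> V \<Longrightarrow> (LBINT x. (fst (U x))\<^sup>2) \<le> C * B U U"
proof -
  let ?P = "(\<lambda>U. (\<lambda>x. fst (U x), ennreal (B U U))) ` V"
  have bl: "bounded \<Omega>l" and bn: "bounded \<Omega>n" using bounded_subset[OF Om(2)] l(3) n(3) by auto
  have L: "linked ?P (\<Omega>l \<union> \<Omega>n) (\<Omega>l \<union> \<Omega>n)"
  proof (rule linked_coupled_domains[OF V_family_borel l(1) bl l(2) n(1) bn n(2) _ _ _ \<delta> dist])
    show "linked ?P \<Omega>l \<Omega>l"
      by (rule linked_lipschitz_domain[OF V_family_borel V_family_translation l(1) bl l(4,2,5)])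
    show "linked ?P \<Omega>n \<Omega>n"
      by (rule linked_delta_connected[OF V_family_borel V_family_near_linked \<delta> n(1) bn n(4,2)]) simp
    show "near_linked (2 * \<delta>) \<Omega>l \<Omega>n ?P" by (rule V_family_near_linked) simp
  qed
  obtain C where C: "C \<ge> 0" "\<And>u q. (u, q) \<in> ?P \<Longrightarrow> sq_integrable lborel u \<Longrightarrow>
     (AE x in lborel. x \<notin> \<Omega>l \<union> \<Omega>n \<longrightarrow> u x = 0) \<Longrightarrow> (LBINT x. u x) = 0 \<Longrightarrow>
     (\<integral>\<^sup>+x. ennreal ((u x)\<^sup>2) \<partial>lborel) \<le> ennreal C * q"
  proof (rule poincare_of_linked[OF _ _ _ L])
    show "open (\<Omega>l \<union> \<Omega>n)" "bounded (\<Omega>l \<union> \<Omega>n)" "\<Omega>l \<union> \<Omega>n \<noteq> {}"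
      using l(1,2) n(1) bl bn by auto
  qed (rule that)
  show ?thesis
  proof
    show "C \<ge> 0" by (rule C(1))
    fix U assume U: "U \<in> V"
    note D = V_D[OF U]
    have "AE x in lborel. x \<notin> \<Omega>l \<union> \<Omega>n \<longrightarrow> fst (U x) = 0"
      using null by eventually_elim (use D(4) in blast)
    then have "(\<integral>\<^sup>+x. ennreal ((fst (U x))\<^sup>2) \<partial>lborel) \<le> ennreal C * ennreal (B U U)"
      using U by (intro C(2) D(2,6)) auto
    also have "\<dots> = ennreal (C * B U U)" using C(1) B_nonneg by (simp add: ennreal_mult)
    also have "(\<integral>\<^sup>+x. ennreal ((fst (U x))\<^sup>2) \<partial>lborel) = ennreal (LBINT x. (fst (U x))\<^sup>2)"
      using sq_integrableD(2)[OF D(2)] by (subst nn_integral_eq_integral) auto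
    finally show "(LBINT x. (fst (U x))\<^sup>2) \<le> C * B U U"
      using C(1) B_nonneg by (simp add: ennreal_le_iff)
  qed
qed

text \<open>By the Poincare inequality a Cauchy sequence for \<open>B\<close> is Cauchy for the norm of \<open>L2\<close>. A subsequence converges almost
everywhere, and then so do its jumps, because \<open>\<mu>\<close> is absolutely continuous.\<close>

lemma V_complete:
  assumes U: "\<And>m::nat. U m \<in> V"
    and Cauchy: "\<And>e. e > 0 \<Longrightarrow> \<exists>N. \<forall>m\<ge>N. \<forall>n\<ge>N. B (\<lambda>x. U m x - U n x) (\<lambda>x. U m x - U n x) < e"
  shows "\<exists>W\<in>V. (\<lambda>m. B (\<lambda>x. U m x - W x) (\<lambda>x. U m x - W x)) \<longlonglongrightarrow> 0"
proof -
  obtain C where C: "C \<ge> 0" "\<And>U. U \<in> V \<Longrightarrow> (LBINT x. (fst (U x))\<^sup>2) \<le> C * B U U"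
    using poincare by blast
  have norm_le: "(LBINT x. (norm (W x))\<^sup>2) \<le> (C + 1) * B W W" if "W \<in> V" for W
    using integral_norm_sq_prod[OF V_D(1)[OF that]] C(2)[OF that] snd_le_B[of W] by (simp add: distrib_right)
  have CauchyL2: "\<exists>N. \<forall>m\<ge>N. \<forall>n\<ge>N. (LBINT x. (norm (U m x - U n x))\<^sup>2) < e" if e: "e > 0" for e
  proof -
    obtain N where N: "\<And>m n. m \<ge> N \<Longrightarrow> n \<ge> N \<Longrightarrow> B (\<lambda>x. U m x - U n x) (\<lambda>x. U m x - U n x) < e / (C + 1)"
      using Cauchy[of "e / (C + 1)"] C(1) e by auto
    have "(LBINT x. (norm (U m x - U n x))\<^sup>2) < e" if "m \<ge> N" "n \<ge> N" for m n
      using norm_le[OF V_diff[OF U U], of m n] N[OF that] C(1) by (simp add: field_simps)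
    then show ?thesis by blast
  qed
  have CauchyJ: "\<exists>N. \<forall>m\<ge>N. \<forall>n\<ge>N. (\<integral>z. (norm (jump (U m) z - jump (U n) z))\<^sup>2 \<partial>\<mu>) < e" if e: "e > 0" for e
    using Cauchy[OF e] jump_le_B[of "\<lambda>x. U _ x - U _ x"] unfolding jump_linear by (meson le_less_trans)
  obtain W' r where W': "W' \<in> borel_measurable lborel" and r: "strict_mono r"
    and AE': "AE x in lborel. (\<lambda>k. U (r k) x) \<longlonglongrightarrow> W' x"
    using L2_Cauchy_AE_subsequence[OF V_D(1)[OF U] CauchyL2] by blast
  \<comment> \<open>The almost everywhere limit is only determined up to a null set; cutting it off restores the zero extensions.\<close>
  define W where "W x = (indicator \<Omega> x * fst (W' x), indicator \<Omega>l x *\<^sub>R snd (W' x))" for x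
  have [measurable]: "\<Omega> \<in> sets borel" "\<Omega>l \<in> sets borel" using Om l by auto
  have [measurable]: "(\<lambda>x. fst (W' x)) \<in> borel_measurable borel" "(\<lambda>x. snd (W' x)) \<in> borel_measurable borel"
    using W' by (auto intro!: borel_measurable_continuous_on[OF continuous_on_fst[OF continuous_on_id]]
       borel_measurable_continuous_on[OF continuous_on_snd[OF continuous_on_id]])
  have W_meas: "W \<in> borel_measurable borel" unfolding W_def[abs_def] by (rule borel_measurable_Pair) measurable
  have AE: "AE x in lborel. (\<lambda>k. U (r k) x) \<longlonglongrightarrow> W x"
    using AE'
  proof eventually_elim
    case (elim x)
    have "(\<lambda>k. (indicator \<Omega> x * fst (U (r k) x), indicator \<Omega>l x *\<^sub>R snd (U (r k) x))) \<longlonglongrightarrow> W x"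
      unfolding W_def by (intro tendsto_intros elim)
    moreover have "(indicator \<Omega> x * fst (U (r k) x), indicator \<Omega>l x *\<^sub>R snd (U (r k) x)) = U (r k) x" for k
      using V_D(4,5)[OF U] by (auto simp: prod_eq_iff indicator_def)
    ultimately show ?case by simp
  qed
  have AEj: "AE z in \<mu>. (\<lambda>k. jump (U (r k)) z) \<longlonglongrightarrow> jump W z"
  proof (rule AE_\<mu>)
    show "AE z in lborel \<Otimes>\<^sub>M lborel. (\<lambda>k. jump (U (r k)) z) \<longlonglongrightarrow> jump W z"
      using AE_lborel_pair[OF AE] by eventually_elim (auto simp: jump_def case_prod_unfold intro!: tendsto_intros)
  qed
  have Wj_meas: "jump W \<in> borel_measurable \<mu>" using jump_measurable[OF W_meas] by (simp add: \<mu>_def)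
  have W_meas': "W \<in> borel_measurable lborel" using W_meas by simp
  have Wsq: "sq_integrable lborel W" and lim: "(\<lambda>m. LBINT x. (norm (U m x - W x))\<^sup>2) \<longlonglongrightarrow> 0"
    using L2_Cauchy_limit[OF V_D(1)[OF U] W_meas' r AE CauchyL2] by auto
  have Wj: "sq_integrable \<mu> (jump W)" and limj: "(\<lambda>m. \<integral>z. (norm (jump (U m) z - jump W z))\<^sup>2 \<partial>\<mu>) \<longlonglongrightarrow> 0"
    using L2_Cauchy_limit[OF V_jump[OF U] Wj_meas r AEj CauchyJ] by auto
  have orth: "(LBINT x. W x \<bullet> h x) = 0" if h: "sq_integrable lborel h" "\<And>m. (LBINT x. U m x \<bullet> h x) = 0" for h
    using L2_limit_inner[OF V_D(1)[OF U] Wsq h(1) lim] h(2) by (simp add: LIMSEQ_const_iff)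
  have W0: "\<And>x. x \<notin> \<Omega> \<Longrightarrow> fst (W x) = 0" "\<And>x. x \<notin> \<Omega>l \<Longrightarrow> snd (W x) = 0" by (auto simp: W_def)
  have "(LBINT x. fst (W x)) = 0"
  proof -
    have "(LBINT x. W x \<bullet> (indicator \<Omega> x, 0)) = 0"
    proof (rule orth)
      show "sq_integrable lborel (\<lambda>x. (indicator \<Omega> x :: real, 0::'a))"
        by (rule sq_integrable_Pair[OF sq_integrable_indicator]) (simp add: sq_integrable_def)
      show "(LBINT x. U m x \<bullet> (indicator \<Omega> x, 0)) = 0" for m
        using mean_as_inner[of "U m"] V_D(4,6)[OF U] by simp
    qed
    then show ?thesis using mean_as_inner[of W] W0(1) by simp
  qed
  moreover have "weak_gradient_on \<Omega>l (\<lambda>x. fst (W x)) (\<lambda>x. snd (W x))"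
    unfolding weak_gradient_as_inner[OF Wsq]
  proof (intro allI impI ballI orth)
    fix \<psi> m and b :: 'a assume \<psi>: "test_function \<Omega>l \<psi>" and b: "b \<in> Basis"
    show "sq_integrable lborel (\<lambda>x. (frechet_derivative \<psi> (at x) b, \<psi> x *\<^sub>R b))"
      by (rule sq_integrable_test_pair[OF \<psi>])
    show "(LBINT x. U m x \<bullet> (frechet_derivative \<psi> (at x) b, \<psi> x *\<^sub>R b)) = 0"
      using V_D(7)[OF U, unfolded weak_gradient_as_inner[OF V_D(1)[OF U]]] \<psi> b by blast
  qed
  ultimately have W: "W \<in> V" unfolding V_def admissible_def using Wsq W0 Wj by blast
  have "(\<lambda>m. B (\<lambda>x. U m x - W x) (\<lambda>x. U m x - W x)) \<longlonglongrightarrow> 0"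
  proof (rule tendsto_sandwich[OF _ _ tendsto_const])
    show "\<forall>\<^sub>F m in sequentially. 0 \<le> B (\<lambda>x. U m x - W x) (\<lambda>x. U m x - W x)" by (simp add: B_nonneg)
    have "B (\<lambda>x. U m x - W x) (\<lambda>x. U m x - W x)
        \<le> (LBINT x. (norm (U m x - W x))\<^sup>2) + (\<integral>z. (norm (jump (U m) z - jump W z))\<^sup>2 \<partial>\<mu>)" for m
      using integral_norm_sq_prod[OF V_D(1)[OF V_diff[OF U[of m] W]]]
      by (simp add: B_def jump_linear power2_norm_eq_inner flip: power2_eq_square)
    then show "\<forall>\<^sub>F m in sequentially. B (\<lambda>x. U m x - W x) (\<lambda>x. U m x - W x)
        \<le> (LBINT x. (norm (U m x - W x))\<^sup>2) + (\<integral>z. (norm (jump (U m) z - jump W z))\<^sup>2 \<partial>\<mu>)"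
      by (intro always_eventually allI)
    show "(\<lambda>m. (LBINT x. (norm (U m x - W x))\<^sup>2) + (\<integral>z. (norm (jump (U m) z - jump W z))\<^sup>2 \<partial>\<mu>)) \<longlonglongrightarrow> 0"
      using tendsto_add[OF lim limj] by simp
  qed
  then show ?thesis using W by blast
qed

lemma energy_space_V: "\<exists>C. energy_space V B F C"
proof -
  obtain C where C: "C \<ge> 0" "\<And>U. U \<in> V \<Longrightarrow> (LBINT x. (fst (U x))\<^sup>2) \<le> C * B U U"
    using poincare by blast
  define K where "K = (LBINT x. (norm (f x))\<^sup>2)"
  have K: "K \<ge> 0" by (simp add: K_def)
  have "energy_space V B F (K * C)"
  proof
    show "(F U)\<^sup>2 \<le> K * C * B U U" if U: "U \<in> V" for U
    proof -
      have "\<bar>F U\<bar> \<le> sqrt K * sqrt (LBINT x. (norm (fst (U x)))\<^sup>2)"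
        unfolding F_def K_def by (rule sq_integrable_inner(2)[OF f V_D(2)[OF U]])
      also have "\<dots> = sqrt (K * (LBINT x. (fst (U x))\<^sup>2))" by (simp add: real_sqrt_mult)
      finally have "(F U)\<^sup>2 \<le> K * (LBINT x. (fst (U x))\<^sup>2)"
        using K power_mono[of "\<bar>F U\<bar>" _ 2] by fastforce
      also have "\<dots> \<le> K * (C * B U U)" by (intro mult_left_mono C(2) U K)
      finally show ?thesis by (simp add: mult.assoc)
    qed
    show "B U W = B W U" for U W by (simp add: B_def inner_commute mult.commute)
    show "B (\<lambda>x. U x + W x) Z = B U Z + B W Z" if "U \<in> V" "W \<in> V" "Z \<in> V" for U W Z
      using sq_integrable_inner(1)[OF V_D(3)[OF that(1)] V_D(3)[OF that(3)]]
        sq_integrable_inner(1)[OF V_D(3)[OF that(2)] V_D(3)[OF that(3)]]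
        sq_integrable_inner(1)[OF V_jump[OF that(1)] V_jump[OF that(3)]]
        sq_integrable_inner(1)[OF V_jump[OF that(2)] V_jump[OF that(3)]]
      by (simp add: B_def jump_linear inner_add_left distrib_right)
    show "B (\<lambda>x. a *\<^sub>R U x) W = a * B U W" for a U W
      by (simp add: B_def jump_linear distrib_left mult.assoc)
    show "F (\<lambda>x. U x + W x) = F U + F W" if "U \<in> V" "W \<in> V" for U W
      using sq_integrable_inner(1)[OF f V_D(2)[OF that(1)]] sq_integrable_inner(1)[OF f V_D(2)[OF that(2)]]
      by (simp add: F_def distrib_left)
    show "F (\<lambda>x. a *\<^sub>R U x) = a * F U" for a U
      by (simp add: F_def mult.left_commute[of _ a])
  qed (use V_zero V_add V_scale B_nonneg V_complete K C(1) in auto)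
  then show ?thesis by blast
qed

end

section \<open>Borel representatives of Lebesgue measurable functions\<close>

lemma AE_lebesgue_on_iff:
  assumes "S \<in> sets borel"
  shows "(AE x in lebesgue_on S. P x) \<longleftrightarrow> (AE x in lborel. x \<in> S \<longrightarrow> P x)"
  using assms by (subst AE_restrict_space_iff) (auto simp: AE_completion_iff)

text \<open>Lebesgue measure is complete, so agreeing almost everywhere with a Borel function is enough for measurability. In
iterated integrals this is what makes the inner integrals measurable functions of the outer variable.\<close>

lemma lebesgue_on_eq_borel:
  fixes F h :: "'a::euclidean_space \<Rightarrow> 'b::euclidean_space"
  assumes S: "S \<in> sets borel" and h [measurable]: "h \<in> borel_measurable borel"
    and AE: "AE x in lborel. x \<in> S \<longrightarrow> F x = h x"
  shows "F \<in> borel_measurable (lebesgue_on S)"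
    and "(\<integral>x. F x \<partial>lebesgue_on S) = (LBINT x. indicator S x *\<^sub>R h x)"
    and "integrable (lebesgue_on S) F \<longleftrightarrow> integrable lborel (\<lambda>x. indicator S x *\<^sub>R h x)"
proof -
  note [measurable] = S
  have h': "(\<lambda>x. indicator S x *\<^sub>R h x) \<in> borel_measurable lborel" by measurable
  have AE': "AE x in lebesgue. indicator S x *\<^sub>R h x = (if x \<in> S then F x else 0)"
    by (rule AE_completion) (use AE in \<open>auto elim!: eventually_mono\<close>)
  have m: "(\<lambda>x. if x \<in> S then F x else 0) \<in> borel_measurable lebesgue"
    by (rule borel_measurable_AE[OF _ AE']) (rule measurable_completion[OF h'])
  then show "F \<in> borel_measurable (lebesgue_on S)"
    using S by (subst (asm) borel_measurable_if) auto
  have eq: "(\<lambda>x. indicator S x *\<^sub>R F x) = (\<lambda>x. if x \<in> S then F x else 0)" by (auto simp: indicator_def)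
  have "(\<integral>x. F x \<partial>lebesgue_on S) = (\<integral>x. (if x \<in> S then F x else 0) \<partial>lebesgue)"
    using S by (subst integral_restrict_space) (auto simp: eq)
  also have "\<dots> = (\<integral>x. indicator S x *\<^sub>R h x \<partial>lebesgue)"
    by (rule integral_cong_AE[OF m measurable_completion[OF h']]) (use AE' in \<open>auto elim!: eventually_mono\<close>)
  also have "\<dots> = (LBINT x. indicator S x *\<^sub>R h x)" by (rule integral_completion[OF h'])
  finally show "(\<integral>x. F x \<partial>lebesgue_on S) = (LBINT x. indicator S x *\<^sub>R h x)" .
  have "integrable (lebesgue_on S) F \<longleftrightarrow> integrable lebesgue (\<lambda>x. if x \<in> S then F x else 0)"
    using S by (subst integrable_restrict_space) (auto simp: eq)
  also have "\<dots> \<longleftrightarrow> integrable lebesgue (\<lambda>x. indicator S x *\<^sub>R h x)"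
    by (rule integrable_cong_AE[OF m measurable_completion[OF h']]) (use AE' in \<open>auto elim!: eventually_mono\<close>)
  also have "\<dots> \<longleftrightarrow> integrable lborel (\<lambda>x. indicator S x *\<^sub>R h x)" by (rule integrable_completion[OF h'])
  finally show "integrable (lebesgue_on S) F \<longleftrightarrow> integrable lborel (\<lambda>x. indicator S x *\<^sub>R h x)" .
qed

lemma nn_integral_lebesgue_on_eq_borel:
  fixes F h :: "'a::euclidean_space \<Rightarrow> ennreal"
  assumes S: "S \<in> sets borel" and AE: "AE x in lborel. x \<in> S \<longrightarrow> F x = h x"
  shows "(\<integral>\<^sup>+x. F x \<partial>lebesgue_on S) = (\<integral>\<^sup>+x\<in>S. h x \<partial>lborel)"
proof -
  have "(\<integral>\<^sup>+x. F x \<partial>lebesgue_on S) = (\<integral>\<^sup>+x\<in>S. F x \<partial>lborel)"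
    using S by (subst nn_integral_restrict_space) (auto simp: nn_integral_completion)
  also have "\<dots> = (\<integral>\<^sup>+x\<in>S. h x \<partial>lborel)"
    by (rule nn_integral_cong_AE) (use AE in \<open>auto elim!: eventually_mono simp: indicator_def\<close>)
  finally show ?thesis .
qed

lemma borel_representative:
  fixes F :: "'a::euclidean_space \<Rightarrow> 'b::euclidean_space"
  assumes F: "F \<in> borel_measurable (lebesgue_on S)" and S: "S \<in> sets borel"
  obtains h where "h \<in> borel_measurable borel" "\<And>x. x \<notin> S \<Longrightarrow> h x = 0" "AE x in lborel. x \<in> S \<longrightarrow> F x = h x"
proof -
  note [measurable] = S
  have m: "(\<lambda>x. if x \<in> S then F x else 0) \<in> borel_measurable lebesgue"
    using F S by (intro borel_measurable_if_I) auto
  have "\<exists>g\<in>borel_measurable lborel. AE x in lborel. (if x \<in> S then F x else 0) \<bullet> b = g x" for b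
    by (rule completion_ex_borel_measurable_real) (use m in measurable)
  then obtain g where g: "\<And>b. g b \<in> borel_measurable lborel"
    "\<And>b. AE x in lborel. (if x \<in> S then F x else 0) \<bullet> b = g b x" by metis
  note [measurable] = g(1)
  show ?thesis
  proof
    show "(\<lambda>x. indicator S x *\<^sub>R (\<Sum>b\<in>Basis. g b x *\<^sub>R b)) \<in> borel_measurable borel" by measurable
    have "AE x in lborel. \<forall>b\<in>Basis. (if x \<in> S then F x else 0) \<bullet> b = g b x"
      by (intro AE_finite_allI) (use g(2) in auto)
    then show "AE x in lborel. x \<in> S \<longrightarrow> F x = indicator S x *\<^sub>R (\<Sum>b\<in>Basis. g b x *\<^sub>R b)"
    proof eventually_elim
      case (elim x)
      show ?case
      proof
        assume x: "x \<in> S"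
        have "F x = (\<Sum>b\<in>Basis. (F x \<bullet> b) *\<^sub>R b)" by (simp add: euclidean_representation)
        also have "\<dots> = (\<Sum>b\<in>Basis. g b x *\<^sub>R b)" using elim x by (intro sum.cong) auto
        finally show "F x = indicator S x *\<^sub>R (\<Sum>b\<in>Basis. g b x *\<^sub>R b)" using x by simp
      qed
    qed
  qed auto
qed

lemma L2_iff_representative:
  fixes u h :: "'a::euclidean_space \<Rightarrow> 'b::euclidean_space"
  assumes S: "S \<in> sets borel" and h: "h \<in> borel_measurable borel"
    and AE: "AE x in lborel. x \<in> S \<longrightarrow> u x = h x"
  shows "u \<in> L2 S \<longleftrightarrow> sq_integrable lborel (\<lambda>x. indicator S x *\<^sub>R h x)"
proof -
  note [measurable] = S h
  have "integrable (lebesgue_on S) (\<lambda>x. (norm (u x))\<^sup>2) \<longleftrightarrow> integrable lborel (\<lambda>x. indicator S x *\<^sub>R (norm (h x))\<^sup>2)"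
    by (rule lebesgue_on_eq_borel(3)[OF S]) (use AE in \<open>auto elim!: eventually_mono\<close>)
  also have "(\<lambda>x. indicator S x *\<^sub>R (norm (h x))\<^sup>2) = (\<lambda>x. (norm (indicator S x *\<^sub>R h x))\<^sup>2)"
    by (auto simp: indicator_def)
  finally show ?thesis
    using lebesgue_on_eq_borel(1)[OF S h AE] by (simp add: L2_def sq_integrable_def)
qed

text \<open>Local integrability only gives measurability on compact subsets; it extends to \<open>D\<close> along an exhaustion by compact sets.\<close>

lemma locally_integrable_representative:
  fixes g :: "'a::euclidean_space \<Rightarrow> 'b::euclidean_space"
  assumes D: "open D" and g: "locally_integrable D g"
  obtains h where "h \<in> borel_measurable borel" "\<And>x. x \<notin> D \<Longrightarrow> h x = 0" "AE x in lborel. x \<in> D \<longrightarrow> g x = h x"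
    "\<And>K. compact K \<Longrightarrow> K \<subseteq> D \<Longrightarrow> integrable lborel (\<lambda>x. indicator K x *\<^sub>R h x)"
proof -
  have Db: "D \<in> sets borel" using D by simp
  obtain K where K: "\<And>n::nat. compact (K n)" "\<And>n. K n \<subseteq> D" "incseq K" "(\<Union>n. K n) = D"
    using open_compact_exhaustion[OF D] by metis
  have Kb: "K n \<in> sets borel" for n using K(1) by (simp add: borel_compact)
  have "(\<lambda>x. if x \<in> D then g x else 0) \<in> borel_measurable lebesgue"
  proof (rule borel_measurable_LIMSEQ_metric)
    fix n
    have "integrable (lebesgue_on (K n)) g"
      using g K(1,2) by (simp add: locally_integrable_def)
    then have "g \<in> borel_measurable (lebesgue_on (K n))" by (rule borel_measurable_integrable)
    then show "(\<lambda>x. if x \<in> K n then g x else 0) \<in> borel_measurable lebesgue"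
      using Kb by (intro borel_measurable_if_I) auto
  next
    fix x
    show "(\<lambda>n. if x \<in> K n then g x else 0) \<longlonglongrightarrow> (if x \<in> D then g x else 0)"
    proof (cases "x \<in> D")
      case True
      then obtain m where m: "x \<in> K m" using K(4) by auto
      have "eventually (\<lambda>n. g x = (if x \<in> K n then g x else 0)) sequentially"
        using eventually_ge_at_top[of m] by eventually_elim (use m K(3) in \<open>auto simp: incseq_def\<close>)
      then show ?thesis using True Lim_transform_eventually[OF tendsto_const] by auto
    next
      case False
      then have "x \<notin> K n" for n using K(2) by auto
      then show ?thesis using False by simp
    qed
  qed
  then have "g \<in> borel_measurable (lebesgue_on D)" using Db by (subst (asm) borel_measurable_if) auto
  then obtain h where h: "h \<in> borel_measurable borel" "\<And>x. x \<notin> D \<Longrightarrow> h x = 0" "AE x in lborel. x \<in> D \<longrightarrow> g x = h x"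
    using borel_representative[OF _ Db] by metis
  have "integrable lborel (\<lambda>x. indicator K x *\<^sub>R h x)" if K: "compact K" "K \<subseteq> D" for K
  proof -
    have "AE x in lborel. x \<in> K \<longrightarrow> g x = h x" using h(3) by eventually_elim (use K in auto)
    from lebesgue_on_eq_borel(3)[OF borel_compact[OF K(1)] h(1) this] show ?thesis
      using g K by (simp add: locally_integrable_def)
  qed
  then show ?thesis using that h by blast
qed

lemma weak_gradient_representative:
  fixes u u' :: "'a::euclidean_space \<Rightarrow> real" and g g' :: "'a \<Rightarrow> 'a"
  assumes D: "open D" and b: "u' \<in> borel_measurable borel" "g' \<in> borel_measurable borel"
    and AE: "AE x in lborel. x \<in> D \<longrightarrow> u x = u' x" "AE x in lborel. x \<in> D \<longrightarrow> g x = g' x"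
  shows "(\<forall>\<psi>. test_function D \<psi> \<longrightarrow> (\<forall>b\<in>Basis.
        (\<integral>x. u x * frechet_derivative \<psi> (at x) b \<partial>lebesgue_on D)
          = - (\<integral>x. (g x \<bullet> b) * \<psi> x \<partial>lebesgue_on D))) \<longleftrightarrow> weak_gradient_on D u' g'"
proof -
  have Db: "D \<in> sets borel" using D by simp
  note [measurable] = b
  have "(\<integral>x. u x * frechet_derivative \<psi> (at x) b \<partial>lebesgue_on D) = (LBINT x. u' x * frechet_derivative \<psi> (at x) b)"
    and "(\<integral>x. (g x \<bullet> b) * \<psi> x \<partial>lebesgue_on D) = (LBINT x. (g' x \<bullet> b) * \<psi> x)"
    if \<psi>: "test_function D \<psi>" for \<psi> b
  proof -
    note sm = test_function_smooth[OF \<psi>]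
    note [measurable] = smooth_borel[OF sm] smooth_borel[OF smooth_directional_derivative[OF sm]]
    have "(\<integral>x. u x * frechet_derivative \<psi> (at x) b \<partial>lebesgue_on D)
        = (LBINT x. indicator D x *\<^sub>R (u' x * frechet_derivative \<psi> (at x) b))"
      by (rule lebesgue_on_eq_borel(2)[OF Db]) (measurable, use AE(1) in \<open>auto elim!: eventually_mono\<close>)
    also have "\<dots> = (LBINT x. u' x * frechet_derivative \<psi> (at x) b)"
      using derivative_outside_support[OF sm] \<psi>
      by (intro Bochner_Integration.integral_cong) (auto simp: indicator_def test_function_def)
    finally show "(\<integral>x. u x * frechet_derivative \<psi> (at x) b \<partial>lebesgue_on D) = (LBINT x. u' x * frechet_derivative \<psi> (at x) b)" .
    have "(\<integral>x. (g x \<bullet> b) * \<psi> x \<partial>lebesgue_on D) = (LBINT x. indicator D x *\<^sub>R ((g' x \<bullet> b) * \<psi> x))"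
      by (rule lebesgue_on_eq_borel(2)[OF Db]) (measurable, use AE(2) in \<open>auto elim!: eventually_mono\<close>)
    also have "\<dots> = (LBINT x. (g' x \<bullet> b) * \<psi> x)"
      using test_function_outside[OF \<psi>] by (intro Bochner_Integration.integral_cong) (auto simp: indicator_def)
    finally show "(\<integral>x. (g x \<bullet> b) * \<psi> x \<partial>lebesgue_on D) = (LBINT x. (g' x \<bullet> b) * \<psi> x)" .
  qed
  then show ?thesis unfolding weak_gradient_on_def by auto
qed

lemma weak_gradient_unique:
  fixes u :: "'a::euclidean_space \<Rightarrow> real"
  assumes D: "open D" and g1: "has_weak_gradient D u g1" and g2: "has_weak_gradient D u g2"
  shows "AE x in lborel. x \<in> D \<longrightarrow> g1 x = g2 x"
proof -
  obtain u' where u': "u' \<in> borel_measurable borel" "AE x in lborel. x \<in> D \<longrightarrow> u x = u' x"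
    using locally_integrable_representative[OF D, of u] g1 unfolding has_weak_gradient_def by metis
  obtain h1 where h1: "h1 \<in> borel_measurable borel" "AE x in lborel. x \<in> D \<longrightarrow> g1 x = h1 x"
    "\<And>K. compact K \<Longrightarrow> K \<subseteq> D \<Longrightarrow> integrable lborel (\<lambda>x. indicator K x *\<^sub>R h1 x)"
    using locally_integrable_representative[OF D, of g1] g1 unfolding has_weak_gradient_def by metis
  obtain h2 where h2: "h2 \<in> borel_measurable borel" "AE x in lborel. x \<in> D \<longrightarrow> g2 x = h2 x"
    "\<And>K. compact K \<Longrightarrow> K \<subseteq> D \<Longrightarrow> integrable lborel (\<lambda>x. indicator K x *\<^sub>R h2 x)"
    using locally_integrable_representative[OF D, of g2] g2 unfolding has_weak_gradient_def by metis
  have w1: "weak_gradient_on D u' h1"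
    using g1 weak_gradient_representative[OF D u'(1) h1(1) u'(2) h1(2)] unfolding has_weak_gradient_def by blast
  have w2: "weak_gradient_on D u' h2"
    using g2 weak_gradient_representative[OF D u'(1) h2(1) u'(2) h2(2)] unfolding has_weak_gradient_def by blast
  note [measurable] = h1(1) h2(1)
  have "AE x in lborel. x \<in> D \<longrightarrow> (h1 x - h2 x) \<bullet> b = 0" if b: "b \<in> Basis" for b
  proof (rule fundamental_lemma[OF D])
    show "(\<lambda>x. (h1 x - h2 x) \<bullet> b) \<in> borel_measurable borel" by measurable
    have ind: "indicator K x *\<^sub>R (h x \<bullet> b) = (indicator K x *\<^sub>R h x) \<bullet> b" for K x and h :: "'a \<Rightarrow> 'a" by simp
    have i1: "integrable lborel (\<lambda>x. indicator K x *\<^sub>R (h1 x \<bullet> b))" if "compact K" "K \<subseteq> D" for K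
      unfolding ind by (intro integrable_inner_left h1(3) that)
    have i2: "integrable lborel (\<lambda>x. indicator K x *\<^sub>R (h2 x \<bullet> b))" if "compact K" "K \<subseteq> D" for K
      unfolding ind by (intro integrable_inner_left h2(3) that)
    show "integrable lborel (\<lambda>x. indicator K x * ((h1 x - h2 x) \<bullet> b))" if "compact K" "K \<subseteq> D" for K
      using Bochner_Integration.integrable_diff[OF i1[OF that] i2[OF that]]
      by (simp add: inner_diff_left right_diff_distrib)
    show "(LBINT x. ((h1 x - h2 x) \<bullet> b) * \<psi> x) = 0" if \<psi>: "test_function D \<psi>" for \<psi>
    proof -
      define L where "L = closure {x. \<psi> x \<noteq> 0}"
      have L: "compact L" "L \<subseteq> D" "\<And>x. x \<notin> L \<Longrightarrow> \<psi> x = 0"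
        using \<psi> by (auto simp: L_def test_function_def intro: zero_outside_support)
      have "integrable lborel (\<lambda>x. (h1 x \<bullet> b) * \<psi> x)" "integrable lborel (\<lambda>x. (h2 x \<bullet> b) * \<psi> x)"
        by (intro integrable_mult_compact_support[OF _ _ L(1,3)] i1 i2 L smooth_continuous[OF test_function_smooth[OF \<psi>]]; measurable)+
      then show ?thesis
        using w1 w2 \<psi> b unfolding weak_gradient_on_def by (simp add: inner_diff_left left_diff_distrib)
    qed
  qed
  then have "AE x in lborel. \<forall>b\<in>Basis. x \<in> D \<longrightarrow> (h1 x - h2 x) \<bullet> b = 0"
    by (intro AE_finite_allI) auto
  then show ?thesis
    using h1(2) h2(2) by eventually_elim (simp add: euclidean_eq_iff[where 'a='a] inner_diff_left)
qed

lemma sq_integrable_imp_locally_integrable: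
  fixes u h :: "'a::euclidean_space \<Rightarrow> 'b::euclidean_space"
  assumes D: "open D" and h: "sq_integrable lborel h" and AE: "AE x in lborel. x \<in> D \<longrightarrow> u x = h x"
  shows "locally_integrable D u"
  unfolding locally_integrable_def
proof (intro allI impI)
  fix K assume K: "compact K \<and> K \<subseteq> D"
  have "AE x in lborel. x \<in> K \<longrightarrow> u x = h x" using AE by eventually_elim (use K in auto)
  then show "integrable (lebesgue_on K) u"
    using lebesgue_on_eq_borel(3)[of K h u] K sq_integrable_locally_integrable[OF h]
    by (auto simp: locally_integrable_lborel_def borel_compact)
qed

text \<open>The representative \<open>weak_grad\<close> is chosen among all weak gradients; by uniqueness it agrees almost everywhere with one that is
square integrable.\<close>

lemma H1_weak_grad:
  assumes D: "open D" and u: "u \<in> H1 D"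
  shows "has_weak_gradient D u (weak_grad D u)" "weak_grad D u \<in> L2 D"
proof -
  obtain g where g: "g \<in> L2 D" "has_weak_gradient D u g" using u by (auto simp: H1_def)
  show w: "has_weak_gradient D u (weak_grad D u)"
    unfolding weak_grad_def by (rule someI[of "has_weak_gradient D u", OF g(2)])
  have Db: "D \<in> sets borel" using D by simp
  obtain h where h: "h \<in> borel_measurable borel" "AE x in lborel. x \<in> D \<longrightarrow> g x = h x"
    using borel_representative[OF _ Db, of g] g(1) unfolding L2_def by blast
  have "AE x in lborel. x \<in> D \<longrightarrow> weak_grad D u x = h x"
    using weak_gradient_unique[OF D w g(2)] h(2) by eventually_elim auto
  then show "weak_grad D u \<in> L2 D"
    using g(1) L2_iff_representative[OF Db h(1)] h(2) by blast
qed

lemma smooth_has_weak_gradient: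
  fixes \<phi> :: "'a::euclidean_space \<Rightarrow> real"
  assumes D: "open D" "bounded D" and \<phi>: "smooth \<phi>"
  shows "has_weak_gradient D \<phi> (grad \<phi>)" "\<phi> \<in> L2 D" "grad \<phi> \<in> L2 D"
proof -
  have Db: "D \<in> sets borel" using D by simp
  have cont: "continuous_on UNIV \<phi>" "continuous_on UNIV (grad \<phi>)"
    unfolding grad_def[abs_def] using smooth_continuous[OF \<phi>] smooth_continuous[OF smooth_directional_derivative[OF \<phi>]]
    by (auto intro!: continuous_intros)
  have bor: "\<phi> \<in> borel_measurable borel" "grad \<phi> \<in> borel_measurable borel"
    using cont borel_measurable_continuous_onI by auto
  have sq: "sq_integrable lborel (\<lambda>x. indicator D x *\<^sub>R w x)" if w: "continuous_on UNIV w"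
    for w :: "'a \<Rightarrow> 'b::euclidean_space"
  proof -
    have [measurable]: "w \<in> borel_measurable borel" using w borel_measurable_continuous_onI by auto
    have "compact (closure D)" using D(2) by simp
    then have "integrable lborel (\<lambda>x. indicator (closure D) x *\<^sub>R (norm (w x))\<^sup>2)"
      by (rule borel_integrable_compact) (intro continuous_intros continuous_on_subset[OF w], auto)
    then have "integrable lborel (\<lambda>x. (norm (indicator D x *\<^sub>R w x))\<^sup>2)"
      by (rule Bochner_Integration.integrable_bound)
        (use Db closure_subset[of D] in \<open>auto simp: indicator_def\<close>)
    then show ?thesis using Db by (simp add: sq_integrable_def)
  qed
  show "\<phi> \<in> L2 D" "grad \<phi> \<in> L2 D"
    using L2_iff_representative[OF Db bor(1), of \<phi>] L2_iff_representative[OF Db bor(2), of "grad \<phi>"]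
      sq[OF cont(1)] sq[OF cont(2)] by auto
  have "weak_gradient_on D \<phi> (grad \<phi>)"
    unfolding weak_gradient_on_def
  proof (intro allI impI ballI)
    fix \<psi> and b :: 'a assume \<psi>: "test_function D \<psi>" and b: "b \<in> Basis"
    have "grad \<phi> x \<bullet> b = frechet_derivative \<phi> (at x) b" for x
      using b by (simp add: grad_def inner_sum_left inner_Basis if_distrib cong: if_cong)
    then show "(LBINT x. \<phi> x * frechet_derivative \<psi> (at x) b) = - (LBINT x. (grad \<phi> x \<bullet> b) * \<psi> x)"
      using integration_by_parts_smooth[OF \<phi> \<psi>] by simp
  qed
  moreover have "locally_integrable D \<phi>" "locally_integrable D (grad \<phi>)"
    using sq_integrable_imp_locally_integrable[OF D(1) sq[OF cont(1)], of \<phi>]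
      sq_integrable_imp_locally_integrable[OF D(1) sq[OF cont(2)], of "grad \<phi>"] by auto
  ultimately show "has_weak_gradient D \<phi> (grad \<phi>)"
    using weak_gradient_representative[OF D(1) bor, of \<phi> "grad \<phi>"] unfolding has_weak_gradient_def by simp
qed

lemma nn_integral_lebesgue_on_twice:
  fixes h :: "'a::euclidean_space \<Rightarrow> 'b::euclidean_space \<Rightarrow> ennreal"
  assumes S: "S \<in> sets borel" and T: "T \<in> sets borel"
    and AE: "AE x in lborel. x \<in> S \<longrightarrow> (AE y in lborel. y \<in> T \<longrightarrow> F x y = h x y)"
  shows "(\<integral>\<^sup>+x. \<integral>\<^sup>+y. F x y \<partial>lebesgue_on T \<partial>lebesgue_on S) = (\<integral>\<^sup>+x\<in>S. (\<integral>\<^sup>+y\<in>T. h x y \<partial>lborel) \<partial>lborel)"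
  by (rule nn_integral_lebesgue_on_eq_borel[OF S])
    (use AE in \<open>auto elim!: eventually_mono intro!: nn_integral_lebesgue_on_eq_borel[OF T]\<close>)

lemma integral_lebesgue_on_twice:
  fixes h :: "'a::euclidean_space \<Rightarrow> 'b::euclidean_space \<Rightarrow> real"
  assumes S: "S \<in> sets borel" and T: "T \<in> sets borel"
    and h [measurable]: "(\<lambda>(x, y). h x y) \<in> borel_measurable (borel \<Otimes>\<^sub>M borel)"
    and AE: "AE x in lborel. x \<in> S \<longrightarrow> (AE y in lborel. y \<in> T \<longrightarrow> F x y = h x y)"
  shows "(\<integral>x. \<integral>y. F x y \<partial>lebesgue_on T \<partial>lebesgue_on S)
    = (LBINT x. (LBINT y. indicator S x * indicator T y * h x y))"
proof -
  note [measurable] = S T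
  have "(\<integral>x. \<integral>y. F x y \<partial>lebesgue_on T \<partial>lebesgue_on S)
      = (LBINT x. indicator S x *\<^sub>R (LBINT y. indicator T y *\<^sub>R h x y))"
  proof (rule lebesgue_on_eq_borel(2)[OF S])
    show "(\<lambda>x. LBINT y. indicator T y *\<^sub>R h x y) \<in> borel_measurable borel" by measurable
    show "AE x in lborel. x \<in> S \<longrightarrow> (\<integral>y. F x y \<partial>lebesgue_on T) = (LBINT y. indicator T y *\<^sub>R h x y)"
      using AE
    proof eventually_elim
      case (elim x)
      have "h x \<in> borel_measurable borel" by measurable
      from lebesgue_on_eq_borel(2)[OF T this] elim show ?case by blast
    qed
  qed
  also have "\<dots> = (LBINT x. (LBINT y. indicator S x * indicator T y * h x y))"
    by (simp add: mult.assoc)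
  finally show ?thesis .
qed

lemma AE_lborel_reflect:
  fixes x :: "'a::euclidean_space"
  assumes "AE z in lborel. P z"
  shows "AE y in lborel. P (x - y)"
proof -
  have eq: "(lborel :: 'a measure) = distr lborel borel (\<lambda>y. x - y)"
    using lborel_affine[of "-1" x] by (simp add: density_1)
  have "AE z in distr lborel borel (\<lambda>y. x - y). P z" unfolding eq[symmetric] by (rule assms)
  then show ?thesis by (rule AE_distrD[rotated]) measurable
qed

section \<open>The coupled problem\<close>

lemma indicator_scaleR_self:
  "(\<And>x. x \<notin> S \<Longrightarrow> h x = 0) \<Longrightarrow> (\<lambda>x. indicator S x *\<^sub>R h x :: 'b::real_vector) = h"
  by (auto simp: fun_eq_iff indicator_def)

lemma ennreal_half_mult: "a \<ge> 0 \<Longrightarrow> ennreal (a / 2) = 1 / 2 * ennreal a"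
  using divide_ennreal[of a 2] by (simp add: divide_ennreal_def mult.commute)

text \<open>The data \<open>J\<close>, \<open>G\<close> and \<open>f0\<close> of the problem together with Borel functions \<open>J'\<close>, \<open>G'\<close> and \<open>f\<close> that agree with them
almost everywhere.\<close>

locale coupled_problem = coupled_domains \<Omega> \<Omega>l \<Omega>n \<delta> c k f
  for \<Omega> \<Omega>l \<Omega>n :: "'a::euclidean_space set" and \<delta> c k f +
  fixes J J' :: "'a \<Rightarrow> real" and G G' :: "'a \<Rightarrow> 'a \<Rightarrow> real" and f0 :: "'a \<Rightarrow> real"
  assumes J' [measurable]: "J' \<in> borel_measurable borel" and J'_nonneg: "\<And>z. J' z \<ge> 0"
    and G' [measurable]: "(\<lambda>(x, y). G' x y) \<in> borel_measurable (borel \<Otimes>\<^sub>M borel)"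
    and G'_nonneg: "\<And>x y. G' x y \<ge> 0"
    and k_eq: "\<And>x y. k (x, y) = indicator \<Omega>n x * indicator \<Omega>n y * J' (x - y) + indicator \<Omega>l x * indicator \<Omega>n y * G' x y"
    and AE_J: "AE z in lborel. J z = J' z"
    and AE_G: "AE y in lborel. AE x in lborel. x \<in> \<Omega>l \<longrightarrow> y \<in> \<Omega>n \<longrightarrow> G x y = G' x y"
    and f0: "AE x in lborel. x \<in> \<Omega> \<longrightarrow> f0 x = f x"
begin

text \<open>Every member of \<open>H_Neu\<close> has an admissible Borel representative, and its energy is computed on that.\<close>

definition represents :: "('a \<Rightarrow> real \<times> 'a) \<Rightarrow> ('a \<Rightarrow> real) \<Rightarrow> bool" where
  "represents U u \<longleftrightarrow> admissible U \<and> (AE x in lborel. x \<in> \<Omega> \<longrightarrow> u x = fst (U x)) \<and>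
     (AE x in lborel. x \<in> \<Omega>l \<longrightarrow> weak_grad \<Omega>l u x = snd (U x))"

lemma represents_admissible: "represents U u \<Longrightarrow> admissible U"
  and represents_AE: "represents U u \<Longrightarrow> AE x in lborel. x \<in> \<Omega> \<longrightarrow> u x = fst (U x)"
    "represents U u \<Longrightarrow> AE x in lborel. x \<in> \<Omega>l \<longrightarrow> weak_grad \<Omega>l u x = snd (U x)"
  by (simp_all add: represents_def)

lemma borel_domains [measurable]: "\<Omega> \<in> sets borel" "\<Omega>l \<in> sets borel" "\<Omega>n \<in> sets borel"
  using Om l n by auto

lemma representative_exists:
  assumes u: "u \<in> H_Neu \<Omega> \<Omega>l"
  obtains U where "represents U u"
proof -
  have u1: "u \<in> L2 \<Omega>" "u \<in> H1 \<Omega>l" "(\<integral>x. u x \<partial>lebesgue_on \<Omega>) = 0" using u by (auto simp: H_Neu_def)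
  obtain h where h: "h \<in> borel_measurable borel" "\<And>x. x \<notin> \<Omega> \<Longrightarrow> h x = 0" "AE x in lborel. x \<in> \<Omega> \<longrightarrow> u x = h x"
    using borel_representative[OF _ borel_domains(1), of u] u1(1) unfolding L2_def by blast
  note w = H1_weak_grad[OF l(1) u1(2)]
  obtain g where g: "g \<in> borel_measurable borel" "\<And>x. x \<notin> \<Omega>l \<Longrightarrow> g x = 0" "AE x in lborel. x \<in> \<Omega>l \<longrightarrow> weak_grad \<Omega>l u x = g x"
    using borel_representative[OF _ borel_domains(2), of "weak_grad \<Omega>l u"] w(2) unfolding L2_def by blast
  have ih: "(\<lambda>x. indicator \<Omega> x *\<^sub>R h x) = h" and ig: "(\<lambda>x. indicator \<Omega>l x *\<^sub>R g x) = g"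
    using h(2) g(2) by (auto intro!: indicator_scaleR_self simp del: real_scaleR_def)
  have hs: "sq_integrable lborel h" "sq_integrable lborel g"
    using L2_iff_representative[OF borel_domains(1) h(1,3)] L2_iff_representative[OF borel_domains(2) g(1,3)]
      u1(1) w(2) unfolding ih ig by auto
  have hl: "AE x in lborel. x \<in> \<Omega>l \<longrightarrow> u x = h x" using h(3) by eventually_elim (use l(3) in auto)
  have "(LBINT x. h x) = 0"
    using lebesgue_on_eq_borel(2)[OF borel_domains(1) h(1,3)] u1(3) unfolding ih by simp
  moreover have "weak_gradient_on \<Omega>l h g"
    using weak_gradient_representative[OF l(1) h(1) g(1) hl g(3)] w(1) unfolding has_weak_gradient_def by blast
  ultimately have "represents (\<lambda>x. (h x, g x)) u"
    unfolding represents_def admissible_def using sq_integrable_Pair[OF hs] h g by simp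
  then show ?thesis by (rule that)
qed

lemma V_represents:
  assumes U: "U \<in> V"
  shows "(\<lambda>x. fst (U x)) \<in> H_Neu \<Omega> \<Omega>l" "represents U (\<lambda>x. fst (U x))"
proof -
  note D = V_D[OF U]
  let ?u = "\<lambda>x. fst (U x)" and ?g = "\<lambda>x. snd (U x)"
  have gb: "?g \<in> borel_measurable borel" using sq_integrableD(1)[OF D(3)] by simp
  have ih: "(\<lambda>x. indicator \<Omega> x *\<^sub>R ?u x) = ?u" and ig: "(\<lambda>x. indicator \<Omega>l x *\<^sub>R ?g x) = ?g"
    using D(4,5) by (auto intro!: indicator_scaleR_self simp del: real_scaleR_def)
  have u: "?u \<in> L2 \<Omega>" using L2_iff_representative[OF borel_domains(1) D(9), of ?u] D(2) unfolding ih by simp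
  have g: "?g \<in> L2 \<Omega>l" using L2_iff_representative[OF borel_domains(2) gb, of ?g] D(3) unfolding ig by simp
  have "sq_integrable lborel (\<lambda>x. indicator \<Omega>l x *\<^sub>R ?u x)"
    by (rule sq_integrable_bound[OF D(2)]) (use D(9) in \<open>auto simp: indicator_def\<close>)
  then have ul: "?u \<in> L2 \<Omega>l" using L2_iff_representative[OF borel_domains(2) D(9), of ?u] by simp
  have "locally_integrable \<Omega>l ?u" "locally_integrable \<Omega>l ?g"
    using sq_integrable_imp_locally_integrable[OF l(1) D(2), of ?u] sq_integrable_imp_locally_integrable[OF l(1) D(3), of ?g] by auto
  then have hw: "has_weak_gradient \<Omega>l ?u ?g"
    using weak_gradient_representative[OF l(1) D(9) gb, of ?u ?g] D(7) unfolding has_weak_gradient_def by simp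
  then have H1: "?u \<in> H1 \<Omega>l" using ul g by (auto simp: H1_def)
  have "(\<integral>x. ?u x \<partial>lebesgue_on \<Omega>) = 0"
    using lebesgue_on_eq_borel(2)[OF borel_domains(1) D(9), of ?u] D(6) unfolding ih by simp
  then show "?u \<in> H_Neu \<Omega> \<Omega>l" using u H1 by (simp add: H_Neu_def)
  have "AE x in lborel. x \<in> \<Omega>l \<longrightarrow> weak_grad \<Omega>l ?u x = ?g x"
    by (rule weak_gradient_unique[OF l(1) H1_weak_grad(1)[OF l(1) H1] hw])
  then show "represents U ?u" using V_admissible[OF U] by (simp add: represents_def)
qed

lemma jump_J_AE:
  assumes "AE x in lborel. x \<in> \<Omega> \<longrightarrow> u x = u' x"
  shows "AE x in lborel. x \<in> \<Omega>n \<longrightarrow> (AE y in lborel. y \<in> \<Omega>n \<longrightarrow> J (x - y) = J' (x - y) \<and> u y = u' y \<and> u x = u' x)"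
  using assms
proof eventually_elim
  case (elim x)
  show ?case
  proof
    assume x: "x \<in> \<Omega>n"
    show "AE y in lborel. y \<in> \<Omega>n \<longrightarrow> J (x - y) = J' (x - y) \<and> u y = u' y \<and> u x = u' x"
      using AE_lborel_reflect[OF AE_J, of x] assms by eventually_elim (use elim x n(3) in auto)
  qed
qed

lemma jump_G_AE:
  assumes "AE x in lborel. x \<in> \<Omega> \<longrightarrow> u x = u' x"
  shows "AE y in lborel. y \<in> \<Omega>n \<longrightarrow> (AE x in lborel. x \<in> \<Omega>l \<longrightarrow> G x y = G' x y \<and> u y = u' y \<and> u x = u' x)"
  using assms AE_G
proof eventually_elim
  case (elim y)
  show ?case
  proof
    assume y: "y \<in> \<Omega>n"
    show "AE x in lborel. x \<in> \<Omega>l \<longrightarrow> G x y = G' x y \<and> u y = u' y \<and> u x = u' x"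
      using elim(2) assms by eventually_elim (use elim(1) y n(3) l(3) in auto)
  qed
qed

text \<open>The iterated integrals of the energy, in opposite orders for \<open>J\<close> and for \<open>G\<close>, become integrals over the product measure by Tonelli's
theorem and add up to one integral with respect to \<open>\<mu>\<close>.\<close>

lemma quadratic_energy_representative:
  assumes U: "represents U u"
  shows "quadratic_energy \<Omega>l \<Omega>n J G u
    = 1 / 2 * ((\<integral>\<^sup>+x. ennreal ((norm (snd (U x)))\<^sup>2) \<partial>lborel) + (\<integral>\<^sup>+z. ennreal ((norm (jump U z))\<^sup>2) \<partial>\<mu>))"
proof -
  note D = admissibleD[OF represents_admissible[OF U]]
  note [measurable] = D(9,10)
  let ?d = "\<lambda>x y. ennreal ((fst (U y) - fst (U x))\<^sup>2)"
  let ?J = "\<lambda>x y. ennreal (indicator \<Omega>n x * indicator \<Omega>n y * J' (x - y)) * ?d x y"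
  let ?G = "\<lambda>x y. ennreal (indicator \<Omega>l x * indicator \<Omega>n y * G' x y) * ?d x y"
  have "(\<integral>\<^sup>+x. ennreal ((norm (weak_grad \<Omega>l u x))\<^sup>2 / 2) \<partial>lebesgue_on \<Omega>l)
      = (\<integral>\<^sup>+x\<in>\<Omega>l. ennreal ((norm (snd (U x)))\<^sup>2 / 2) \<partial>lborel)"
    by (rule nn_integral_lebesgue_on_eq_borel[OF borel_domains(2)]) (use represents_AE(2)[OF U] in \<open>auto elim!: eventually_mono\<close>)
  also have "\<dots> = (\<integral>\<^sup>+x. 1 / 2 * ennreal ((norm (snd (U x)))\<^sup>2) \<partial>lborel)"
    using D(5) by (intro nn_integral_cong) (auto simp: indicator_def ennreal_half_mult)
  also have "\<dots> = 1 / 2 * (\<integral>\<^sup>+x. ennreal ((norm (snd (U x)))\<^sup>2) \<partial>lborel)"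
    by (rule nn_integral_cmult) measurable
  finally have 1: "(\<integral>\<^sup>+x. ennreal ((norm (weak_grad \<Omega>l u x))\<^sup>2 / 2) \<partial>lebesgue_on \<Omega>l)
      = 1 / 2 * (\<integral>\<^sup>+x. ennreal ((norm (snd (U x)))\<^sup>2) \<partial>lborel)" .
  have "(\<integral>\<^sup>+x. \<integral>\<^sup>+y. ennreal (J (x - y) * \<bar>u y - u x\<bar>\<^sup>2) \<partial>lebesgue_on \<Omega>n \<partial>lebesgue_on \<Omega>n)
      = (\<integral>\<^sup>+x\<in>\<Omega>n. (\<integral>\<^sup>+y\<in>\<Omega>n. ennreal (J' (x - y) * (fst (U y) - fst (U x))\<^sup>2) \<partial>lborel) \<partial>lborel)"
    by (rule nn_integral_lebesgue_on_twice[OF borel_domains(3,3)])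
      (use jump_J_AE[OF represents_AE(1)[OF U]] in \<open>auto elim!: eventually_mono\<close>)
  also have "\<dots> = (\<integral>\<^sup>+x. \<integral>\<^sup>+y. ?J x y \<partial>lborel \<partial>lborel)"
    using J'_nonneg by (intro nn_integral_cong) (auto simp: indicator_def ennreal_mult intro!: nn_integral_cong)
  also have "\<dots> = (\<integral>\<^sup>+z. ?J (fst z) (snd z) \<partial>(lborel \<Otimes>\<^sub>M lborel))"
    by (subst lborel.nn_integral_fst[symmetric]) auto
  finally have 2: "(\<integral>\<^sup>+x. \<integral>\<^sup>+y. ennreal (J (x - y) * \<bar>u y - u x\<bar>\<^sup>2) \<partial>lebesgue_on \<Omega>n \<partial>lebesgue_on \<Omega>n)
      = (\<integral>\<^sup>+z. ?J (fst z) (snd z) \<partial>(lborel \<Otimes>\<^sub>M lborel))" .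
  have "(\<integral>\<^sup>+y. \<integral>\<^sup>+x. ennreal (G x y * \<bar>u y - u x\<bar>\<^sup>2) \<partial>lebesgue_on \<Omega>l \<partial>lebesgue_on \<Omega>n)
      = (\<integral>\<^sup>+y\<in>\<Omega>n. (\<integral>\<^sup>+x\<in>\<Omega>l. ennreal (G' x y * (fst (U y) - fst (U x))\<^sup>2) \<partial>lborel) \<partial>lborel)"
    by (rule nn_integral_lebesgue_on_twice[OF borel_domains(3,2)])
      (use jump_G_AE[OF represents_AE(1)[OF U]] in \<open>auto elim!: eventually_mono\<close>)
  also have "\<dots> = (\<integral>\<^sup>+y. \<integral>\<^sup>+x. ?G x y \<partial>lborel \<partial>lborel)"
    using G'_nonneg by (intro nn_integral_cong) (auto simp: indicator_def ennreal_mult intro!: nn_integral_cong)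
  also have "\<dots> = (\<integral>\<^sup>+x. \<integral>\<^sup>+y. ?G x y \<partial>lborel \<partial>lborel)"
    by (rule lborel_pair.Fubini') measurable
  also have "\<dots> = (\<integral>\<^sup>+z. ?G (fst z) (snd z) \<partial>(lborel \<Otimes>\<^sub>M lborel))"
    by (subst lborel.nn_integral_fst[symmetric]) auto
  finally have 3: "(\<integral>\<^sup>+y. \<integral>\<^sup>+x. ennreal (G x y * \<bar>u y - u x\<bar>\<^sup>2) \<partial>lebesgue_on \<Omega>l \<partial>lebesgue_on \<Omega>n)
      = (\<integral>\<^sup>+z. ?G (fst z) (snd z) \<partial>(lborel \<Otimes>\<^sub>M lborel))" .
  have "(\<integral>\<^sup>+z. ennreal ((norm (jump U z))\<^sup>2) \<partial>\<mu>)
      = (\<integral>\<^sup>+z. ennreal (k z) * ennreal ((norm (jump U z))\<^sup>2) \<partial>(lborel \<Otimes>\<^sub>M lborel))"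
    unfolding \<mu>_def using jump_measurable[OF D(8)] by (subst nn_integral_density) auto
  also have "\<dots> = (\<integral>\<^sup>+z. ?J (fst z) (snd z) + ?G (fst z) (snd z) \<partial>(lborel \<Otimes>\<^sub>M lborel))"
    using J'_nonneg G'_nonneg
    by (intro nn_integral_cong) (auto simp: jump_def k_eq case_prod_unfold distrib_right split: prod.split)
  also have "\<dots> = (\<integral>\<^sup>+z. ?J (fst z) (snd z) \<partial>(lborel \<Otimes>\<^sub>M lborel)) + (\<integral>\<^sup>+z. ?G (fst z) (snd z) \<partial>(lborel \<Otimes>\<^sub>M lborel))"
    by (rule nn_integral_add) measurable
  finally show ?thesis unfolding quadratic_energy_def 1 2 3 by (simp only: distrib_left add.assoc)
qed

lemma energy_of_V:
  assumes U: "represents U u" and V: "U \<in> V"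
  shows "quadratic_energy \<Omega>l \<Omega>n J G u = ennreal (B U U / 2)"
proof -
  note D = V_D[OF V]
  have "quadratic_energy \<Omega>l \<Omega>n J G u = 1 / 2 * (ennreal (LBINT x. (norm (snd (U x)))\<^sup>2) + ennreal (\<integral>z. (norm (jump U z))\<^sup>2 \<partial>\<mu>))"
    unfolding quadratic_energy_representative[OF U]
    using sq_integrableD(2)[OF D(3)] sq_integrableD(2)[OF V_jump[OF V]] by (simp add: nn_integral_eq_integral)
  also have "\<dots> = 1 / 2 * ennreal (B U U)"
    by (simp add: B_def power2_norm_eq_inner flip: power2_eq_square)
  also have "\<dots> = ennreal (B U U / 2)" using B_nonneg by (rule ennreal_half_mult[symmetric])
  finally show ?thesis .
qed

text \<open>Functions of infinite energy correspond exactly to the admissible pairs outside \<open>V\<close>, so that minimizing over \<open>H_Neu\<close> and over \<open>V\<close> is the same.\<close>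

lemma finite_energy_iff:
  assumes U: "represents U u"
  shows "quadratic_energy \<Omega>l \<Omega>n J G u < \<infinity> \<longleftrightarrow> U \<in> V"
proof
  assume "quadratic_energy \<Omega>l \<Omega>n J G u < \<infinity>"
  then have "(\<integral>\<^sup>+z. ennreal ((norm (jump U z))\<^sup>2) \<partial>\<mu>) < \<infinity>"
    unfolding quadratic_energy_representative[OF U] by (auto simp: ennreal_mult_less_top ennreal_mult_eq_top_iff less_top)
  then show "U \<in> V"
    using represents_admissible[OF U] jump_measurable[OF admissibleD(8)[OF represents_admissible[OF U]]]
    by (simp add: V_def sq_integrable_iff_nn \<mu>_def)
qed (use energy_of_V[OF U] in simp)

lemma linear_part:
  assumes U: "represents U u"
  shows "(\<integral>x. f0 x * u x \<partial>lebesgue_on \<Omega>) = F U"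
proof -
  note D = admissibleD[OF represents_admissible[OF U]]
  have fb [measurable]: "f \<in> borel_measurable borel" using sq_integrableD(1)[OF f] by simp
  note [measurable] = D(9)
  have "(\<integral>x. f0 x * u x \<partial>lebesgue_on \<Omega>) = (LBINT x. indicator \<Omega> x *\<^sub>R (f x * fst (U x)))"
  proof (rule lebesgue_on_eq_borel(2)[OF borel_domains(1)])
    show "AE x in lborel. x \<in> \<Omega> \<longrightarrow> f0 x * u x = f x * fst (U x)"
      using f0 represents_AE(1)[OF U] by eventually_elim auto
  qed measurable
  also have "\<dots> = F U" unfolding F_def using D(4)
    by (intro Bochner_Integration.integral_cong) (auto simp: indicator_def)
  finally show ?thesis .
qed

text \<open>The terms for \<open>J\<close> and \<open>G\<close> are each dominated by the integrand for \<open>k\<close>, which is integrable by Cauchy-Schwarz; hence Fubini's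
theorem applies to both of them.\<close>

lemma bilinear_representative:
  assumes U: "represents U u" "U \<in> V" and W: "represents W w" "W \<in> V"
  shows "B U W = (\<integral>x. weak_grad \<Omega>l u x \<bullet> weak_grad \<Omega>l w x \<partial>lebesgue_on \<Omega>l)
      + (\<integral>x. \<integral>y. J (x - y) * (u y - u x) * (w y - w x) \<partial>lebesgue_on \<Omega>n \<partial>lebesgue_on \<Omega>n)
      + (\<integral>y. \<integral>x. G x y * (u y - u x) * (w y - w x) \<partial>lebesgue_on \<Omega>l \<partial>lebesgue_on \<Omega>n)"
proof -
  note D = admissibleD[OF represents_admissible[OF U(1)]] and E = admissibleD[OF represents_admissible[OF W(1)]]
  note [measurable] = D(9,10) E(9,10)
  let ?p = "\<lambda>x y. (fst (U y) - fst (U x)) * (fst (W y) - fst (W x))"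
  let ?J = "\<lambda>x y. indicator \<Omega>n x * indicator \<Omega>n y * (J' (x - y) * ?p x y)"
  let ?G = "\<lambda>x y. indicator \<Omega>l x * indicator \<Omega>n y * (G' x y * ?p x y)"
  have 1: "(\<integral>x. weak_grad \<Omega>l u x \<bullet> weak_grad \<Omega>l w x \<partial>lebesgue_on \<Omega>l) = (LBINT x. snd (U x) \<bullet> snd (W x))"
  proof -
    have "(\<integral>x. weak_grad \<Omega>l u x \<bullet> weak_grad \<Omega>l w x \<partial>lebesgue_on \<Omega>l)
        = (LBINT x. indicator \<Omega>l x *\<^sub>R (snd (U x) \<bullet> snd (W x)))"
    proof (rule lebesgue_on_eq_borel(2)[OF borel_domains(2)])
      show "AE x in lborel. x \<in> \<Omega>l \<longrightarrow> weak_grad \<Omega>l u x \<bullet> weak_grad \<Omega>l w x = snd (U x) \<bullet> snd (W x)"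
        using represents_AE(2)[OF U(1)] represents_AE(2)[OF W(1)] by eventually_elim auto
    qed measurable
    also have "\<dots> = (LBINT x. snd (U x) \<bullet> snd (W x))"
      using D(5) by (intro Bochner_Integration.integral_cong) (auto simp: indicator_def)
    finally show ?thesis .
  qed
  have 2: "(\<integral>x. \<integral>y. J (x - y) * (u y - u x) * (w y - w x) \<partial>lebesgue_on \<Omega>n \<partial>lebesgue_on \<Omega>n)
      = (LBINT x. LBINT y. ?J x y)"
  proof (rule integral_lebesgue_on_twice[OF borel_domains(3,3)])
    show "AE x in lborel. x \<in> \<Omega>n \<longrightarrow> (AE y in lborel. y \<in> \<Omega>n \<longrightarrow>
        J (x - y) * (u y - u x) * (w y - w x) = J' (x - y) * ?p x y)"
      using jump_J_AE[OF represents_AE(1)[OF U(1)]] jump_J_AE[OF represents_AE(1)[OF W(1)]]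
    proof eventually_elim
      case (elim x)
      show ?case
      proof
        assume x: "x \<in> \<Omega>n"
        show "AE y in lborel. y \<in> \<Omega>n \<longrightarrow> J (x - y) * (u y - u x) * (w y - w x) = J' (x - y) * ?p x y"
          using elim(1)[rule_format, OF x] elim(2)[rule_format, OF x] by eventually_elim auto
      qed
    qed
  qed measurable
  have 3: "(\<integral>y. \<integral>x. G x y * (u y - u x) * (w y - w x) \<partial>lebesgue_on \<Omega>l \<partial>lebesgue_on \<Omega>n)
      = (LBINT y. LBINT x. ?G x y)"
  proof -
    have "(\<integral>y. \<integral>x. G x y * (u y - u x) * (w y - w x) \<partial>lebesgue_on \<Omega>l \<partial>lebesgue_on \<Omega>n)
      = (LBINT y. LBINT x. indicator \<Omega>n y * indicator \<Omega>l x * (G' x y * ?p x y))"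
    proof (rule integral_lebesgue_on_twice[OF borel_domains(3,2)])
      show "AE y in lborel. y \<in> \<Omega>n \<longrightarrow> (AE x in lborel. x \<in> \<Omega>l \<longrightarrow>
          G x y * (u y - u x) * (w y - w x) = G' x y * ?p x y)"
        using jump_G_AE[OF represents_AE(1)[OF U(1)]] jump_G_AE[OF represents_AE(1)[OF W(1)]]
      proof eventually_elim
        case (elim y)
        show ?case
        proof
          assume y: "y \<in> \<Omega>n"
          show "AE x in lborel. x \<in> \<Omega>l \<longrightarrow> G x y * (u y - u x) * (w y - w x) = G' x y * ?p x y"
            using elim(1)[rule_format, OF y] elim(2)[rule_format, OF y] by eventually_elim auto
        qed
      qed
    qed measurable
    then show ?thesis by (simp only: mult.commute[of "indicator \<Omega>n _"])
  qed
  have jm: "jump U \<in> borel_measurable (lborel \<Otimes>\<^sub>M lborel)" "jump W \<in> borel_measurable (lborel \<Otimes>\<^sub>M lborel)"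
    using jump_measurable D(8) E(8) by auto
  note [measurable] = jm
  have "integrable \<mu> (\<lambda>z. jump U z \<bullet> jump W z)"
    by (rule sq_integrable_inner(1)[OF V_jump[OF U(2)] V_jump[OF W(2)]])
  then have kint: "integrable (lborel \<Otimes>\<^sub>M lborel) (\<lambda>z. k z * (jump U z * jump W z))"
    unfolding \<mu>_def using k_nonneg by (subst (asm) integrable_density) auto
  have Jint: "integrable (lborel \<Otimes>\<^sub>M lborel) (\<lambda>(x, y). ?J x y)"
    and Gint: "integrable (lborel \<Otimes>\<^sub>M lborel) (\<lambda>(x, y). ?G x y)"
  proof -
    have "\<bar>?J x y\<bar> \<le> \<bar>k (x, y) * ?p x y\<bar>" "\<bar>?G x y\<bar> \<le> \<bar>k (x, y) * ?p x y\<bar>" for x y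
      unfolding k_eq abs_mult using J'_nonneg[of "x - y"] G'_nonneg[of x y]
      by (auto simp: indicator_def intro!: mult_right_mono mult_nonneg_nonneg)
    then show "integrable (lborel \<Otimes>\<^sub>M lborel) (\<lambda>(x, y). ?J x y)" "integrable (lborel \<Otimes>\<^sub>M lborel) (\<lambda>(x, y). ?G x y)"
      by (auto intro!: Bochner_Integration.integrable_bound[OF kint] simp: jump_def)
  qed
  have "(\<integral>z. jump U z \<bullet> jump W z \<partial>\<mu>) = (\<integral>z. k z * (jump U z * jump W z) \<partial>(lborel \<Otimes>\<^sub>M lborel))"
    unfolding \<mu>_def using k_nonneg by (subst integral_density) auto
  also have "\<dots> = (\<integral>z. (case z of (x, y) \<Rightarrow> ?J x y) + (case z of (x, y) \<Rightarrow> ?G x y) \<partial>(lborel \<Otimes>\<^sub>M lborel))"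
    by (intro Bochner_Integration.integral_cong) (auto simp: jump_def k_eq algebra_simps)
  also have "\<dots> = (\<integral>z. (case z of (x, y) \<Rightarrow> ?J x y) \<partial>(lborel \<Otimes>\<^sub>M lborel))
      + (\<integral>z. (case z of (x, y) \<Rightarrow> ?G x y) \<partial>(lborel \<Otimes>\<^sub>M lborel))"
    using Jint Gint by (rule Bochner_Integration.integral_add)
  also have "\<dots> = (LBINT x. LBINT y. ?J x y) + (LBINT y. LBINT x. ?G x y)"
    using lborel_pair.integral_fst[OF Jint] lborel_pair.integral_snd[OF Gint] by simp
  finally show ?thesis unfolding B_def 1 2 3 by simp
qed

text \<open>Minimizers correspond to minimizers of the abstract energy on \<open>V\<close>. Two of them differ by a pair of vanishing energy, hence by a null function
according to the Poincare inequality. A smooth function of mean zero and finite energy is represented by a member of \<open>V\<close>, and the Euler-Lagrange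
equation tested with it is the weak formulation.\<close>

theorem existence_uniqueness_weak_solution:
  shows "\<exists>u. is_minimizer_Neu \<Omega> \<Omega>l \<Omega>n J G f0 u"
    and "is_minimizer_Neu \<Omega> \<Omega>l \<Omega>n J G f0 u \<Longrightarrow> is_minimizer_Neu \<Omega> \<Omega>l \<Omega>n J G f0 v \<Longrightarrow>
       AE x in lebesgue_on \<Omega>. u x = v x"
    and "is_minimizer_Neu \<Omega> \<Omega>l \<Omega>n J G f0 u \<Longrightarrow> weak_solution_Neu \<Omega> \<Omega>l \<Omega>n J G f0 u"
proof -
  obtain C where "energy_space V B F C" using energy_space_V by blast
  then interpret ES: energy_space V B F C .
  have E_V: "E_Neu \<Omega> \<Omega>l \<Omega>n J G f0 u = ereal (ES.energy U)" if "represents U u" "U \<in> V" for U u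
    unfolding E_Neu_def ES.energy_def energy_of_V[OF that] linear_part[OF that(1)]
    using B_nonneg[of U] by (simp add: enn2ereal_ennreal)
  have E_inf: "E_Neu \<Omega> \<Omega>l \<Omega>n J G f0 u = \<infinity>" if "represents U u" "U \<notin> V" for U u
    unfolding E_Neu_def using finite_energy_iff[OF that(1)] that(2) by (simp add: top.not_eq_extremum[symmetric])
  have min_V: "\<exists>U. represents U u \<and> U \<in> V \<and> (\<forall>W\<in>V. ES.energy U \<le> ES.energy W)"
    if m: "is_minimizer_Neu \<Omega> \<Omega>l \<Omega>n J G f0 u" for u
  proof -
    have uH: "u \<in> H_Neu \<Omega> \<Omega>l" using m by (simp add: is_minimizer_Neu_def)
    obtain U where U: "represents U u" using representative_exists[OF uH] .
    have le: "E_Neu \<Omega> \<Omega>l \<Omega>n J G f0 u \<le> ereal (ES.energy W)" if "W \<in> V" for W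
      using m V_represents[OF that] E_V[OF V_represents(2)[OF that] that] unfolding is_minimizer_Neu_def by metis
    have "U \<in> V"
    proof (rule ccontr)
      assume "U \<notin> V"
      then show False using le[OF V_zero] E_inf[OF U] by simp
    qed
    then show ?thesis using U le E_V[OF U] by auto
  qed
  show "\<exists>u. is_minimizer_Neu \<Omega> \<Omega>l \<Omega>n J G f0 u"
  proof -
    obtain U where U: "U \<in> V" "\<And>W. W \<in> V \<Longrightarrow> ES.energy U \<le> ES.energy W" using ES.minimizer_exists by blast
    have "is_minimizer_Neu \<Omega> \<Omega>l \<Omega>n J G f0 (\<lambda>x. fst (U x))"
      unfolding is_minimizer_Neu_def
    proof (intro conjI ballI V_represents(1)[OF U(1)])
      fix v assume "v \<in> H_Neu \<Omega> \<Omega>l"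
      then obtain W where W: "represents W v" by (rule representative_exists)
      show "E_Neu \<Omega> \<Omega>l \<Omega>n J G f0 (\<lambda>x. fst (U x)) \<le> E_Neu \<Omega> \<Omega>l \<Omega>n J G f0 v"
        using E_V[OF V_represents(2)[OF U(1)] U(1)] E_V[OF W] E_inf[OF W] U(2)[of W] by (cases "W \<in> V") auto
    qed
    then show ?thesis by blast
  qed
  show "AE x in lebesgue_on \<Omega>. u x = v x"
    if uv: "is_minimizer_Neu \<Omega> \<Omega>l \<Omega>n J G f0 u" "is_minimizer_Neu \<Omega> \<Omega>l \<Omega>n J G f0 v"
  proof -
    obtain U where U: "represents U u" "U \<in> V" "\<And>W. W \<in> V \<Longrightarrow> ES.energy U \<le> ES.energy W" using min_V[OF uv(1)] by blast
    obtain W where W: "represents W v" "W \<in> V" "\<And>Z. Z \<in> V \<Longrightarrow> ES.energy W \<le> ES.energy Z" using min_V[OF uv(2)] by blast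
    let ?d = "\<lambda>x. U x - W x"
    have B0: "B ?d ?d = 0" by (rule ES.minimizer_unique[OF U(2) W(2) U(3) W(3)])
    have dV: "?d \<in> V" using U(2) W(2) by (rule V_diff)
    obtain C' where "C' \<ge> 0" "\<And>U. U \<in> V \<Longrightarrow> (LBINT x. (fst (U x))\<^sup>2) \<le> C' * B U U"
      using poincare by blast
    then have "(LBINT x. (fst (?d x))\<^sup>2) \<le> 0" using dV B0 by fastforce
    moreover have "(LBINT x. (fst (?d x))\<^sup>2) \<ge> 0" by simp
    ultimately have "(LBINT x. (fst (?d x))\<^sup>2) = 0" by linarith
    then have "AE x in lborel. (fst (?d x))\<^sup>2 = 0"
      using sq_integrableD(2)[OF V_D(2)[OF dV]] by (subst (asm) integral_nonneg_eq_0_iff_AE) auto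
    then have "AE x in lborel. x \<in> \<Omega> \<longrightarrow> u x = v x"
      using represents_AE(1)[OF U(1)] represents_AE(1)[OF W(1)] by eventually_elim auto
    then show ?thesis by (simp add: AE_lebesgue_on_iff)
  qed
  show "weak_solution_Neu \<Omega> \<Omega>l \<Omega>n J G f0 u" if m: "is_minimizer_Neu \<Omega> \<Omega>l \<Omega>n J G f0 u"
    unfolding weak_solution_Neu_def
  proof (intro conjI allI impI)
    obtain U where U: "represents U u" "U \<in> V" "\<And>W. W \<in> V \<Longrightarrow> ES.energy U \<le> ES.energy W" using min_V[OF m] by blast
    show "u \<in> H_Neu \<Omega> \<Omega>l" using m by (simp add: is_minimizer_Neu_def)
    show "E_Neu \<Omega> \<Omega>l \<Omega>n J G f0 u < \<infinity>" using E_V[OF U(1,2)] by simp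
    fix \<phi> :: "'a \<Rightarrow> real"
    assume "smooth \<phi> \<and> (\<integral>x. \<phi> x \<partial>lebesgue_on \<Omega>) = 0 \<and> quadratic_energy \<Omega>l \<Omega>n J G \<phi> < \<infinity>"
    then have \<phi>: "smooth \<phi>" "(\<integral>x. \<phi> x \<partial>lebesgue_on \<Omega>) = 0" "quadratic_energy \<Omega>l \<Omega>n J G \<phi> < \<infinity>" by auto
    have bl: "bounded \<Omega>l" using bounded_subset[OF Om(2) l(3)] .
    have \<phi>1: "\<phi> \<in> H1 \<Omega>l" unfolding H1_def using smooth_has_weak_gradient[OF l(1) bl \<phi>(1)] by blast
    then have "\<phi> \<in> H_Neu \<Omega> \<Omega>l"
      unfolding H_Neu_def using smooth_has_weak_gradient(2)[OF Om \<phi>(1)] \<phi>(2) by simp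
    then obtain W where W: "represents W \<phi>" by (rule representative_exists)
    have WV: "W \<in> V" using finite_energy_iff[OF W] \<phi>(3) by simp
    have wg: "AE x in lborel. x \<in> \<Omega>l \<longrightarrow> weak_grad \<Omega>l \<phi> x = grad \<phi> x"
      by (rule weak_gradient_unique[OF l(1) H1_weak_grad(1)[OF l(1) \<phi>1] smooth_has_weak_gradient(1)[OF l(1) bl \<phi>(1)]])
    have gr: "(\<integral>x. weak_grad \<Omega>l u x \<bullet> weak_grad \<Omega>l \<phi> x \<partial>lebesgue_on \<Omega>l)
        = (\<integral>x. weak_grad \<Omega>l u x \<bullet> grad \<phi> x \<partial>lebesgue_on \<Omega>l)"
    proof -
      note [measurable] = admissibleD(10)[OF represents_admissible[OF U(1)]] admissibleD(10)[OF represents_admissible[OF W]]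
      have a: "AE x in lborel. x \<in> \<Omega>l \<longrightarrow> weak_grad \<Omega>l u x \<bullet> weak_grad \<Omega>l \<phi> x = snd (U x) \<bullet> snd (W x)"
        using represents_AE(2)[OF U(1)] represents_AE(2)[OF W] by eventually_elim auto
      have b: "AE x in lborel. x \<in> \<Omega>l \<longrightarrow> weak_grad \<Omega>l u x \<bullet> grad \<phi> x = snd (U x) \<bullet> snd (W x)"
        using represents_AE(2)[OF U(1)] represents_AE(2)[OF W] wg by eventually_elim auto
      have "(\<lambda>x. snd (U x) \<bullet> snd (W x)) \<in> borel_measurable borel" by measurable
      from lebesgue_on_eq_borel(2)[OF borel_domains(2) this a] lebesgue_on_eq_borel(2)[OF borel_domains(2) this b]
      show ?thesis by simp
    qed
    show "(\<integral>x. f0 x * \<phi> x \<partial>lebesgue_on \<Omega>) =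
          (\<integral>x. weak_grad \<Omega>l u x \<bullet> grad \<phi> x \<partial>lebesgue_on \<Omega>l)
          + (\<integral>x. \<integral>y. J (x - y) * (u y - u x) * (\<phi> y - \<phi> x) \<partial>lebesgue_on \<Omega>n \<partial>lebesgue_on \<Omega>n)
          + (\<integral>y. \<integral>x. G x y * (u y - u x) * (\<phi> y - \<phi> x) \<partial>lebesgue_on \<Omega>l \<partial>lebesgue_on \<Omega>n)"
      using ES.euler_lagrange[OF U(2,3) WV] bilinear_representative[OF U(1,2) W WV] linear_part[OF W] gr by simp
  qed
qed

end

text \<open>It remains to choose Borel versions of the data. The versions of the kernels are also raised to the lower bounds of \<open>J\<close> and \<open>G\<close> near the diagonal, so that
those bounds hold everywhere and not just almost everywhere.\<close>

theorem theorem1p3: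
  fixes \<Omega> \<Omega>l \<Omega>n :: "'a::euclidean_space set"
    and \<delta> :: real
    and J :: "'a \<Rightarrow> real"
    and G :: "'a \<Rightarrow> 'a \<Rightarrow> real"
    and f :: "'a \<Rightarrow> real"
  assumes Omega: "open \<Omega>" "bounded \<Omega>"
    and subdomains: "open \<Omega>l" "open \<Omega>n" "\<Omega>l \<noteq> {}" "\<Omega>n \<noteq> {}" "\<Omega>l \<subseteq> \<Omega>" "\<Omega>n \<subseteq> \<Omega>" "\<Omega>l \<inter> \<Omega>n = {}"
      "\<Omega> = interior (closure \<Omega>l \<union> closure \<Omega>n)"
    and null_interface: "negligible (\<Omega> - (\<Omega>l \<union> \<Omega>n))"
    and delta: "\<delta> > 0"
    and local_domain: "connected \<Omega>l" "lipschitz_boundary \<Omega>l"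
    and nonlocal_domain: "delta_connected \<delta> \<Omega>n"
    and J: "J \<in> borel_measurable lebesgue" "\<And>z. J z \<ge> 0" "\<And>z. J (- z) = J z"
    and J1: "\<exists>C>0. \<forall>z. norm z \<le> 2 * \<delta> \<longrightarrow> J z > C"
    and J2: "compact_kernel J \<Omega>n"
    and G: "(\<lambda>(x, y). G x y) \<in> borel_measurable (lebesgue_on (\<Omega>l \<times> \<Omega>n))"
      "\<And>x y. x \<in> \<Omega>l \<Longrightarrow> y \<in> \<Omega>n \<Longrightarrow> G x y \<ge> 0"
    and G1: "\<exists>C>0. \<forall>x\<in>\<Omega>l. \<forall>y\<in>\<Omega>n. norm (x - y) \<le> 2 * \<delta> \<longrightarrow> G x y > C"
    and P1: "setdist \<Omega>l \<Omega>n < \<delta>"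
    and f: "f \<in> L2 \<Omega>" "(\<integral>x. f x \<partial>lebesgue_on \<Omega>) = 0"
  shows "(\<exists>u. is_minimizer_Neu \<Omega> \<Omega>l \<Omega>n J G f u) \<and>
    (\<forall>u v. is_minimizer_Neu \<Omega> \<Omega>l \<Omega>n J G f u \<and> is_minimizer_Neu \<Omega> \<Omega>l \<Omega>n J G f v \<longrightarrow>
       (AE x in lebesgue_on \<Omega>. u x = v x)) \<and>
    (\<forall>u. is_minimizer_Neu \<Omega> \<Omega>l \<Omega>n J G f u \<longrightarrow> weak_solution_Neu \<Omega> \<Omega>l \<Omega>n J G f u)"
proof -
  obtain CJ where CJ: "CJ > 0" "\<And>z. norm z \<le> 2 * \<delta> \<Longrightarrow> J z > CJ" using J1 by blast
  obtain CG where CG: "CG > 0" "\<And>x y. x \<in> \<Omega>l \<Longrightarrow> y \<in> \<Omega>n \<Longrightarrow> norm (x - y) \<le> 2 * \<delta> \<Longrightarrow> G x y > CG"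
    using G1 by blast
  have bor [measurable]: "\<Omega> \<in> sets borel" "\<Omega>l \<in> sets borel" "\<Omega>n \<in> sets borel" using Omega subdomains by auto
  obtain f' where f': "f' \<in> borel_measurable borel" "\<And>x. x \<notin> \<Omega> \<Longrightarrow> f' x = 0" "AE x in lborel. x \<in> \<Omega> \<longrightarrow> f x = f' x"
    using borel_representative[OF _ bor(1), of f] f(1) unfolding L2_def by blast
  have "(\<lambda>x. indicator \<Omega> x *\<^sub>R f' x) = f'" using f'(2) by (rule indicator_scaleR_self)
  then have f'_sq: "sq_integrable lborel f'"
    using L2_iff_representative[OF bor(1) f'(1,3)] f(1) by simp
  obtain J0 where J0 [measurable]: "J0 \<in> borel_measurable borel" and J0_eq: "AE z in lborel. J z = J0 z"
    using completion_ex_borel_measurable_real[OF J(1)] by auto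
  define J' where "J' z = max (J0 z) (if norm z \<le> 2 * \<delta> then CJ else 0)" for z
  have J'_meas: "J' \<in> borel_measurable borel" unfolding J'_def[abs_def] by measurable
  have J'_eq: "AE z in lborel. J z = J' z"
    using J0_eq
  proof eventually_elim
    case (elim z)
    then show ?case using CJ(2)[of z] J(2)[of z] by (auto simp: J'_def)
  qed
  have prod: "open (\<Omega>l \<times> \<Omega>n)" using subdomains by (intro open_Times)
  obtain G0 where G0: "G0 \<in> borel_measurable (borel :: ('a \<times> 'a) measure)"
    "AE z in lborel. z \<in> \<Omega>l \<times> \<Omega>n \<longrightarrow> (case z of (x, y) \<Rightarrow> G x y) = G0 z"
    using borel_representative[OF G(1) borel_open[OF prod]] by blast
  define G' where "G' x y = max (G0 (x, y)) (if norm (x - y) \<le> 2 * \<delta> then CG else 0)" for x y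
  have [measurable]: "G0 \<in> borel_measurable (borel \<Otimes>\<^sub>M borel)" using G0(1) by (simp add: borel_prod)
  have G'_meas: "(\<lambda>(x, y). G' x y) \<in> borel_measurable (borel \<Otimes>\<^sub>M borel)"
    unfolding G'_def[abs_def] case_prod_unfold by measurable
  have G'_eq: "AE y in lborel. AE x in lborel. x \<in> \<Omega>l \<longrightarrow> y \<in> \<Omega>n \<longrightarrow> G x y = G' x y"
  proof -
    obtain N where N: "{z. \<not> (z \<in> \<Omega>l \<times> \<Omega>n \<longrightarrow> (case z of (x, y) \<Rightarrow> G x y) = G0 z)} \<subseteq> N"
      "emeasure lborel N = 0" "N \<in> sets lborel"
      using AE_E[OF G0(2)] by auto
    have "N \<in> sets (lborel \<Otimes>\<^sub>M lborel)" using N(3) by (simp only: lborel_prod)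
    then have "space (lborel \<Otimes>\<^sub>M lborel) - N \<in> sets (lborel \<Otimes>\<^sub>M lborel)" by (rule sets.compl_sets)
    also have "space (lborel \<Otimes>\<^sub>M lborel) - N = {z \<in> space (lborel \<Otimes>\<^sub>M lborel). (fst z, snd z) \<notin> N}" by auto
    finally have swap: "(AE x in lborel. AE y in lborel. (x, y) \<notin> N) \<longleftrightarrow> (AE y in lborel. AE x in lborel. (x, y) \<notin> N)"
      by (rule lborel_pair.AE_commute)
    have "AE z in lborel. z \<notin> N" using N(2,3) by (intro AE_not_in) (auto simp: null_sets_def)
    then have "AE z in lborel \<Otimes>\<^sub>M lborel. z \<notin> N" by (simp only: lborel_prod)
    from lborel_pair.AE_pair[OF this] have "AE x in lborel. AE y in lborel. (x, y) \<notin> N" .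
    then have "AE y in lborel. AE x in lborel. (x, y) \<notin> N"
      by (simp only: swap)
    then show ?thesis
    proof eventually_elim
      case (elim y)
      then show ?case
      proof eventually_elim
        case (elim x)
        show ?case
        proof (intro impI)
          assume xy: "x \<in> \<Omega>l" "y \<in> \<Omega>n"
          then have "G x y = G0 (x, y)" using elim N(1) by auto
          then show "G x y = G' x y" using CG(2)[OF xy] G(2)[OF xy] by (auto simp: G'_def)
        qed
      qed
    qed
  qed
  define k where "k = (\<lambda>(x, y). indicator \<Omega>n x * indicator \<Omega>n y * J' (x - y) + indicator \<Omega>l x * indicator \<Omega>n y * G' x y)"
  have J'_nonneg: "J' z \<ge> 0" and G'_nonneg: "G' x y \<ge> 0" for z x y
    using CJ(1) CG(1) by (auto simp: J'_def G'_def le_max_iff_disj)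
  note [measurable] = J'_meas G'_meas
  interpret coupled_problem \<Omega> \<Omega>l \<Omega>n \<delta> "min CJ CG" k f' J J' G G' f
  proof
    have "k \<in> borel_measurable (borel \<Otimes>\<^sub>M borel)" unfolding k_def by measurable
    then show "k \<in> borel_measurable borel" by (simp add: borel_prod)
    show "AE x in lborel. x \<in> \<Omega> \<longrightarrow> x \<in> \<Omega>l \<union> \<Omega>n"
      using AE_lborel_negligible[OF null_interface] by eventually_elim auto
    show "min CJ CG \<le> k (x, y)" if "x \<in> \<Omega>l \<union> \<Omega>n" "y \<in> \<Omega>n" "dist x y \<le> 2 * \<delta>" for x y
      using that subdomains(7) J'_nonneg G'_nonneg by (auto simp: k_def J'_def G'_def dist_norm indicator_def)
    show "k z \<ge> 0" for z using J'_nonneg G'_nonneg by (cases z) (auto simp: k_def)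
  qed (use Omega subdomains local_domain nonlocal_domain delta P1 CJ(1) CG(1) f' f'_sq J'_meas J'_nonneg G'_meas G'_nonneg J'_eq G'_eq
      in \<open>auto simp: k_def\<close>)
  show ?thesis using existence_uniqueness_weak_solution by blast
qed

end
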